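(* There is an absolute constant $C\ge 1$ such that $$C^{-1}\operatorname{dist}_{L^1(\mathbb P)}(f,\mathcal A)\le \|Df\|_{L^1(\mathbb P^{\otimes 3})}\le 4\operatorname{dist}_{L^1(\mathbb P)}(f,\mathcal A)\qquad (f\in L^1(\mathbb P)).$$ Consequently $\ker D=\mathcal A$, and the map $$J:L^1(\mathbb P)/R\longrightarrow \mathbb R\oplus_1 L^1(\mathbb P^{\otimes 3}),\qquad J(f+R):=(\mathbb E f,\,Df),$$ is well defined and satisfies $$\frac1{2C}\|f+R\|_{L^1/R}\le \|J(f+R)\|\le 5\|f+R\|_{L^1/R}\qquad (f\in L^1(\mathbb P)).$$ Both $L^1(\mathbb P)/R$ and $L^1(\mathbb P)/\mathcal A$ therefore embed isomorphically into $L^1(0,1)$. One admissible value of $C$ is $C=B_0^5$, where $$\gamma=6^{7/3},\qquad A_0=2+\gamma,\qquad B_0=A_0+5\cdot 4^{1/5}(1+4A_0)^{4/5}.$$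
   Context: All Banach spaces are real. Let $\Delta=\{-1,1\}^{\mathbb N}$ with the product probability measure $\mathbb P=\bigotimes_{j\ge1}\frac12(\delta_{-1}+\delta_1)$, let $r_j(x)=x_j$ be the coordinate functions on $\Delta$, let $R$ be the closed linear span of $\{r_j:j\ge1\}$ in $L^1(\mathbb P)=L^1(\Delta,\mathbb P)$, and let $\mathcal A=\mathbb R\mathbf 1+R$ (a closed subspace; constants are not included in $R$). $\mathbb E f=\int f\,d\mathbb P$. Quotients carry the quotient norm, and $\oplus_1$ denotes the $\ell_1$-sum. For $x,y,\sigma\in\Delta$ define $z,w\in\Delta$ by $$z_j=\tfrac{1+\sigma_j}2x_j+\tfrac{1-\sigma_j}2y_j,\qquad w_j=\tfrac{1-\sigma_j}2x_j+\tfrac{1+\sigma_j}2y_j.$$ The operator $D:L^1(\mathbb P)\to L^1(\Delta^3,\mathbb P^{\otimes3})$ is $$Df(x,y,\sigma)=f(x)+f(y)-f(z)-f(w).$$ Under $\mathbb P^{\otimes 3}$ each of the four points $x,y,z,w$ has distribution $\mathbb P$, so $D$ is well defined on equivalence classes. *)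

theory Defs
  imports "HOL-Probability.Probability"
begin

section \<open>Normed spaces with explicit carriers\<close>

record 'v nspace =
  carr :: "'v set"
  zer :: 'v
  add :: "'v \<Rightarrow> 'v \<Rightarrow> 'v"
  scl :: "real \<Rightarrow> 'v \<Rightarrow> 'v"
  nrm :: "'v \<Rightarrow> real"

definition minus_on :: "'v nspace \<Rightarrow> 'v \<Rightarrow> 'v \<Rightarrow> 'v" where
  "minus_on X x y = add X x (scl X (- 1) y)"

definition dist_on :: "'v nspace \<Rightarrow> 'v \<Rightarrow> 'v set \<Rightarrow> real" where
  "dist_on X x S = (INF y\<in>S. nrm X (minus_on X x y))"

inductive_set lspan :: "'v nspace \<Rightarrow> 'v set \<Rightarrow> 'v set" for X and S where
  zero: "zer X \<in> lspan X S"
| base: "x \<in> S \<Longrightarrow> x \<in> lspan X S"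
| add: "x \<in> lspan X S \<Longrightarrow> y \<in> lspan X S \<Longrightarrow> add X x y \<in> lspan X S"
| scl: "x \<in> lspan X S \<Longrightarrow> scl X c x \<in> lspan X S"

definition closure_on :: "'v nspace \<Rightarrow> 'v set \<Rightarrow> 'v set" where
  "closure_on X S = {x \<in> carr X. \<forall>e>0. \<exists>y\<in>S. nrm X (minus_on X x y) < e}"

definition coset :: "'v nspace \<Rightarrow> 'v set \<Rightarrow> 'v \<Rightarrow> 'v set" where
  "coset X S x = add X x ` S"

text \<open>The vector space operations on a space of equivalence classes are computed on representatives.\<close>

definition rep :: "'v set \<Rightarrow> 'v" where
  "rep K = (SOME x. x \<in> K)"

definition quot_space :: "'v nspace \<Rightarrow> 'v set \<Rightarrow> 'v set nspace" where
  "quot_space X S =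
    \<lparr>carr = coset X S ` carr X,
     zer = coset X S (zer X),
     add = (\<lambda>K L. coset X S (add X (rep K) (rep L))),
     scl = (\<lambda>c K. coset X S (scl X c (rep K))),
     nrm = (\<lambda>K. INF x\<in>K. nrm X x)\<rparr>"

definition real_line :: "real nspace" where
  "real_line = \<lparr>carr = UNIV, zer = 0, add = (+), scl = (*), nrm = abs\<rparr>"

definition sum1 :: "'v nspace \<Rightarrow> 'w nspace \<Rightarrow> ('v \<times> 'w) nspace" where
  "sum1 X Y =
    \<lparr>carr = carr X \<times> carr Y,
     zer = (zer X, zer Y),
     add = (\<lambda>p q. (add X (fst p) (fst q), add Y (snd p) (snd q))),
     scl = (\<lambda>c p. (scl X c (fst p), scl Y c (snd p))),
     nrm = (\<lambda>p. nrm X (fst p) + nrm Y (snd p))\<rparr>"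

definition linear_map_on :: "'v nspace \<Rightarrow> 'w nspace \<Rightarrow> ('v \<Rightarrow> 'w) \<Rightarrow> bool" where
  "linear_map_on X Y T \<longleftrightarrow>
    T \<in> carr X \<rightarrow> carr Y \<and>
    (\<forall>x\<in>carr X. \<forall>y\<in>carr X. T (add X x y) = add Y (T x) (T y)) \<and>
    (\<forall>c. \<forall>x\<in>carr X. T (scl X c x) = scl Y c (T x))"

definition embeds_isomorphically :: "'v nspace \<Rightarrow> 'w nspace \<Rightarrow> bool" where
  "embeds_isomorphically X Y \<longleftrightarrow>
    (\<exists>T. linear_map_on X Y T \<and>
      (\<exists>c>0. \<exists>C. \<forall>x\<in>carr X. c * nrm X x \<le> nrm Y (T x) \<and> nrm Y (T x) \<le> C * nrm X x))"


section \<open>The Banach space of integrable functions modulo equality almost everywhere\<close>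

definition cls :: "'a measure \<Rightarrow> ('a \<Rightarrow> real) \<Rightarrow> ('a \<Rightarrow> real) set" where
  "cls M f = {g. integrable M g \<and> (AE x in M. g x = f x)}"

definition L1 :: "'a measure \<Rightarrow> ('a \<Rightarrow> real) set nspace" where
  "L1 M =
    \<lparr>carr = cls M ` {f. integrable M f},
     zer = cls M (\<lambda>x. 0),
     add = (\<lambda>F G. cls M (\<lambda>x. rep F x + rep G x)),
     scl = (\<lambda>c F. cls M (\<lambda>x. c * rep F x)),
     nrm = (\<lambda>F. \<integral>x. \<bar>rep F x\<bar> \<partial>M)\<rparr>"

lemma rep_cls:
  assumes "integrable M f"
  shows "integrable M (rep (cls M f))" "AE x in M. rep (cls M f) x = f x"
proof -
  have "f \<in> cls M f" using assms by (simp add: cls_def)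
  then have "rep (cls M f) \<in> cls M f" unfolding rep_def by (rule someI[where P = "\<lambda>h. h \<in> cls M f"])
  then show "integrable M (rep (cls M f))" "AE x in M. rep (cls M f) x = f x"
    by (simp_all add: cls_def)
qed

lemma cls_cong:
  assumes "AE x in M. f x = g x"
  shows "cls M f = cls M g"
proof -
  have "(AE x in M. h x = f x) \<longleftrightarrow> (AE x in M. h x = g x)" for h
    using assms by (auto elim: eventually_elim2)
  then show ?thesis by (simp add: cls_def)
qed

lemma cls_eq_iff:
  assumes "integrable M f"
  shows "cls M f = cls M g \<longleftrightarrow> (AE x in M. f x = g x)"
proof
  assume "cls M f = cls M g"
  then have "f \<in> cls M g" using assms by (auto simp: cls_def)
  then show "AE x in M. f x = g x" by (simp add: cls_def)
qed (rule cls_cong)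

lemma L1_add_cls:
  assumes "integrable M f" "integrable M g"
  shows "add (L1 M) (cls M f) (cls M g) = cls M (\<lambda>x. f x + g x)"
  unfolding L1_def nspace.simps
  by (rule cls_cong) (use rep_cls(2)[OF assms(1)] rep_cls(2)[OF assms(2)] in eventually_elim, simp)

lemma L1_scl_cls:
  assumes "integrable M f"
  shows "scl (L1 M) c (cls M f) = cls M (\<lambda>x. c * f x)"
  unfolding L1_def nspace.simps
  by (rule cls_cong) (use rep_cls(2)[OF assms] in eventually_elim, simp)

lemma L1_nrm_cls:
  assumes "integrable M f"
  shows "nrm (L1 M) (cls M f) = (\<integral>x. \<bar>f x\<bar> \<partial>M)"
  unfolding L1_def nspace.simps
  by (rule integral_cong_AE)
    (use rep_cls[OF assms] assms in \<open>auto elim!: eventually_mono\<close>)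


section \<open>The cube and the operator D\<close>

text \<open>Coordinates are indexed by \<^typ>\<open>nat\<close> starting from 0. The space of the measure
  below is the set of all sequences with values in \<open>{-1, 1}\<close>.\<close>

definition cube :: "(nat \<Rightarrow> real) measure" where
  "cube = (\<Pi>\<^sub>M j\<in>UNIV. uniform_count_measure {- 1, 1})"

definition cube3 :: "((nat \<Rightarrow> real) \<times> (nat \<Rightarrow> real) \<times> (nat \<Rightarrow> real)) measure" where
  "cube3 = cube \<Otimes>\<^sub>M (cube \<Otimes>\<^sub>M cube)"

definition one :: "((nat \<Rightarrow> real) \<Rightarrow> real) set" where
  "one = cls cube (\<lambda>x. 1)"

definition rademacher :: "nat \<Rightarrow> ((nat \<Rightarrow> real) \<Rightarrow> real) set" where
  "rademacher j = cls cube (\<lambda>x. x j)"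

definition R_space :: "((nat \<Rightarrow> real) \<Rightarrow> real) set set" where
  "R_space = closure_on (L1 cube) (lspan (L1 cube) (range rademacher))"

definition A_space :: "((nat \<Rightarrow> real) \<Rightarrow> real) set set" where
  "A_space = {add (L1 cube) (scl (L1 cube) c one) r | c r. r \<in> R_space}"

definition expect :: "((nat \<Rightarrow> real) \<Rightarrow> real) set \<Rightarrow> real" where
  "expect F = (\<integral>x. rep F x \<partial>cube)"

definition mix_z :: "(nat \<Rightarrow> real) \<Rightarrow> (nat \<Rightarrow> real) \<Rightarrow> (nat \<Rightarrow> real) \<Rightarrow> (nat \<Rightarrow> real)" where
  "mix_z x y s = (\<lambda>j. (1 + s j) / 2 * x j + (1 - s j) / 2 * y j)"

definition mix_w :: "(nat \<Rightarrow> real) \<Rightarrow> (nat \<Rightarrow> real) \<Rightarrow> (nat \<Rightarrow> real) \<Rightarrow> (nat \<Rightarrow> real)" where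
  "mix_w x y s = (\<lambda>j. (1 - s j) / 2 * x j + (1 + s j) / 2 * y j)"

definition D_fun ::
  "((nat \<Rightarrow> real) \<Rightarrow> real) \<Rightarrow> (nat \<Rightarrow> real) \<times> (nat \<Rightarrow> real) \<times> (nat \<Rightarrow> real) \<Rightarrow> real" where
  "D_fun f = (\<lambda>(x, y, s). f x + f y - f (mix_z x y s) - f (mix_w x y s))"

definition D_op ::
  "((nat \<Rightarrow> real) \<Rightarrow> real) set \<Rightarrow> ((nat \<Rightarrow> real) \<times> (nat \<Rightarrow> real) \<times> (nat \<Rightarrow> real) \<Rightarrow> real) set" where
  "D_op F = cls cube3 (D_fun (rep F))"

definition two_sided_bound :: "real \<Rightarrow> bool" where
  "two_sided_bound C \<longleftrightarrow>
    (\<forall>F\<in>carr (L1 cube).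
      1 / C * dist_on (L1 cube) F A_space \<le> nrm (L1 cube3) (D_op F) \<and>
      nrm (L1 cube3) (D_op F) \<le> 4 * dist_on (L1 cube) F A_space)"

definition const_gamma :: real where
  "const_gamma = 6 powr (7 / 3)"

definition const_A0 :: real where
  "const_A0 = 2 + const_gamma"

definition const_B0 :: real where
  "const_B0 = const_A0 + 5 * 4 powr (1 / 5) * (1 + 4 * const_A0) powr (4 / 5)"

lemma expect_cls:
  assumes "integrable cube f"
  shows "expect (cls cube f) = (\<integral>x. f x \<partial>cube)"
  unfolding expect_def
  by (rule integral_cong_AE) (use rep_cls[OF assms] assms in auto)

lemma prob_space_coin: "prob_space (uniform_count_measure {- 1, 1 :: real})"
  by (rule prob_space_uniform_count_measure) auto

interpretation coin: product_prob_space "\<lambda>_. uniform_count_measure {- 1, 1 :: real}" UNIV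
  by (intro product_prob_spaceI prob_space_coin)

interpretation cube: prob_space cube
  unfolding cube_def by (rule coin.P.prob_space_axioms)

interpretation cube2: prob_space "cube \<Otimes>\<^sub>M cube"
  by (intro prob_space_pair cube.prob_space_axioms)

interpretation cube3: prob_space cube3
  unfolding cube3_def by (intro prob_space_pair cube.prob_space_axioms cube2.prob_space_axioms)

lemma space_cube: "space cube = {x. \<forall>j. x j \<in> {- 1, 1}}"
  by (auto simp: cube_def space_PiM PiE_iff space_uniform_count_measure)

lemma space_cube3: "space cube3 = space cube \<times> space cube \<times> space cube"
  by (simp add: cube3_def space_pair_measure)

lemma measurable_coordinate [measurable]:
  "(\<lambda>x. x j) \<in> measurable cube (count_space {- 1, 1})"
  unfolding cube_def by measurable

lemma measurable_coordinate3:
  "(\<lambda>(x, y, s). x j) \<in> measurable cube3 (count_space {- 1, 1})"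
  "(\<lambda>(x, y, s). y j) \<in> measurable cube3 (count_space {- 1, 1})"
  "(\<lambda>(x, y, s). s j) \<in> measurable cube3 (count_space {- 1, 1})"
  unfolding cube3_def by measurable

lemma measurable_to_cube:
  assumes "\<And>j. (\<lambda>p. h p j) \<in> measurable M (count_space {- 1, 1})"
  shows "h \<in> measurable M cube"
  unfolding cube_def
  by (rule measurable_PiM_single')
    (use assms measurable_space[OF assms] in
      \<open>auto simp: measurable_cong_sets[OF refl sets_uniform_count_measure_count_space]
        space_uniform_count_measure\<close>)

lemma mix_if:
  assumes "s \<in> space cube"
  shows "mix_z x y s j = (if s j = 1 then x j else y j)"
    "mix_w x y s j = (if s j = 1 then y j else x j)"
proof -
  have "s j = 1 \<or> s j = - 1" using assms by (auto simp: space_cube)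
  then show "mix_z x y s j = (if s j = 1 then x j else y j)"
    "mix_w x y s j = (if s j = 1 then y j else x j)"
    by (auto simp: mix_z_def mix_w_def)
qed

lemma measurable_mix:
  "(\<lambda>(x, y, s). mix_z x y s) \<in> measurable cube3 cube"
  "(\<lambda>(x, y, s). mix_w x y s) \<in> measurable cube3 cube"
proof -
  note [measurable] = measurable_coordinate3[unfolded case_prod_beta]
  have *: "(\<lambda>p. if snd (snd p) j = 1 then fst p j else fst (snd p) j)
      \<in> measurable cube3 (count_space {- 1, 1})"
    "(\<lambda>p. if snd (snd p) j = 1 then fst (snd p) j else fst p j)
      \<in> measurable cube3 (count_space {- 1, 1})" for j
    by measurable
  have "(\<lambda>p. mix_z (fst p) (fst (snd p)) (snd (snd p)) j)
      \<in> measurable cube3 (count_space {- 1, 1})" for j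
    by (rule measurable_cong[THEN iffD2, OF _ *(1)[of j]]) (auto simp: space_cube3 mix_if)
  moreover have "(\<lambda>p. mix_w (fst p) (fst (snd p)) (snd (snd p)) j)
      \<in> measurable cube3 (count_space {- 1, 1})" for j
    by (rule measurable_cong[THEN iffD2, OF _ *(2)[of j]]) (auto simp: space_cube3 mix_if)
  ultimately show "(\<lambda>(x, y, s). mix_z x y s) \<in> measurable cube3 cube"
    "(\<lambda>(x, y, s). mix_w x y s) \<in> measurable cube3 cube"
    by (auto intro!: measurable_to_cube simp: case_prod_beta)
qed

lemma nn_integral_cube_prod:
  fixes h :: "nat \<Rightarrow> real \<Rightarrow> ennreal"
  assumes "finite J"
  shows "(\<integral>\<^sup>+x. (\<Prod>j\<in>J. h j (x j)) \<partial>cube) = (\<Prod>j\<in>J. (h j 1 + h j (- 1)) / 2)"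
proof -
  let ?U = "uniform_count_measure {- 1, 1 :: real}"
  have m: "h j \<in> borel_measurable ?U" for j
    by (simp add: measurable_cong_sets[OF sets_uniform_count_measure_count_space refl])
  have "(\<integral>\<^sup>+x. (\<Prod>j\<in>J. h j (x j)) \<partial>cube)
      = (\<integral>\<^sup>+x. (\<Prod>j\<in>J. h j (x j)) \<partial>distr cube (PiM J (\<lambda>_. ?U)) (\<lambda>x. restrict x J))"
    unfolding cube_def
    by (subst nn_integral_distr)
      (auto intro!: borel_measurable_prod_ennreal measurable_compose[OF _ m])
  also have "\<dots> = (\<integral>\<^sup>+x. (\<Prod>j\<in>J. h j (x j)) \<partial>PiM J (\<lambda>_. ?U))"
    unfolding cube_def by (subst coin.distr_PiM_restrict_finite) (use assms in auto)
  also have "\<dots> = (\<Prod>j\<in>J. \<integral>\<^sup>+t. h j t \<partial>?U)"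
    by (rule coin.product_nn_integral_prod[OF assms m])
  also have "\<dots> = (\<Prod>j\<in>J. (h j 1 + h j (- 1)) / 2)"
  proof (rule prod.cong[OF refl])
    fix j
    have "ennreal (1 / 2) = 1 / 2"
      using divide_ennreal[of 1 2] by simp
    then show "(\<integral>\<^sup>+t. h j t \<partial>?U) = (h j 1 + h j (- 1)) / 2"
      unfolding uniform_count_measure_def
      by (subst nn_integral_point_measure_finite)
        (simp_all add: divide_ennreal_def distrib_left add.commute mult.commute)
  qed
  finally show ?thesis .
qed

lemma nn_integral_cube3:
  assumes "f \<in> borel_measurable cube3"
  shows "(\<integral>\<^sup>+p. f p \<partial>cube3) = (\<integral>\<^sup>+x. \<integral>\<^sup>+y. \<integral>\<^sup>+s. f (x, y, s) \<partial>cube \<partial>cube \<partial>cube)"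
proof -
  have [measurable]: "f \<in> borel_measurable (cube \<Otimes>\<^sub>M (cube \<Otimes>\<^sub>M cube))"
    using assms by (simp add: cube3_def)
  show ?thesis
    unfolding cube3_def
    by (subst cube2.nn_integral_fst[symmetric], measurable,
        intro nn_integral_cong, subst cube.nn_integral_fst[symmetric]) measurable
qed

lemma distr_select:
  assumes m: "h \<in> measurable cube3 cube"
    and e: "e = 1 \<or> e = (- 1 :: real)"
    and h: "\<And>x y s j. s \<in> space cube \<Longrightarrow> h (x, y, s) j = (if s j = e then x j else y j)"
  shows "distr cube3 cube h = cube"
proof -
  let ?U = "uniform_count_measure {- 1, 1 :: real}"
  have "distr cube3 cube h = PiM UNIV (\<lambda>_. ?U)"
  proof (rule measure_eqI_PiM_infinite)
    show "sets (distr cube3 cube h) = sets (PiM UNIV (\<lambda>_. ?U))" by (simp add: cube_def)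
    show "finite_measure (distr cube3 cube h)"
      by (intro prob_space.finite_measure cube3.prob_space_distr m)
    fix A and J :: "nat set"
    assume J: "finite J" and A: "\<And>j. j \<in> J \<Longrightarrow> A j \<in> sets ?U"
    let ?E = "prod_emb UNIV (\<lambda>_. ?U) J (Pi\<^sub>E J A)"
    let ?i = "\<lambda>j. indicator (A j) :: real \<Rightarrow> ennreal"
    have E: "?E \<in> sets cube"
      unfolding cube_def by (intro sets_PiM_I) (use J A in auto)
    have ind: "indicator ?E x = (\<Prod>j\<in>J. ?i j (x j))" if "x \<in> space cube" for x
    proof (cases "\<forall>j\<in>J. x j \<in> A j")
      case True
      then show ?thesis
        using that by (auto simp: indicator_def prod_emb_def cube_def space_PiM PiE_iff)
    next
      case False
      then have "(\<Prod>j\<in>J. ?i j (x j)) = 0" using J by (auto simp: indicator_def)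
      then show ?thesis using False by (auto simp: indicator_def prod_emb_def PiE_iff)
    qed
    have half: "(a + a) / 2 = a" for a :: ennreal
      by (simp add: mult_2[symmetric] ennreal_mult_divide_eq mult.commute)
    have two: "(if (1::real) = e then a else b) + (if - 1 = e then a else b) = a + b"
      for a b :: ennreal
      using e by (auto simp: add.commute)
    have E': "(\<Prod>j\<in>J. (?i j 1 + ?i j (- 1)) / 2) = emeasure cube ?E"
    proof -
      have "emeasure cube ?E = (\<integral>\<^sup>+x. (\<Prod>j\<in>J. ?i j (x j)) \<partial>cube)"
        using E by (simp add: ind flip: nn_integral_indicator cong: nn_integral_cong)
      then show ?thesis
        using nn_integral_cube_prod[OF J, of ?i] by (simp only:)
    qed
    have "emeasure (distr cube3 cube h) ?E = (\<integral>\<^sup>+p. indicator ?E (h p) \<partial>cube3)"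
      using m E by (simp add: nn_integral_distr flip: nn_integral_indicator)
    also have "\<dots> = (\<integral>\<^sup>+x. \<integral>\<^sup>+y. \<integral>\<^sup>+s. indicator ?E (h (x, y, s)) \<partial>cube \<partial>cube \<partial>cube)"
      by (rule nn_integral_cube3) (rule measurable_compose[OF m], use E in simp)
    also have "\<dots> = (\<integral>\<^sup>+x. \<integral>\<^sup>+y. \<integral>\<^sup>+s.
        (\<Prod>j\<in>J. if s j = e then ?i j (x j) else ?i j (y j)) \<partial>cube \<partial>cube \<partial>cube)"
    proof (intro nn_integral_cong)
      fix x y s assume *: "x \<in> space cube" "y \<in> space cube" "s \<in> space cube"
      then have "h (x, y, s) \<in> space cube"
        using measurable_space[OF m] by (simp add: space_cube3)
      then show "indicator ?E (h (x, y, s))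
          = (\<Prod>j\<in>J. if s j = e then ?i j (x j) else ?i j (y j))"
        using * by (simp add: ind h) (intro prod.cong; simp)
    qed
    also have "\<dots> = (\<integral>\<^sup>+x. \<integral>\<^sup>+y. (\<Prod>j\<in>J. (?i j (x j) + ?i j (y j)) / 2) \<partial>cube \<partial>cube)"
    proof (intro nn_integral_cong)
      fix x y :: "nat \<Rightarrow> real"
      show "(\<integral>\<^sup>+s. (\<Prod>j\<in>J. if s j = e then ?i j (x j) else ?i j (y j)) \<partial>cube)
          = (\<Prod>j\<in>J. (?i j (x j) + ?i j (y j)) / 2)"
        using nn_integral_cube_prod[OF J, of "\<lambda>j t. if t = e then ?i j (x j) else ?i j (y j)"]
        by (simp only: two)
    qed
    also have "\<dots> = (\<integral>\<^sup>+x. (\<Prod>j\<in>J.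
        ((?i j (x j) + ?i j 1) / 2 + (?i j (x j) + ?i j (- 1)) / 2) / 2) \<partial>cube)"
      by (intro nn_integral_cong nn_integral_cube_prod[OF J])
    also have "\<dots> = (\<Prod>j\<in>J. (((?i j 1 + ?i j 1) / 2 + (?i j 1 + ?i j (- 1)) / 2) / 2
        + ((?i j (- 1) + ?i j 1) / 2 + (?i j (- 1) + ?i j (- 1)) / 2) / 2) / 2)"
      by (rule nn_integral_cube_prod[OF J])
    also have "\<dots> = (\<Prod>j\<in>J. (?i j 1 + ?i j (- 1)) / 2)"
    proof (rule prod.cong[OF refl])
      fix j
      have add_half: "a / 2 + b / 2 = (a + b) / 2" for a b :: ennreal
        by (simp add: divide_ennreal_def distrib_right)
      have "(?i j 1 + ?i j 1) + (?i j 1 + ?i j (- 1))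
          + ((?i j (- 1) + ?i j 1) + (?i j (- 1) + ?i j (- 1)))
          = (?i j 1 + ?i j (- 1) + (?i j 1 + ?i j (- 1)))
          + (?i j 1 + ?i j (- 1) + (?i j 1 + ?i j (- 1)))"
        by (simp add: algebra_simps)
      then show "(((?i j 1 + ?i j 1) / 2 + (?i j 1 + ?i j (- 1)) / 2) / 2
        + ((?i j (- 1) + ?i j 1) / 2 + (?i j (- 1) + ?i j (- 1)) / 2) / 2) / 2
          = (?i j 1 + ?i j (- 1)) / 2"
        by (simp only: add_half) (simp only: half)
    qed
    finally show "emeasure (distr cube3 cube h) ?E = emeasure (PiM UNIV (\<lambda>_. ?U)) ?E"
      by (simp only: E') (simp add: cube_def)
  qed simp
  then show ?thesis by (simp add: cube_def)
qed

lemma distr_points: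
  "distr cube3 cube (\<lambda>(x, y, s). x) = cube"
  "distr cube3 cube (\<lambda>(x, y, s). y) = cube"
  "distr cube3 cube (\<lambda>(x, y, s). mix_z x y s) = cube"
  "distr cube3 cube (\<lambda>(x, y, s). mix_w x y s) = cube"
proof -
  show "distr cube3 cube (\<lambda>(x, y, s). mix_z x y s) = cube"
    by (rule distr_select[where e = 1]) (auto simp: measurable_mix mix_if)
  have "s j = 1 \<longleftrightarrow> s j \<noteq> - 1" if "s \<in> space cube" for s j
    using that by (force simp: space_cube)
  then show "distr cube3 cube (\<lambda>(x, y, s). mix_w x y s) = cube"
    by (intro distr_select[where e = "- 1"]) (auto simp: measurable_mix mix_if)
  have x: "(\<lambda>(x, y, s). x) \<in> measurable cube3 cube" "(\<lambda>(x, y, s). y) \<in> measurable cube3 cube"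
    unfolding cube3_def by measurable
  have *: "emeasure (distr cube3 cube h) E = (\<integral>\<^sup>+x. \<integral>\<^sup>+y. \<integral>\<^sup>+s.
      indicator E (h (x, y, s)) \<partial>cube \<partial>cube \<partial>cube)"
    if h: "h \<in> measurable cube3 cube" and E: "E \<in> sets cube" for h E
  proof -
    have "emeasure (distr cube3 cube h) E = (\<integral>\<^sup>+p. indicator E (h p) \<partial>cube3)"
      using h E by (simp add: nn_integral_distr flip: nn_integral_indicator)
    then show ?thesis
      using nn_integral_cube3[OF measurable_compose[OF h, of "indicator E" borel]] E by simp
  qed
  show "distr cube3 cube (\<lambda>(x, y, s). x) = cube"
    by (rule measure_eqI) (auto simp: *[OF x(1)] cube.emeasure_space_1)
  show "distr cube3 cube (\<lambda>(x, y, s). y) = cube"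
    by (rule measure_eqI) (auto simp: *[OF x(2)] cube.emeasure_space_1)
qed

lemma D_fun_integrable:
  assumes "integrable cube f"
  shows "integrable cube3 (D_fun f)"
proof -
  have *: "integrable cube3 (\<lambda>p. f (h p))"
    if "h \<in> measurable cube3 cube" "distr cube3 cube h = cube" for h
    using that assms by (metis integrable_distr)
  have x: "(\<lambda>(x, y, s). x) \<in> measurable cube3 cube" "(\<lambda>(x, y, s). y) \<in> measurable cube3 cube"
    unfolding cube3_def by measurable
  show ?thesis
    using *[OF x(1) distr_points(1)] *[OF x(2) distr_points(2)]
      *[OF measurable_mix(1) distr_points(3)] *[OF measurable_mix(2) distr_points(4)]
    unfolding D_fun_def case_prod_beta by (intro Bochner_Integration.integrable_add Bochner_Integration.integrable_diff)
qed

lemma D_op_cls: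
  assumes "integrable cube f"
  shows "D_op (cls cube f) = cls cube3 (D_fun f)"
proof -
  let ?g = "rep (cls cube f)"
  have *: "AE p in cube3. ?g (h p) = f (h p)"
    if "h \<in> measurable cube3 cube" "distr cube3 cube h = cube" for h
    by (rule AE_distrD[OF that(1)]) (use rep_cls(2)[OF assms] in \<open>simp only: that(2)\<close>)
  have x: "(\<lambda>(x, y, s). x) \<in> measurable cube3 cube" "(\<lambda>(x, y, s). y) \<in> measurable cube3 cube"
    unfolding cube3_def by measurable
  show ?thesis
    unfolding D_op_def
    by (rule cls_cong)
      (use *[OF x(1) distr_points(1)] *[OF x(2) distr_points(2)]
        *[OF measurable_mix(1) distr_points(3)] *[OF measurable_mix(2) distr_points(4)]
        in eventually_elim, auto simp: D_fun_def)
qed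

end

theory Submission
  imports Defs
begin

text \<open>Both \<open>(x, y)\<close> and \<open>(z, w)\<close> are pairs of independent uniform points, whereas \<open>x\<close> and \<open>z\<close>
agree in each coordinate with probability \<open>3/4\<close>, and likewise for \<open>x, w\<close>, for \<open>y, z\<close> and for \<open>y, w\<close>.
With the noise operator \<open>T\<close> that multiplies a Walsh function of degree \<open>k\<close> by \<open>2^(-k)\<close>, expanding
the square gives \<open>\<parallel>Df\<parallel>\<^sub>2^2 = 4 \<parallel>f\<parallel>\<^sub>2^2 + 4 (E f)^2 - 8 \<langle>f, T f\<rangle>\<close>. On degree at least 2 one has
\<open>\<langle>f, T f\<rangle> \<le> \<parallel>f\<parallel>\<^sub>2^2 / 4\<close>, so in \<open>L^2\<close> the distance of \<open>f\<close> from the affine functions is at most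
\<open>\<parallel>Df\<parallel>\<^sub>2 / sqrt 2\<close> (\<open>exists_affine_L2_defect\<close>).

The passage to \<open>L^1\<close> rests on a gain of integrability. If \<open>\<bar>f x\<bar> > 4 t\<close>, then one of \<open>\<bar>f y\<bar>\<close>,
\<open>\<bar>f z\<bar>\<close>, \<open>\<bar>f w\<bar>\<close>, \<open>\<bar>Df\<bar>\<close> exceeds \<open>t\<close>. It is rare that both \<open>\<bar>f x\<bar>\<close> and \<open>\<bar>f y\<bar>\<close> are large,
by independence; and for \<open>x\<close> and \<open>z\<close>, or \<open>x\<close> and \<open>w\<close>, the inequality \<open>\<parallel>T g\<parallel>\<^sub>4 \<le> \<parallel>g\<parallel>\<^sub>2\<close>
(\<open>noise_hypercontractive\<close>) serves as a substitute for independence. The tails therefore satisfy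
\<open>P(\<bar>f\<bar> > 4 t) \<le> 216 P(\<bar>f\<bar> > t)^2 + 2 P(\<bar>Df\<bar> > t)\<close> (\<open>tail_recursion\<close>).
Starting from the bound \<open>1 / t\<close> of Markov, two rounds of this leave tails of order \<open>t^(-4)\<close>, apart from the
tails of \<open>Df\<close> itself. Hence, if \<open>\<parallel>f\<parallel>\<^sub>1 \<le> 1\<close> and \<open>\<parallel>Df\<parallel>\<^sub>1\<close> is tiny, truncating \<open>f\<close> at a suitable
absolute height costs almost nothing in \<open>L^1\<close>, and the bounded part is handled in \<open>L^2\<close>. This brings \<open>f\<close>
within \<open>9/10\<close> of an affine function (\<open>affine_contraction\<close>). As \<open>D\<close> vanishes on affine functions, the step
can be repeated until the distance is at most \<open>10^11 \<parallel>Df\<parallel>\<^sub>1\<close> (\<open>affine_approximation\<close>), and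
\<open>10^11 \<le> B\<^sub>0^5\<close>.

All of this takes place on finite cubes, where integrals are averages over words and the basic inequalities
are inductions on the word length. Functions of finitely many coordinates are dense in \<open>L^1\<close>, which gives the
two-sided bound in general, and with it the kernel of \<open>D\<close> and the estimates for \<open>J\<close>.

For the embeddings, \<open>E (Df) = 0\<close>, so \<open>\<bar>E f\<bar>\<close> and \<open>\<parallel>Df\<parallel>\<^sub>1\<close> are both controlled by the norm of the single
function \<open>E f + Df\<close>; therefore \<open>f \<mapsto> E f + Df\<close> embeds \<open>L^1/R\<close> in \<open>L^1\<close> of the triple cube, and
\<open>D\<close> embeds \<open>L^1/A\<close> there. Binary digits, split into three subsequences, define a measure preserving map from
the unit interval to the triple cube, and composition with it is an isometry into \<open>L^1(0,1)\<close>
(\<open>distr_coding\<close>).\<close>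

section \<open>Averages over words\<close>

primrec avg :: "nat \<Rightarrow> ('a::finite list \<Rightarrow> real) \<Rightarrow> real" where
  "avg 0 f = f []"
| "avg (Suc n) f = (\<Sum>a\<in>UNIV. avg n (\<lambda>l. f (a # l))) / CARD('a)"

lemma avg_add: "avg n (\<lambda>l. f l + g l) = avg n f + avg n g"
  by (induction n arbitrary: f g) (simp_all add: sum.distrib add_divide_distrib)

lemma avg_cmult: "avg n (\<lambda>l. c * f l) = c * avg n f"
  by (induction n arbitrary: f) (simp_all add: sum_distrib_left)

lemma avg_divide: "avg n (\<lambda>l. f l / c) = avg n f / c"
  using avg_cmult[of n "inverse c" f] by (simp add: field_simps)

lemma avg_diff: "avg n (\<lambda>l. f l - g l) = avg n f - avg n g"
  using avg_add[of n f "\<lambda>l. (- 1) * g l"] by (simp only: avg_cmult) simp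

lemma avg_const [simp]: "avg n (\<lambda>l. c) = c"
  by (induction n) simp_all

lemma avg_mono:
  assumes "\<And>l. length l = n \<Longrightarrow> f l \<le> g l"
  shows "avg n f \<le> avg n g"
  using assms
  by (induction n arbitrary: f g) (auto intro!: divide_right_mono sum_mono)

lemma avg_cong:
  assumes "\<And>l. length l = n \<Longrightarrow> f l = g l"
  shows "avg n f = avg n g"
  by (rule antisym) (auto intro!: avg_mono simp: assms)

lemma avg_nonneg: "(\<And>l. 0 \<le> f l) \<Longrightarrow> 0 \<le> avg n f"
  using avg_mono[of n "\<lambda>_. 0" f] by simp

lemma avg_sum: "finite I \<Longrightarrow> avg n (\<lambda>l. \<Sum>i\<in>I. f i l) = (\<Sum>i\<in>I. avg n (f i))"
  by (induction I rule: finite_induct) (simp_all add: avg_add)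

text \<open>The discriminant of the nonnegative quadratic polynomial \<open>s \<mapsto> avg ((u + s v)^2)\<close>.\<close>

lemma avg_Cauchy_Schwarz:
  "(avg n (\<lambda>l. u l * v l))\<^sup>2 \<le> avg n (\<lambda>l. (u l)\<^sup>2) * avg n (\<lambda>l. (v l)\<^sup>2)"
proof -
  define a b c where "a = avg n (\<lambda>l. (u l)\<^sup>2)" and "b = avg n (\<lambda>l. (v l)\<^sup>2)"
    and "c = avg n (\<lambda>l. u l * v l)"
  have pos: "a \<ge> 0" "b \<ge> 0" by (auto simp: a_def b_def intro!: avg_nonneg)
  have q: "0 \<le> a + 2 * s * c + s\<^sup>2 * b" for s
  proof -
    have "0 \<le> avg n (\<lambda>l. (u l + s * v l)\<^sup>2)" by (rule avg_nonneg) simp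
    also have "(\<lambda>l. (u l + s * v l)\<^sup>2) = (\<lambda>l. (u l)\<^sup>2 + ((2 * s) * (u l * v l) + s\<^sup>2 * (v l)\<^sup>2))"
      by (rule ext) (simp add: power2_eq_square algebra_simps)
    finally show ?thesis by (simp add: avg_add avg_cmult a_def b_def c_def)
  qed
  have "c\<^sup>2 \<le> a * b"
  proof (cases "b = 0")
    case True
    have "c = 0"
    proof (rule ccontr)
      assume "c \<noteq> 0"
      \<comment> \<open>For \<open>b = 0\<close> the polynomial is affine in \<open>s\<close>, and this \<open>s\<close> makes it negative.\<close>
      then have "a + 2 * (- (a + 1) / c) * c = - a - 2" by (simp add: field_simps)
      then show False using q[of "- (a + 1) / c"] True pos by simp
    qed
    then show ?thesis using pos by simp
  next
    case False
    then have "b > 0" using pos by simp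
    then show ?thesis using q[of "- c / b"]
      by (simp add: field_simps power2_eq_square)
  qed
  then show ?thesis by (simp add: a_def b_def c_def)
qed

lemma avg_abs_le_L2: "(avg n (\<lambda>l. \<bar>f l\<bar>))\<^sup>2 \<le> avg n (\<lambda>l. (f l)\<^sup>2)"
  using avg_Cauchy_Schwarz[of n "\<lambda>l. \<bar>f l\<bar>" "\<lambda>_. 1"] by simp

section \<open>The noise operator on the finite cube\<close>

text \<open>The value at \<open>l\<close> of \<open>T f\<close>: each bit of \<open>l\<close> is kept with probability \<open>3/4\<close> and flipped with
probability \<open>1/4\<close>, independently.\<close>

primrec noise :: "bool list \<Rightarrow> (bool list \<Rightarrow> real) \<Rightarrow> real" where
  "noise [] f = f []"
| "noise (b # l) f = 3 / 4 * noise l (\<lambda>m. f (b # m)) + 1 / 4 * noise l (\<lambda>m. f ((\<not> b) # m))"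

lemma noise_add: "noise l (\<lambda>m. f m + g m) = noise l f + noise l g"
  by (induction l arbitrary: f g) (simp_all add: algebra_simps)

lemma noise_diff: "noise l (\<lambda>m. f m - g m) = noise l f - noise l g"
proof (induction l arbitrary: f g)
  case (Cons b l)
  show ?case unfolding noise.simps Cons by (simp add: algebra_simps)
qed simp

text \<open>Inductions on the word length write \<open>f = g + \<epsilon> h\<close>, where \<open>\<epsilon>\<close> is the sign of the first bit and
\<open>g = head_even f\<close>, \<open>h = head_odd f\<close> depend on the remaining bits. Then \<open>T f = T g + \<epsilon>/2 T h\<close>, and
\<open>\<epsilon>\<close> is orthogonal to the functions of the remaining bits.\<close>

definition head_even :: "(bool list \<Rightarrow> real) \<Rightarrow> bool list \<Rightarrow> real" where
  "head_even f l = (f (True # l) + f (False # l)) / 2"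

definition head_odd :: "(bool list \<Rightarrow> real) \<Rightarrow> bool list \<Rightarrow> real" where
  "head_odd f l = (f (True # l) - f (False # l)) / 2"

lemma head_split:
  "(\<lambda>l. f (True # l)) = (\<lambda>l. head_even f l + head_odd f l)"
  "(\<lambda>l. f (False # l)) = (\<lambda>l. head_even f l - head_odd f l)"
  by (auto simp: head_even_def head_odd_def field_simps)

lemma noise_Cons:
  "noise (True # l) f = noise l (head_even f) + noise l (head_odd f) / 2"
  "noise (False # l) f = noise l (head_even f) - noise l (head_odd f) / 2"
  unfolding noise.simps simp_thms head_split noise_add noise_diff
  by (simp_all add: field_simps)

lemma avg_Suc_bool: "avg (Suc n) f = avg n (\<lambda>l. (f (True # l) + f (False # l)) / 2)"
  using avg_cmult[of n "1/2" "\<lambda>l. f (True # l) + f (False # l)"]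
  by (simp add: UNIV_bool avg_add)

lemma avg_Suc_head_even: "avg (Suc n) f = avg n (head_even f)"
  by (simp only: avg_Suc_bool head_even_def[abs_def])

lemma avg_sq_Suc:
  "avg (Suc n) (\<lambda>l. (f l)\<^sup>2) = avg n (\<lambda>l. (head_even f l)\<^sup>2) + avg n (\<lambda>l. (head_odd f l)\<^sup>2)"
  unfolding avg_Suc_bool avg_add[symmetric]
  by (rule avg_cong) (simp add: head_even_def head_odd_def power2_eq_square field_simps)

text \<open>The Bonami inequality \<open>\<parallel>T g\<parallel>\<^sub>4 \<le> \<parallel>g\<parallel>\<^sub>2\<close>. In \<open>E (T g + \<epsilon>/2 T h)^4\<close> the odd powers of
\<open>\<epsilon>\<close> average out, the mixed term is bounded by the Cauchy-Schwarz inequality, and the three coefficients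
\<open>1\<close>, \<open>3/2\<close>, \<open>1/16\<close> that remain are at most those of \<open>(\<parallel>g\<parallel>\<^sub>2^2 + \<parallel>h\<parallel>\<^sub>2^2)^2\<close>.\<close>

lemma noise_hypercontractive:
  "avg n (\<lambda>l. (noise l f) ^ 4) \<le> (avg n (\<lambda>l. (f l)\<^sup>2))\<^sup>2"
proof (induction n arbitrary: f)
  case (Suc n)
  let ?g = "head_even f" and ?h = "head_odd f"
  let ?A = "avg n (\<lambda>l. (?g l)\<^sup>2)" and ?B = "avg n (\<lambda>l. (?h l)\<^sup>2)"
  have pos: "?A \<ge> 0" "?B \<ge> 0" by (auto intro!: avg_nonneg)
  have quartic: "((a + b / 2) ^ 4 + (a - b / 2) ^ 4) / 2 = a ^ 4 + (3 / 2 * (a\<^sup>2 * b\<^sup>2) + 1 / 16 * b ^ 4)"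
    for a b :: real
  proof -
    have "(a + c) ^ 4 + (a - c) ^ 4 = 2 * (a ^ 4 + 6 * (a\<^sup>2 * c\<^sup>2) + c ^ 4)" for c
      by (simp add: power4_eq_xxxx power2_eq_square algebra_simps)
    from this[of "b / 2"] show ?thesis by (simp add: power_divide)
  qed
  have "(avg n (\<lambda>l. (noise l ?g)\<^sup>2 * (noise l ?h)\<^sup>2))\<^sup>2
      \<le> avg n (\<lambda>l. (noise l ?g) ^ 4) * avg n (\<lambda>l. (noise l ?h) ^ 4)"
    using avg_Cauchy_Schwarz[of n "\<lambda>l. (noise l ?g)\<^sup>2" "\<lambda>l. (noise l ?h)\<^sup>2"] by simp
  also have "\<dots> \<le> (?A * ?B)\<^sup>2"
    unfolding power_mult_distrib by (intro mult_mono Suc) (auto intro!: avg_nonneg)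
  finally have cross: "avg n (\<lambda>l. (noise l ?g)\<^sup>2 * (noise l ?h)\<^sup>2) \<le> ?A * ?B"
    using pos by (rule power2_le_imp_le[OF _ mult_nonneg_nonneg])
  have "avg (Suc n) (\<lambda>l. (noise l f) ^ 4)
      = avg n (\<lambda>l. (noise l ?g) ^ 4 + (3 / 2 * ((noise l ?g)\<^sup>2 * (noise l ?h)\<^sup>2)
          + 1 / 16 * (noise l ?h) ^ 4))"
    unfolding avg_Suc_bool noise_Cons by (rule avg_cong) (rule quartic)
  also have "\<dots> = avg n (\<lambda>l. (noise l ?g) ^ 4)
      + (3 / 2 * avg n (\<lambda>l. (noise l ?g)\<^sup>2 * (noise l ?h)\<^sup>2) + 1 / 16 * avg n (\<lambda>l. (noise l ?h) ^ 4))"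
    by (simp only: avg_add avg_cmult)
  also have "\<dots> \<le> ?A\<^sup>2 + (3 / 2 * (?A * ?B) + 1 / 16 * ?B\<^sup>2)"
    by (intro add_mono mult_left_mono Suc cross) auto
  also have "\<dots> \<le> (?A + ?B)\<^sup>2"
    using mult_nonneg_nonneg[OF pos] zero_le_power2[of ?B] unfolding power2_sum mult.assoc
    by linarith
  finally show ?case unfolding avg_sq_Suc .
qed simp

lemma noise_form_Suc:
  "avg (Suc n) (\<lambda>l. f l * noise l f)
    = avg n (\<lambda>l. head_even f l * noise l (head_even f))
      + 1 / 2 * avg n (\<lambda>l. head_odd f l * noise l (head_odd f))"
  unfolding avg_Suc_bool avg_add[symmetric] avg_cmult[symmetric] noise_Cons
  by (rule avg_cong) (simp add: head_even_def head_odd_def field_simps)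

lemma noise_form_le: "avg n (\<lambda>l. f l * noise l f) \<le> avg n (\<lambda>l. (f l)\<^sup>2)"
proof (induction n arbitrary: f)
  case (Suc n)
  have "0 \<le> avg n (\<lambda>l. (head_odd f l)\<^sup>2)" by (rule avg_nonneg) simp
  then show ?case
    unfolding noise_form_Suc avg_sq_Suc using Suc[of "head_even f"] Suc[of "head_odd f"] by simp
qed (simp add: power2_eq_square)

text \<open>On mean zero functions \<open>T\<close> is at most \<open>1/2\<close>. The odd part \<open>h\<close> enters the form
with the factor \<open>1/2\<close> already in front, so that the contraction property of \<open>T\<close> suffices for it.\<close>

lemma noise_form_spectral_gap:
  "2 * avg n (\<lambda>l. f l * noise l f) \<le> avg n (\<lambda>l. (f l)\<^sup>2) + (avg n f)\<^sup>2"
proof (induction n arbitrary: f)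
  case (Suc n)
  show ?case
    unfolding noise_form_Suc avg_sq_Suc avg_Suc_head_even
    using Suc[of "head_even f"] noise_form_le[of n "head_odd f"] by simp
qed (simp add: power2_eq_square)

definition bit_sign :: "bool \<Rightarrow> real" where
  "bit_sign b = (if b then 1 else - 1)"

definition affine_fn :: "nat \<Rightarrow> real \<Rightarrow> (nat \<Rightarrow> real) \<Rightarrow> bool list \<Rightarrow> real" where
  "affine_fn n c a l = c + (\<Sum>j<n. a j * bit_sign (l ! j))"

lemma affine_fn_Cons:
  "affine_fn (Suc n) c (case_nat e a) (b # l) = affine_fn n c a l + e * bit_sign b"
  unfolding affine_fn_def sum.lessThan_Suc_shift by simp

text \<open>The right-hand side is half of \<open>\<parallel>Df\<parallel>\<^sub>2^2\<close>, see \<open>avg_defect_sq\<close> below. For \<open>f = g + \<epsilon> h\<close> it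
exceeds its value for \<open>g\<close> by \<open>2 \<parallel>h\<parallel>\<^sub>2^2 - 2 \<langle>h, T h\<rangle>\<close>. Replacing \<open>h\<close> by its mean \<open>e\<close> turns
\<open>\<epsilon> h\<close> into the linear term \<open>e \<epsilon>\<close> at the cost of the variance of \<open>h\<close>, and the spectral gap says
that this cost is covered.\<close>

lemma exists_affine_L2:
  "\<exists>c a. avg n (\<lambda>l. (f l - affine_fn n c a l)\<^sup>2)
    \<le> 2 * avg n (\<lambda>l. (f l)\<^sup>2) + 2 * (avg n f)\<^sup>2 - 4 * avg n (\<lambda>l. f l * noise l f)"
proof (induction n arbitrary: f)
  case 0
  show ?case
    by (rule exI[of _ "f []"]) (simp add: affine_fn_def power2_eq_square)
next
  case (Suc n)
  let ?g = "head_even f" and ?h = "head_odd f"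
  obtain c a where ca: "avg n (\<lambda>l. (?g l - affine_fn n c a l)\<^sup>2)
      \<le> 2 * avg n (\<lambda>l. (?g l)\<^sup>2) + 2 * (avg n ?g)\<^sup>2 - 4 * avg n (\<lambda>l. ?g l * noise l ?g)"
    using Suc[of ?g] by blast
  define e where "e = avg n ?h"
  have var: "avg n (\<lambda>l. (?h l - e)\<^sup>2) = avg n (\<lambda>l. (?h l)\<^sup>2) - e\<^sup>2"
  proof -
    have "(\<lambda>l. (?h l - e)\<^sup>2) = (\<lambda>l. (?h l)\<^sup>2 + ((- 2 * e) * ?h l + e\<^sup>2))"
      by (rule ext) (simp add: power2_eq_square algebra_simps)
    then show ?thesis
      by (simp only: avg_add avg_cmult avg_const) (simp add: e_def power2_eq_square)
  qed
  have "avg (Suc n) (\<lambda>l. (f l - affine_fn (Suc n) c (case_nat e a) l)\<^sup>2)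
      = avg n (\<lambda>l. (?g l - affine_fn n c a l)\<^sup>2) + avg n (\<lambda>l. (?h l - e)\<^sup>2)"
    unfolding avg_Suc_bool avg_add[symmetric] affine_fn_Cons
    by (rule avg_cong) (simp add: head_even_def head_odd_def bit_sign_def power2_eq_square field_simps)
  also have "\<dots> \<le> 2 * avg (Suc n) (\<lambda>l. (f l)\<^sup>2) + 2 * (avg (Suc n) f)\<^sup>2
      - 4 * avg (Suc n) (\<lambda>l. f l * noise l f)"
    unfolding noise_form_Suc avg_sq_Suc avg_Suc_head_even
    using ca noise_form_spectral_gap[of n ?h] by (simp add: var flip: e_def)
  finally show ?case by blast
qed

section \<open>The defect on words\<close>

text \<open>A word over triples of bits encodes \<open>(x, y, \<sigma>)\<close>; the third bit tells whether \<open>\<sigma>\<^sub>j = 1\<close>, that is, whether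
\<open>z\<close> takes its bit from \<open>x\<close>.\<close>

type_synonym letter3 = "bool \<times> bool \<times> bool"

fun x_of :: "letter3 \<Rightarrow> bool" where "x_of (a, b, c) = a"
fun y_of :: "letter3 \<Rightarrow> bool" where "y_of (a, b, c) = b"
fun z_of :: "letter3 \<Rightarrow> bool" where "z_of (a, b, c) = (if c then a else b)"
fun w_of :: "letter3 \<Rightarrow> bool" where "w_of (a, b, c) = (if c then b else a)"

abbreviation xs :: "letter3 list \<Rightarrow> bool list" where "xs \<equiv> map x_of"
abbreviation ys :: "letter3 list \<Rightarrow> bool list" where "ys \<equiv> map y_of"
abbreviation zs :: "letter3 list \<Rightarrow> bool list" where "zs \<equiv> map z_of"
abbreviation ws :: "letter3 list \<Rightarrow> bool list" where "ws \<equiv> map w_of"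

definition defect :: "(bool list \<Rightarrow> real) \<Rightarrow> letter3 list \<Rightarrow> real" where
  "defect f l = f (xs l) + f (ys l) - f (zs l) - f (ws l)"

lemma sum_letter3:
  fixes G :: "letter3 \<Rightarrow> real"
  shows "(\<Sum>a\<in>UNIV. G a) = G (True, True, True) + G (True, True, False) + G (True, False, True)
    + G (True, False, False) + G (False, True, True) + G (False, True, False)
    + G (False, False, True) + G (False, False, False)"
proof -
  have U: "(UNIV :: letter3 set) = {(True, True, True), (True, True, False), (True, False, True),
      (True, False, False), (False, True, True), (False, True, False), (False, False, True),
      (False, False, False)}"
    by auto
  show ?thesis unfolding U by simp
qed

lemma avg_Suc_letter3:
  fixes F :: "letter3 list \<Rightarrow> real"
  shows "avg (Suc n) F = (avg n (\<lambda>l. F ((True, True, True) # l)) + avg n (\<lambda>l. F ((True, True, False) # l))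
    + avg n (\<lambda>l. F ((True, False, True) # l)) + avg n (\<lambda>l. F ((True, False, False) # l))
    + avg n (\<lambda>l. F ((False, True, True) # l)) + avg n (\<lambda>l. F ((False, True, False) # l))
    + avg n (\<lambda>l. F ((False, False, True) # l)) + avg n (\<lambda>l. F ((False, False, False) # l))) / 8"
  unfolding avg.simps sum_letter3 by simp

lemma avg_Suc_halves:
  "avg (Suc n) f = (avg n (\<lambda>l. f (True # l)) + avg n (\<lambda>l. f (False # l))) / 2"
  unfolding avg_Suc_bool by (simp only: avg_divide avg_add)

lemma avg_marginal:
  "avg n (\<lambda>l. f (xs l)) = avg n f"
  "avg n (\<lambda>l. f (ys l)) = avg n f"
  "avg n (\<lambda>l. f (zs l)) = avg n f"
  "avg n (\<lambda>l. f (ws l)) = avg n f"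
proof -
  show "avg n (\<lambda>l. f (xs l)) = avg n f"
  proof (induction n arbitrary: f)
    case (Suc n)
    then show ?case
      using Suc[of "\<lambda>l. f (True # l)"] Suc[of "\<lambda>l. f (False # l)"]
      by (simp add: avg_Suc_letter3 avg_Suc_halves del: avg.simps(2))
  qed simp
  show "avg n (\<lambda>l. f (ys l)) = avg n f"
  proof (induction n arbitrary: f)
    case (Suc n)
    then show ?case
      using Suc[of "\<lambda>l. f (True # l)"] Suc[of "\<lambda>l. f (False # l)"]
      by (simp add: avg_Suc_letter3 avg_Suc_halves del: avg.simps(2))
  qed simp
  show "avg n (\<lambda>l. f (zs l)) = avg n f"
  proof (induction n arbitrary: f)
    case (Suc n)
    then show ?case
      using Suc[of "\<lambda>l. f (True # l)"] Suc[of "\<lambda>l. f (False # l)"]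
      by (simp add: avg_Suc_letter3 avg_Suc_halves del: avg.simps(2))
  qed simp
  show "avg n (\<lambda>l. f (ws l)) = avg n f"
  proof (induction n arbitrary: f)
    case (Suc n)
    then show ?case
      using Suc[of "\<lambda>l. f (True # l)"] Suc[of "\<lambda>l. f (False # l)"]
      by (simp add: avg_Suc_letter3 avg_Suc_halves del: avg.simps(2))
  qed simp
qed

lemma avg_independent:
  "avg n (\<lambda>l. f (xs l) * g (ys l)) = avg n f * avg n g"
  "avg n (\<lambda>l. f (zs l) * g (ws l)) = avg n f * avg n g"
proof -
  show "avg n (\<lambda>l. f (xs l) * g (ys l)) = avg n f * avg n g"
  proof (induction n arbitrary: f g)
    case (Suc n)
    show ?case
      using Suc[of "\<lambda>l. f (True # l)" "\<lambda>l. g (True # l)"] Suc[of "\<lambda>l. f (True # l)" "\<lambda>l. g (False # l)"]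
        Suc[of "\<lambda>l. f (False # l)" "\<lambda>l. g (True # l)"] Suc[of "\<lambda>l. f (False # l)" "\<lambda>l. g (False # l)"]
      by (simp add: avg_Suc_letter3 avg_Suc_halves field_simps del: avg.simps(2))
  qed simp
  show "avg n (\<lambda>l. f (zs l) * g (ws l)) = avg n f * avg n g"
  proof (induction n arbitrary: f g)
    case (Suc n)
    show ?case
      using Suc[of "\<lambda>l. f (True # l)" "\<lambda>l. g (True # l)"] Suc[of "\<lambda>l. f (True # l)" "\<lambda>l. g (False # l)"]
        Suc[of "\<lambda>l. f (False # l)" "\<lambda>l. g (True # l)"] Suc[of "\<lambda>l. f (False # l)" "\<lambda>l. g (False # l)"]
      by (simp add: avg_Suc_letter3 avg_Suc_halves field_simps del: avg.simps(2))
  qed simp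
qed

lemma avg_noise_Suc:
  "avg (Suc n) (\<lambda>l. f l * noise l g)
    = (3 * avg n (\<lambda>l. f (True # l) * noise l (\<lambda>m. g (True # m)))
      + avg n (\<lambda>l. f (True # l) * noise l (\<lambda>m. g (False # m)))
      + avg n (\<lambda>l. f (False # l) * noise l (\<lambda>m. g (True # m)))
      + 3 * avg n (\<lambda>l. f (False # l) * noise l (\<lambda>m. g (False # m)))) / 8"
proof -
  have "avg (Suc n) (\<lambda>l. f l * noise l g)
    = avg n (\<lambda>l. 3 / 8 * (f (True # l) * noise l (\<lambda>m. g (True # m)))
      + (1 / 8 * (f (True # l) * noise l (\<lambda>m. g (False # m)))
      + (1 / 8 * (f (False # l) * noise l (\<lambda>m. g (True # m)))
      + 3 / 8 * (f (False # l) * noise l (\<lambda>m. g (False # m))))))"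
    unfolding avg_Suc_bool by (rule avg_cong) (simp add: field_simps)
  then show ?thesis by (simp only: avg_add avg_cmult) simp
qed

text \<open>Given the bit of \<open>x\<close>, the bit of \<open>z\<close> is equal to it with probability \<open>1/2 + 1/2 \<cdot> 1/2 = 3/4\<close>, which is the
transition of the noise operator.\<close>

lemma avg_correlated:
  "avg n (\<lambda>l. f (xs l) * g (zs l)) = avg n (\<lambda>l. f l * noise l g)"
  "avg n (\<lambda>l. f (xs l) * g (ws l)) = avg n (\<lambda>l. f l * noise l g)"
  "avg n (\<lambda>l. f (ys l) * g (zs l)) = avg n (\<lambda>l. f l * noise l g)"
  "avg n (\<lambda>l. f (ys l) * g (ws l)) = avg n (\<lambda>l. f l * noise l g)"
proof -
  show "avg n (\<lambda>l. f (xs l) * g (zs l)) = avg n (\<lambda>l. f l * noise l g)"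
  proof (induction n arbitrary: f g)
    case (Suc n)
    show ?case
      using Suc[of "\<lambda>l. f (True # l)" "\<lambda>l. g (True # l)"] Suc[of "\<lambda>l. f (True # l)" "\<lambda>l. g (False # l)"]
        Suc[of "\<lambda>l. f (False # l)" "\<lambda>l. g (True # l)"] Suc[of "\<lambda>l. f (False # l)" "\<lambda>l. g (False # l)"]
      by (simp add: avg_Suc_letter3 avg_noise_Suc del: avg.simps(2))
  qed simp
  show "avg n (\<lambda>l. f (xs l) * g (ws l)) = avg n (\<lambda>l. f l * noise l g)"
  proof (induction n arbitrary: f g)
    case (Suc n)
    show ?case
      using Suc[of "\<lambda>l. f (True # l)" "\<lambda>l. g (True # l)"] Suc[of "\<lambda>l. f (True # l)" "\<lambda>l. g (False # l)"]
        Suc[of "\<lambda>l. f (False # l)" "\<lambda>l. g (True # l)"] Suc[of "\<lambda>l. f (False # l)" "\<lambda>l. g (False # l)"]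
      by (simp add: avg_Suc_letter3 avg_noise_Suc del: avg.simps(2))
  qed simp
  show "avg n (\<lambda>l. f (ys l) * g (zs l)) = avg n (\<lambda>l. f l * noise l g)"
  proof (induction n arbitrary: f g)
    case (Suc n)
    show ?case
      using Suc[of "\<lambda>l. f (True # l)" "\<lambda>l. g (True # l)"] Suc[of "\<lambda>l. f (True # l)" "\<lambda>l. g (False # l)"]
        Suc[of "\<lambda>l. f (False # l)" "\<lambda>l. g (True # l)"] Suc[of "\<lambda>l. f (False # l)" "\<lambda>l. g (False # l)"]
      by (simp add: avg_Suc_letter3 avg_noise_Suc del: avg.simps(2))
  qed simp
  show "avg n (\<lambda>l. f (ys l) * g (ws l)) = avg n (\<lambda>l. f l * noise l g)"
  proof (induction n arbitrary: f g)
    case (Suc n)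
    show ?case
      using Suc[of "\<lambda>l. f (True # l)" "\<lambda>l. g (True # l)"] Suc[of "\<lambda>l. f (True # l)" "\<lambda>l. g (False # l)"]
        Suc[of "\<lambda>l. f (False # l)" "\<lambda>l. g (True # l)"] Suc[of "\<lambda>l. f (False # l)" "\<lambda>l. g (False # l)"]
      by (simp add: avg_Suc_letter3 avg_noise_Suc del: avg.simps(2))
  qed simp
qed

lemma avg_defect_sq:
  "avg n (\<lambda>l. (defect f l)\<^sup>2)
    = 4 * avg n (\<lambda>l. (f l)\<^sup>2) + 4 * (avg n f)\<^sup>2 - 8 * avg n (\<lambda>l. f l * noise l f)"
proof -
  have "avg n (\<lambda>l. (defect f l)\<^sup>2)
      = avg n (\<lambda>l. (f (xs l))\<^sup>2 + (f (ys l))\<^sup>2 + (f (zs l))\<^sup>2 + (f (ws l))\<^sup>2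
        + 2 * (f (xs l) * f (ys l)) + 2 * (f (zs l) * f (ws l))
        - 2 * (f (xs l) * f (zs l)) - 2 * (f (xs l) * f (ws l))
        - 2 * (f (ys l) * f (zs l)) - 2 * (f (ys l) * f (ws l)))"
    by (rule avg_cong) (simp add: defect_def power2_eq_square algebra_simps)
  also have "\<dots> = 4 * avg n (\<lambda>l. (f l)\<^sup>2) + 4 * (avg n f)\<^sup>2 - 8 * avg n (\<lambda>l. f l * noise l f)"
    by (simp only: avg_add avg_diff avg_cmult avg_marginal[of n "\<lambda>l. (f l)\<^sup>2"]
        avg_independent avg_correlated)
      (simp add: power2_eq_square)
  finally show ?thesis .
qed

lemma exists_affine_L2_defect:
  "\<exists>c a. avg n (\<lambda>l. (f l - affine_fn n c a l)\<^sup>2) \<le> avg n (\<lambda>l. (defect f l)\<^sup>2) / 2"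
proof -
  have "avg n (\<lambda>l. (defect f l)\<^sup>2) / 2
      = 2 * avg n (\<lambda>l. (f l)\<^sup>2) + 2 * (avg n f)\<^sup>2 - 4 * avg n (\<lambda>l. f l * noise l f)"
    by (simp add: avg_defect_sq)
  then show ?thesis using exists_affine_L2[of n f] by (simp only:)
qed

lemma avg_defect_abs_le: "avg n (\<lambda>l. \<bar>defect f l\<bar>) \<le> 4 * avg n (\<lambda>l. \<bar>f l\<bar>)"
proof -
  have "avg n (\<lambda>l. \<bar>defect f l\<bar>)
      \<le> avg n (\<lambda>l. \<bar>f (xs l)\<bar> + \<bar>f (ys l)\<bar> + \<bar>f (zs l)\<bar> + \<bar>f (ws l)\<bar>)"
    by (rule avg_mono) (simp add: defect_def)
  then show ?thesis by (simp add: avg_add avg_marginal[of n "\<lambda>l. \<bar>f l\<bar>"])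
qed

text \<open>In each coordinate the two bits of \<open>z\<close> and \<open>w\<close> are those of \<open>x\<close> and \<open>y\<close>, possibly exchanged.\<close>

lemma defect_affine:
  assumes "length l = n"
  shows "defect (affine_fn n c a) l = 0"
proof -
  have "bit_sign (xs l ! j) + bit_sign (ys l ! j) - bit_sign (zs l ! j) - bit_sign (ws l ! j) = 0" if "j < n" for j
    using that assms by (cases "l ! j" rule: x_of.cases) simp
  then have "(\<Sum>j<n. a j * (bit_sign (xs l ! j) + bit_sign (ys l ! j) - bit_sign (zs l ! j) - bit_sign (ws l ! j))) = 0"
    by simp
  then show ?thesis
    by (simp add: defect_def affine_fn_def algebra_simps sum.distrib sum_subtractf)
qed

section \<open>Decay of tails\<close>

definition tail :: "nat \<Rightarrow> ('a::finite list \<Rightarrow> real) \<Rightarrow> real \<Rightarrow> real" where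
  "tail n f t = avg n (\<lambda>l. of_bool (t < \<bar>f l\<bar>))"

lemma tail_nonneg: "0 \<le> tail n f t"
  unfolding tail_def by (rule avg_nonneg) simp

lemma tail_antimono: "s \<le> t \<Longrightarrow> tail n f t \<le> tail n f s"
  unfolding tail_def by (rule avg_mono) auto

lemma Markov_tail:
  assumes "0 < t"
  shows "tail n f t \<le> avg n (\<lambda>l. \<bar>f l\<bar>) / t"
  unfolding tail_def avg_divide[symmetric]
  by (rule avg_mono) (use assms in \<open>auto simp: field_simps of_bool_def\<close>)

text \<open>The left-hand side is the probability that \<open>\<bar>f x\<bar> > s\<close> and \<open>\<bar>f z\<bar> > t\<close>. Young's inequality in place
of that of Hoelder lets the factor \<open>T 1\<^sub>F\<close> enter only through its fourth power, which hypercontractivity bounds by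
the square of the measure of \<open>F = {\<bar>f\<bar> > t}\<close>.\<close>

lemma tail_noise_le:
  "avg n (\<lambda>l. of_bool (s < \<bar>f l\<bar>) * noise l (\<lambda>m. of_bool (t < \<bar>f m\<bar>)))
    \<le> tail n f s / 8 + 54 * (tail n f t)\<^sup>2"
proof -
  define G where "G l = (of_bool (t < \<bar>f l\<bar>) :: real)" for l
  \<comment> \<open>The weight of the linear term is chosen so that \<open>tail_recursion\<close> can absorb two copies of
    it; equality holds at \<open>u = 1/6\<close>, a double root of the difference.\<close>
  have young: "u \<le> 1 / 8 + 54 * u ^ 4" for u :: real
  proof -
    have "54 * u ^ 4 - u + 1 / 8 = 54 * ((u - 1 / 6)\<^sup>2 * ((u + 1 / 6)\<^sup>2 + 1 / 18))"
      by (simp add: power2_eq_square power4_eq_xxxx algebra_simps)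
    also have "\<dots> \<ge> 0" by (intro mult_nonneg_nonneg add_nonneg_nonneg) simp_all
    finally show ?thesis by simp
  qed
  have "avg n (\<lambda>l. of_bool (s < \<bar>f l\<bar>) * noise l G)
      \<le> avg n (\<lambda>l. 1 / 8 * of_bool (s < \<bar>f l\<bar>) + 54 * noise l G ^ 4)"
    by (rule avg_mono) (use young in \<open>auto simp: of_bool_def\<close>)
  also have "\<dots> = tail n f s / 8 + 54 * avg n (\<lambda>l. noise l G ^ 4)"
    by (simp add: avg_add avg_cmult avg_divide tail_def)
  also have "\<dots> \<le> tail n f s / 8 + 54 * (avg n (\<lambda>l. (G l)\<^sup>2))\<^sup>2"
    using noise_hypercontractive[of n G] by simp
  also have "(\<lambda>l. (G l)\<^sup>2) = G" by (auto simp: G_def)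
  finally show ?thesis by (simp add: tail_def G_def[abs_def])
qed

text \<open>If \<open>\<bar>f x\<bar> > 4 t\<close>, then one of \<open>f y\<close>, \<open>f z\<close>, \<open>f w\<close>, \<open>Df\<close> exceeds \<open>t\<close> in absolute value.
Of the probability on the left, independence of \<open>x, y\<close> gives back at most a quarter, and \<open>z\<close> and \<open>w\<close> give back an
eighth each. The half that is left is bounded by the quadratic term and the tail of \<open>Df\<close>.\<close>

lemma tail_recursion:
  assumes "tail n f t \<le> 1 / 4"
  shows "tail n f (4 * t) \<le> 216 * (tail n f t)\<^sup>2 + 2 * tail n (defect f) t"
proof -
  define E F where "E l = (of_bool (4 * t < \<bar>f l\<bar>) :: real)"
    and "F l = (of_bool (t < \<bar>f l\<bar>) :: real)" for l
  have "tail n f (4 * t) = avg n (\<lambda>l. E (xs l))"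
    unfolding avg_marginal by (simp add: tail_def E_def[abs_def])
  also have "\<dots> \<le> avg n (\<lambda>l. E (xs l) * F (ys l) + E (xs l) * F (zs l) + E (xs l) * F (ws l)
      + of_bool (t < \<bar>defect f l\<bar>))"
  proof (rule avg_mono)
    fix l
    have "t < \<bar>f (ys l)\<bar> \<or> t < \<bar>f (zs l)\<bar> \<or> t < \<bar>f (ws l)\<bar> \<or> t < \<bar>defect f l\<bar>"
      if "4 * t < \<bar>f (xs l)\<bar>"
      using that unfolding defect_def by linarith
    then show "E (xs l) \<le> E (xs l) * F (ys l) + E (xs l) * F (zs l) + E (xs l) * F (ws l)
      + of_bool (t < \<bar>defect f l\<bar>)"
      by (auto simp: E_def F_def of_bool_def)
  qed
  also have "\<dots> = avg n E * avg n F + 2 * avg n (\<lambda>l. E l * noise l F) + tail n (defect f) t"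
    by (simp only: avg_add avg_independent avg_correlated tail_def)
  also have "avg n E * avg n F \<le> avg n E * (1 / 4)"
    by (rule mult_left_mono) (use assms in \<open>auto simp: tail_def F_def[abs_def] E_def intro!: avg_nonneg\<close>)
  also have "avg n (\<lambda>l. E l * noise l F) \<le> tail n f (4 * t) / 8 + 54 * (tail n f t)\<^sup>2"
    using tail_noise_le[of n "4 * t" f t] by (simp add: E_def F_def[abs_def])
  finally show ?thesis by (simp add: tail_def E_def[abs_def])
qed

text \<open>The two bounds compare a number with the sum of the powers of 4 below it, in place of the formula
\<open>\<parallel>f\<parallel>\<^sub>1 = \<integral> P(\<bar>f\<bar> > t) dt\<close>.\<close>

lemma dyadic_tail_sum_le:
  fixes r :: real
  assumes "0 \<le> r"
  shows "(\<Sum>k<N. 4 ^ k * of_bool (4 ^ k < r)) \<le> 4 / 3 * r"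
proof (induction N)
  case (Suc N)
  show ?case
  proof (cases "4 ^ N < r")
    case True
    have geo: "(\<Sum>k<m. 4 ^ k) = (4 ^ m - 1 :: real) / 3" for m
      by (induction m) (simp_all add: field_simps)
    have "(\<Sum>k<Suc N. 4 ^ k * of_bool (4 ^ k < r)) \<le> (\<Sum>k<Suc N. 4 ^ k :: real)"
      by (rule sum_mono) (simp add: of_bool_def)
    also have "\<dots> \<le> 4 / 3 * r" unfolding geo using True by simp
    finally show ?thesis .
  next
    case False
    then show ?thesis using Suc by simp
  qed
qed (use assms in simp)

lemma le_dyadic_tail_sum:
  fixes r :: real
  assumes "r \<le> 4 ^ (m + N)"
  shows "r * of_bool (4 ^ m < r) \<le> (\<Sum>k<N. 4 * 4 ^ (m + k) * of_bool (4 ^ (m + k) < r))"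
  using assms
proof (induction N)
  case (Suc N)
  show ?case
  proof (cases "4 ^ (m + N) < r")
    case True
    have "r * of_bool (4 ^ m < r) \<le> 4 * 4 ^ (m + N)"
      using Suc.prems by (simp add: of_bool_def)
    also have "\<dots> \<le> (\<Sum>k<Suc N. 4 * 4 ^ (m + k) * of_bool (4 ^ (m + k) < r))"
      using True by (simp add: sum_nonneg)
    finally show ?thesis .
  next
    case False
    then show ?thesis using Suc by simp
  qed
qed simp

definition large_part :: "real \<Rightarrow> ('a list \<Rightarrow> real) \<Rightarrow> 'a list \<Rightarrow> real" where
  "large_part t f l = f l * of_bool (t < \<bar>f l\<bar>)"

definition small_part :: "real \<Rightarrow> ('a list \<Rightarrow> real) \<Rightarrow> 'a list \<Rightarrow> real" where
  "small_part t f l = f l * of_bool (\<bar>f l\<bar> \<le> t)"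

lemma small_plus_large: "small_part t f l + large_part t f l = f l"
  by (simp add: small_part_def large_part_def of_bool_def)

lemma finite_words: "finite {l :: 'a::finite list. length l = n}"
  using finite_lists_length_eq[of "UNIV :: 'a set" n] by simp

lemma bounded_on_words: "\<exists>B. \<forall>l. length l = n \<longrightarrow> \<bar>f l\<bar> \<le> (B :: real)"
  for f :: "'a::finite list \<Rightarrow> real"
proof -
  have "finite ((\<lambda>l. \<bar>f l\<bar>) ` {l. length l = n})" by (simp add: finite_words)
  then show ?thesis by (metis (mono_tags, lifting) Max_ge image_eqI mem_Collect_eq)
qed

text \<open>On words of fixed length \<open>f\<close> is bounded, so finitely many dyadic levels suffice; only bounds uniform in
their number \<open>N\<close> are useful afterwards.\<close>

lemma avg_large_part_le:
  "\<exists>N. avg n (\<lambda>l. \<bar>large_part (4 ^ m) f l\<bar>) \<le> (\<Sum>k<N. 4 * 4 ^ (m + k) * tail n f (4 ^ (m + k)))"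
proof -
  obtain B where B: "\<And>l. length l = n \<Longrightarrow> \<bar>f l\<bar> \<le> B"
    using bounded_on_words[of n f] by blast
  obtain N where N: "B < 4 ^ N" using real_arch_pow[of 4 B] by auto
  have N': "B \<le> 4 ^ (m + N)"
  proof -
    have "(4 :: real) ^ N \<le> 4 ^ (m + N)" by (rule power_increasing) auto
    then show ?thesis using N by linarith
  qed
  have "avg n (\<lambda>l. \<bar>large_part (4 ^ m) f l\<bar>)
      \<le> avg n (\<lambda>l. \<Sum>k<N. 4 * 4 ^ (m + k) * of_bool (4 ^ (m + k) < \<bar>f l\<bar>))"
  proof (rule avg_mono)
    fix l :: "'a list" assume "length l = n"
    then have "\<bar>f l\<bar> \<le> 4 ^ (m + N)" using B N' by force
    from le_dyadic_tail_sum[OF this]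
    show "\<bar>large_part (4 ^ m) f l\<bar> \<le> (\<Sum>k<N. 4 * 4 ^ (m + k) * of_bool (4 ^ (m + k) < \<bar>f l\<bar>))"
      by (simp add: large_part_def abs_mult)
  qed
  also have "\<dots> = (\<Sum>k<N. 4 * 4 ^ (m + k) * tail n f (4 ^ (m + k)))"
    by (simp add: avg_sum avg_cmult tail_def del: sum_of_bool_mult_eq sum_mult_of_bool_eq)
  finally show ?thesis by blast
qed

lemma sum_dyadic_tail_le:
  "(\<Sum>k<N. 4 ^ k * tail n f (4 ^ k)) \<le> 4 / 3 * avg n (\<lambda>l. \<bar>f l\<bar>)"
proof -
  have "(\<Sum>k<N. 4 ^ k * tail n f (4 ^ k))
      = avg n (\<lambda>l. \<Sum>k<N. 4 ^ k * of_bool (4 ^ k < \<bar>f l\<bar>))"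
    by (simp add: avg_sum avg_cmult tail_def del: sum_of_bool_mult_eq sum_mult_of_bool_eq)
  also have "\<dots> \<le> avg n (\<lambda>l. 4 / 3 * \<bar>f l\<bar>)"
    by (rule avg_mono) (rule dyadic_tail_sum_le, simp)
  finally show ?thesis by (simp only: avg_cmult)
qed

text \<open>One application of \<open>tail_recursion\<close> turns the Markov bound \<open>4^(-k)\<close> into order \<open>16^(-k)\<close>, a second one into
\<open>256^(-k)\<close>. A single step is not enough: the \<open>L^2\<close> estimate at truncation height \<open>M\<close> costs a factor
\<open>M\<close>, and tails of order \<open>t^(-2)\<close> would only give \<open>M \<cdot> 1/M\<close>. The assumption on \<open>Df\<close> keeps the square of
its tail, which the second step produces, below the tail itself.\<close>

lemma tail_two_steps:
  assumes f: "avg n (\<lambda>l. \<bar>f l\<bar>) \<le> 1"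
    and d: "avg n (\<lambda>l. \<bar>defect f l\<bar>) \<le> 1 / 1728"
    and k: "1 \<le> k"
  shows "tail n f (4 ^ (k + 2)) \<le> 432 * 216\<^sup>2 / 256 ^ k + 3 * tail n (defect f) (4 ^ k)"
proof -
  define p p1 p2 where "p = tail n f (4 ^ k)" and "p1 = tail n f (4 ^ (k + 1))"
    and "p2 = tail n f (4 ^ (k + 2))"
  define q q1 where "q = tail n (defect f) (4 ^ k)" and "q1 = tail n (defect f) (4 ^ (k + 1))"
  have nn: "0 \<le> p" "0 \<le> p1" "0 \<le> q" by (simp_all add: p_def p1_def q_def tail_nonneg)
  have p_le: "tail n f (4 ^ j) \<le> 1 / 4 ^ j" for j
  proof -
    have "tail n f (4 ^ j) \<le> avg n (\<lambda>l. \<bar>f l\<bar>) / 4 ^ j" by (rule Markov_tail) simp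
    also have "\<dots> \<le> 1 / 4 ^ j" by (rule divide_right_mono) (use f in auto)
    finally show ?thesis .
  qed
  have quarter: "tail n f (4 ^ j) \<le> 1 / 4" if "1 \<le> j" for j
  proof -
    have "(4 :: real) ^ 1 \<le> 4 ^ j" by (rule power_increasing) (use that in auto)
    then have "1 / 4 ^ j \<le> (1 / 4 :: real)" by (simp add: field_simps)
    with p_le[of j] show ?thesis by (rule order_trans)
  qed
  have p1: "p1 \<le> 216 * p\<^sup>2 + 2 * q"
    using tail_recursion[OF quarter[OF k]] by (simp add: p_def p1_def q_def)
  have p2: "p2 \<le> 216 * p1\<^sup>2 + 2 * q1"
    using tail_recursion[OF quarter[of "k + 1"]] k by (simp add: p1_def p2_def q1_def mult.assoc)
  have "q1 \<le> q"
    unfolding q_def q1_def by (rule tail_antimono) simp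
  have q: "q \<le> 1 / 1728"
  proof -
    have "q \<le> avg n (\<lambda>l. \<bar>defect f l\<bar>) / 4 ^ k" unfolding q_def by (rule Markov_tail) simp
    also have "\<dots> \<le> avg n (\<lambda>l. \<bar>defect f l\<bar>) / 1"
      by (rule divide_left_mono) (auto intro: avg_nonneg)
    finally show ?thesis using d by simp
  qed
  then have q2: "1728 * q\<^sup>2 \<le> q"
    using mult_right_mono[OF q nn(3)] by (simp add: power2_eq_square)
  have "p ^ 4 \<le> (1 / 4 ^ k) ^ 4"
    by (rule power_mono) (use p_le[of k] nn in \<open>auto simp: p_def\<close>)
  also have "\<dots> = 1 / 256 ^ k"
  proof -
    have "((4 :: real) ^ k) ^ 4 = (4 ^ 4) ^ k" by (simp only: power_mult[symmetric] mult.commute)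
    then show ?thesis by (simp add: power_divide)
  qed
  finally have p4: "p ^ 4 \<le> 1 / 256 ^ k" .
  have "p1\<^sup>2 \<le> (216 * p\<^sup>2 + 2 * q)\<^sup>2" by (rule power_mono) (use p1 nn in auto)
  also have "\<dots> \<le> 2 * 216\<^sup>2 * p ^ 4 + 8 * q\<^sup>2"
  proof -
    have "2 * 216\<^sup>2 * p ^ 4 + 8 * q\<^sup>2 - (216 * p\<^sup>2 + 2 * q)\<^sup>2 = (216 * p\<^sup>2 - 2 * q)\<^sup>2"
      by (simp add: power2_eq_square power4_eq_xxxx algebra_simps)
    then show ?thesis using zero_le_power2[of "216 * p\<^sup>2 - 2 * q"] by linarith
  qed
  finally have "p2 \<le> 432 * 216\<^sup>2 * p ^ 4 + 1728 * q\<^sup>2 + 2 * q1" using p2 by simp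
  also have "\<dots> \<le> 432 * 216\<^sup>2 * (1 / 256 ^ k) + q + 2 * q"
    using p4 q2 \<open>q1 \<le> q\<close> by simp
  finally show ?thesis by (simp add: p2_def q_def)
qed

text \<open>Up to a factor 4, the sum of \<open>4^k\<close> times the tail at \<open>4^k\<close> over all \<open>k \<ge> 12\<close>, estimated by \<open>tail_two_steps\<close> at \<open>k - 2 \<ge> 10\<close>:
the first term is geometric with ratio \<open>4/256 = 1/64\<close>, the second one sums to a multiple of \<open>\<parallel>Df\<parallel>\<^sub>1\<close>.\<close>

lemma avg_large_part_small:
  assumes f: "avg n (\<lambda>l. \<bar>f l\<bar>) \<le> 1"
    and d: "avg n (\<lambda>l. \<bar>defect f l\<bar>) \<le> 1 / 1728"
  shows "avg n (\<lambda>l. \<bar>large_part (4 ^ 12) f l\<bar>)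
    \<le> 2 / 10 ^ 9 + 256 * avg n (\<lambda>l. \<bar>defect f l\<bar>)"
proof -
  define A :: real where "A = 432 * 216\<^sup>2"
  let ?d = "\<lambda>k. tail n (defect f) (4 ^ k)"
  obtain N where N: "avg n (\<lambda>l. \<bar>large_part (4 ^ 12) f l\<bar>)
      \<le> (\<Sum>k<N. 4 * 4 ^ (12 + k) * tail n f (4 ^ (12 + k)))"
    using avg_large_part_le by blast
  also have "\<dots> \<le> (\<Sum>k<N. 64 * A / 64 ^ 10 * (1 / 64) ^ k + 192 * (4 ^ (10 + k) * ?d (10 + k)))"
  proof (rule sum_mono)
    fix k
    have "4 * 4 ^ (12 + k) * tail n f (4 ^ (12 + k))
        = 64 * 4 ^ (10 + k) * tail n f (4 ^ ((10 + k) + 2))"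
      by (simp add: power_add)
    also have "\<dots> \<le> 64 * 4 ^ (10 + k) * (A / 256 ^ (10 + k) + 3 * ?d (10 + k))"
      unfolding A_def by (intro mult_left_mono tail_two_steps[OF f d]) auto
    also have "\<dots> = 64 * A * (4 ^ (10 + k) / 256 ^ (10 + k)) + 192 * (4 ^ (10 + k) * ?d (10 + k))"
      by (simp add: distrib_left)
    also have "(4 :: real) ^ (10 + k) / 256 ^ (10 + k) = (1 / 64) ^ (10 + k)"
      by (simp add: power_divide[symmetric])
    finally show "4 * 4 ^ (12 + k) * tail n f (4 ^ (12 + k))
        \<le> 64 * A / 64 ^ 10 * (1 / 64) ^ k + 192 * (4 ^ (10 + k) * ?d (10 + k))"
      by (simp add: power_add power_divide)
  qed
  also have "\<dots> = 64 * A / 64 ^ 10 * (\<Sum>k<N. (1 / 64) ^ k)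
      + 192 * (\<Sum>k<N. 4 ^ (10 + k) * ?d (10 + k))"
    by (simp add: sum.distrib sum_distrib_left)
  also have "\<dots> \<le> 64 * A / 64 ^ 10 * (64 / 63) + 192 * (4 / 3 * avg n (\<lambda>l. \<bar>defect f l\<bar>))"
  proof (intro add_mono mult_left_mono)
    have "(\<Sum>k<N. (1 / 64 :: real) ^ k) = 64 / 63 * (1 - (1 / 64) ^ N)"
      by (subst sum_gp_strict) (simp add: field_simps)
    also have "\<dots> \<le> 64 / 63" by simp
    finally show "(\<Sum>k<N. (1 / 64 :: real) ^ k) \<le> 64 / 63" .
    have "(\<Sum>k<N. 4 ^ (10 + k) * ?d (10 + k)) = (\<Sum>k\<in>(\<lambda>k. 10 + k) ` {..<N}. 4 ^ k * ?d k)"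
      by (subst sum.reindex) (auto simp: inj_on_def)
    also have "\<dots> \<le> (\<Sum>k<10 + N. 4 ^ k * ?d k)"
      by (rule sum_mono2) (auto simp: tail_nonneg)
    also have "\<dots> \<le> 4 / 3 * avg n (\<lambda>l. \<bar>defect f l\<bar>)" by (rule sum_dyadic_tail_le)
    finally show "(\<Sum>k<N. 4 ^ (10 + k) * ?d (10 + k)) \<le> 4 / 3 * avg n (\<lambda>l. \<bar>defect f l\<bar>)" .
  qed (simp_all add: A_def)
  also have "64 * A / 64 ^ 10 * (64 / 63) \<le> 2 / 10 ^ 9" by (simp add: A_def)
  finally show ?thesis by simp
qed

section \<open>From the square norm to the absolute norm\<close>

text \<open>Truncation at \<open>M = 4^12\<close> splits \<open>f = S + L\<close>. The large part \<open>L\<close> is negligible in \<open>L^1\<close>, and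
\<open>\<bar>DS\<bar> \<le> 4 M\<close> turns smallness of \<open>DS\<close> in \<open>L^1\<close> into smallness in \<open>L^2\<close>, where an affine
approximation of \<open>S\<close> is available. The height must beat the constant of \<open>avg_large_part_small\<close>, and
\<open>10^(-11)\<close> must then beat \<open>M\<close>.\<close>

lemma affine_contraction:
  assumes f: "avg n (\<lambda>l. \<bar>f l\<bar>) \<le> 1"
    and d: "avg n (\<lambda>l. \<bar>defect f l\<bar>) \<le> 1 / 10 ^ 11"
  shows "\<exists>c a. avg n (\<lambda>l. \<bar>f l - affine_fn n c a l\<bar>) \<le> 9 / 10"
proof -
  define \<delta> where "\<delta> = avg n (\<lambda>l. \<bar>defect f l\<bar>)"
  define M :: real where "M = 4 ^ 12"
  define S L where "S = small_part M f" and "L = large_part M f"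
  have split: "f l = S l + L l" for l by (simp add: S_def L_def small_plus_large)
  have L: "avg n (\<lambda>l. \<bar>L l\<bar>) \<le> 2 / 10 ^ 9 + 256 * \<delta>"
    unfolding L_def M_def \<delta>_def by (rule avg_large_part_small) (use f d in auto)
  have DS1: "avg n (\<lambda>l. \<bar>defect S l\<bar>) \<le> \<delta> + 4 * avg n (\<lambda>l. \<bar>L l\<bar>)"
  proof -
    have "defect S l = defect f l - defect L l" for l
      by (simp add: defect_def split)
    then have "avg n (\<lambda>l. \<bar>defect S l\<bar>) \<le> avg n (\<lambda>l. \<bar>defect f l\<bar> + \<bar>defect L l\<bar>)"
      by (intro avg_mono) simp
    then show ?thesis using avg_defect_abs_le[of n L] by (simp add: avg_add \<delta>_def)
  qed
  have DS2: "avg n (\<lambda>l. (defect S l)\<^sup>2) \<le> 4 * M * avg n (\<lambda>l. \<bar>defect S l\<bar>)"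
    unfolding avg_cmult[symmetric]
  proof (rule avg_mono)
    fix l
    have S: "\<bar>S m\<bar> \<le> M" for m by (simp add: S_def small_part_def of_bool_def M_def)
    have "\<bar>defect S l\<bar> \<le> 4 * M"
      using S[of "xs l"] S[of "ys l"] S[of "zs l"] S[of "ws l"] unfolding defect_def by linarith
    then have "\<bar>defect S l\<bar> * \<bar>defect S l\<bar> \<le> 4 * M * \<bar>defect S l\<bar>"
      by (rule mult_right_mono) simp
    then show "(defect S l)\<^sup>2 \<le> 4 * M * \<bar>defect S l\<bar>" by (simp add: power2_eq_square)
  qed
  obtain c a where ca: "avg n (\<lambda>l. (S l - affine_fn n c a l)\<^sup>2) \<le> avg n (\<lambda>l. (defect S l)\<^sup>2) / 2"
    using exists_affine_L2_defect by blast
  have "(avg n (\<lambda>l. \<bar>S l - affine_fn n c a l\<bar>))\<^sup>2 \<le> avg n (\<lambda>l. (S l - affine_fn n c a l)\<^sup>2)"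
    by (rule avg_abs_le_L2)
  also have "\<dots> \<le> (4 / 5)\<^sup>2"
    using ca DS1 DS2 L d unfolding M_def \<delta>_def by (simp add: power_divide)
  finally have *: "avg n (\<lambda>l. \<bar>S l - affine_fn n c a l\<bar>) \<le> 4 / 5"
    by (rule power2_le_imp_le) simp
  have "avg n (\<lambda>l. \<bar>f l - affine_fn n c a l\<bar>) \<le> avg n (\<lambda>l. \<bar>S l - affine_fn n c a l\<bar> + \<bar>L l\<bar>)"
    by (rule avg_mono) (simp add: split)
  also have "\<dots> \<le> 9 / 10" using * L d by (simp add: avg_add \<delta>_def)
  finally show ?thesis by blast
qed

text \<open>Rescaling \<open>affine_contraction\<close>: as long as the error \<open>m\<close> exceeds \<open>10^11 \<parallel>Df\<parallel>\<^sub>1\<close>, the function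
\<open>(f - a) / m\<close> satisfies its hypotheses because \<open>D\<close> does not see the affine function \<open>a\<close>, and the error
shrinks by the factor \<open>9/10\<close>.\<close>

lemma affine_approximation:
  assumes "0 < \<epsilon>"
  shows "\<exists>c a. avg n (\<lambda>l. \<bar>f l - affine_fn n c a l\<bar>) \<le> 10 ^ 11 * avg n (\<lambda>l. \<bar>defect f l\<bar>) + \<epsilon>"
proof -
  define \<delta> where "\<delta> = avg n (\<lambda>l. \<bar>defect f l\<bar>)"
  have "\<delta> \<ge> 0" by (simp add: \<delta>_def avg_nonneg)
  have step: "\<exists>c a. avg n (\<lambda>l. \<bar>f l - affine_fn n c a l\<bar>)
      \<le> max (10 ^ 11 * \<delta>) ((9 / 10) ^ k * avg n (\<lambda>l. \<bar>f l\<bar>))" for k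
  proof (induction k)
    case 0
    show ?case by (rule exI[of _ 0], rule exI[of _ "\<lambda>_. 0"]) (simp add: affine_fn_def)
  next
    case (Suc k)
    then obtain c a where ca: "avg n (\<lambda>l. \<bar>f l - affine_fn n c a l\<bar>)
        \<le> max (10 ^ 11 * \<delta>) ((9 / 10) ^ k * avg n (\<lambda>l. \<bar>f l\<bar>))" by blast
    define m where "m = avg n (\<lambda>l. \<bar>f l - affine_fn n c a l\<bar>)"
    show ?case
    proof (cases "m \<le> 10 ^ 11 * \<delta>")
      case True
      then show ?thesis unfolding m_def by (metis max.coboundedI1)
    next
      case False
      then have "m > 0" using \<open>\<delta> \<ge> 0\<close> by (smt (verit) mult_nonneg_nonneg zero_le_power)
      define g where "g l = (f l - affine_fn n c a l) / m" for l
      have "avg n (\<lambda>l. \<bar>g l\<bar>) \<le> 1"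
        unfolding g_def using \<open>m > 0\<close> by (simp add: abs_divide avg_divide m_def)
      moreover have "avg n (\<lambda>l. \<bar>defect g l\<bar>) \<le> 1 / 10 ^ 11"
      proof -
        have "avg n (\<lambda>l. \<bar>defect g l\<bar>) = avg n (\<lambda>l. \<bar>defect f l\<bar> / m)"
        proof (rule avg_cong)
          fix l :: "letter3 list" assume "length l = n"
          have "defect g l = (defect f l - defect (affine_fn n c a) l) / m"
            by (simp add: defect_def g_def add_divide_distrib diff_divide_distrib)
          then show "\<bar>defect g l\<bar> = \<bar>defect f l\<bar> / m"
            using defect_affine[OF \<open>length l = n\<close>] \<open>m > 0\<close> by (simp add: abs_divide)
        qed
        also have "\<dots> = \<delta> / m" by (simp add: avg_divide \<delta>_def)
        also have "\<dots> \<le> 1 / 10 ^ 11" using False \<open>m > 0\<close> by (simp add: field_simps)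
        finally show ?thesis .
      qed
      ultimately obtain c' a' where g: "avg n (\<lambda>l. \<bar>g l - affine_fn n c' a' l\<bar>) \<le> 9 / 10"
        using affine_contraction by blast
      have "affine_fn n (c + m * c') (\<lambda>j. a j + m * a' j) l = affine_fn n c a l + m * affine_fn n c' a' l" for l
        by (simp add: affine_fn_def algebra_simps sum.distrib sum_distrib_left)
      moreover have "f l - affine_fn n c a l = m * g l" for l using \<open>m > 0\<close> by (simp add: g_def)
      ultimately have "f l - affine_fn n (c + m * c') (\<lambda>j. a j + m * a' j) l
          = m * (g l - affine_fn n c' a' l)" for l
        by (simp add: right_diff_distrib)
      then have "avg n (\<lambda>l. \<bar>f l - affine_fn n (c + m * c') (\<lambda>j. a j + m * a' j) l\<bar>) \<le> 9 / 10 * m"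
        using g \<open>m > 0\<close> by (simp add: avg_cmult abs_mult)
      also have "\<dots> \<le> (9 / 10) ^ Suc k * avg n (\<lambda>l. \<bar>f l\<bar>)"
        using ca False by (simp add: m_def)
      finally show ?thesis by (meson max.coboundedI2)
    qed
  qed
  obtain k where k: "(9 / 10) ^ k * avg n (\<lambda>l. \<bar>f l\<bar>) \<le> \<epsilon>"
  proof -
    have "(\<lambda>k. (9 / 10 :: real) ^ k * avg n (\<lambda>l. \<bar>f l\<bar>)) \<longlonglongrightarrow> 0 * avg n (\<lambda>l. \<bar>f l\<bar>)"
      by (intro tendsto_intros LIMSEQ_realpow_zero) auto
    then have "\<forall>\<^sub>F k in sequentially. (9 / 10) ^ k * avg n (\<lambda>l. \<bar>f l\<bar>) < \<epsilon>"
      using assms by (intro order_tendstoD) auto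
    then show ?thesis using that by (metis eventually_sequentially le_refl less_imp_le)
  qed
  have "max (10 ^ 11 * \<delta>) ((9 / 10) ^ k * avg n (\<lambda>l. \<bar>f l\<bar>)) \<le> 10 ^ 11 * \<delta> + \<epsilon>"
    using k \<open>\<delta> \<ge> 0\<close> assms by simp
  then show ?thesis using step[of k] unfolding \<delta>_def by (meson order_trans)
qed

section \<open>Cylinder functions on the infinite cube\<close>

lemma avg_singleton: "length l = n \<Longrightarrow> avg n (\<lambda>m. of_bool (m = l)) = 1 / real CARD('a) ^ n"
  for l :: "'a::finite list"
proof (induction l arbitrary: n)
  case (Cons a l)
  then obtain k where n: "n = Suc k" and k: "length l = k" by auto
  have "avg k (\<lambda>m. of_bool (b # m = a # l)) = (if b = a then 1 / real CARD('a) ^ k else 0)" for b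
    using Cons.IH[OF k] by auto
  then show ?case by (simp add: n sum.delta)
qed simp

text \<open>Through this lemma the averages over words become integrals over \<open>cube\<close> and \<open>cube3\<close>.\<close>

lemma integral_uniform_word:
  fixes X :: "'b \<Rightarrow> 'a::finite list" and f :: "'a list \<Rightarrow> real"
  assumes "prob_space M"
    and len: "\<And>w. w \<in> space M \<Longrightarrow> length (X w) = n"
    and sets: "\<And>l. {w \<in> space M. X w = l} \<in> sets M"
    and unif: "\<And>l. length l = n \<Longrightarrow> measure M {w \<in> space M. X w = l} = 1 / real CARD('a) ^ n"
  shows "integrable M (\<lambda>w. f (X w))" and "(\<integral>w. f (X w) \<partial>M) = avg n f"
proof -
  interpret prob_space M by fact
  let ?L = "{l :: 'a list. length l = n}"
  let ?I = "\<lambda>l. indicator {w \<in> space M. X w = l} :: 'b \<Rightarrow> real"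
  have eq: "f (X w) = (\<Sum>l\<in>?L. f l * ?I l w)" if "w \<in> space M" for w
  proof -
    have "(\<Sum>l\<in>?L. f l * ?I l w) = (\<Sum>l\<in>?L. if l = X w then f l else 0)"
      using that by (intro sum.cong) (auto simp: indicator_def)
    then show ?thesis using len[OF that] by (simp add: sum.delta finite_words)
  qed
  have int: "integrable M (\<lambda>w. f l * ?I l w)" for l
    using sets by (intro integrable_mult_right) (simp add: emeasure_eq_measure integrable_indicator_iff)
  then have "integrable M (\<lambda>w. \<Sum>l\<in>?L. f l * ?I l w)" by (intro Bochner_Integration.integrable_sum)
  then show "integrable M (\<lambda>w. f (X w))"
    by (rule Bochner_Integration.integrable_cong[THEN iffD2, rotated -1]) (auto simp: eq)
  have "(\<integral>w. f (X w) \<partial>M) = (\<integral>w. (\<Sum>l\<in>?L. f l * ?I l w) \<partial>M)"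
    by (rule Bochner_Integration.integral_cong) (auto simp: eq)
  also have "\<dots> = (\<Sum>l\<in>?L. f l * (1 / real CARD('a) ^ n))"
  proof (subst Bochner_Integration.integral_sum[OF int], rule sum.cong[OF refl])
    fix l assume "l \<in> ?L"
    then show "(\<integral>w. f l * ?I l w \<partial>M) = f l * (1 / real CARD('a) ^ n)"
      using sets[of l] unif[of l] by (simp add: Int_absorb2)
  qed
  also have "\<dots> = avg n (\<lambda>m. \<Sum>l\<in>?L. f l * of_bool (m = l))"
    by (subst avg_sum) (auto simp: finite_words avg_cmult avg_singleton
        simp del: sum_mult_of_bool_eq intro!: sum.cong)
  also have "\<dots> = avg n f"
  proof (rule avg_cong)
    fix m :: "'a list" assume "length m = n"
    have "(\<Sum>l\<in>?L. f l * of_bool (m = l)) = (\<Sum>l\<in>?L. if l = m then f l else 0)"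
      by (rule sum.cong) (auto simp: of_bool_def)
    then show "(\<Sum>l\<in>?L. f l * of_bool (m = l)) = f m"
      using \<open>length m = n\<close> by (simp add: sum.delta finite_words)
  qed
  finally show "(\<integral>w. f (X w) \<partial>M) = avg n f" .
qed

definition bits :: "nat \<Rightarrow> (nat \<Rightarrow> real) \<Rightarrow> bool list" where
  "bits n x = map (\<lambda>j. x j = 1) [0..<n]"

definition triple_bits :: "nat \<Rightarrow> (nat \<Rightarrow> real) \<times> (nat \<Rightarrow> real) \<times> (nat \<Rightarrow> real) \<Rightarrow> letter3 list" where
  "triple_bits n = (\<lambda>(x, y, s). map (\<lambda>j. (x j = 1, y j = 1, s j = 1)) [0..<n])"

lemma length_bits [simp]: "length (bits n x) = n" "length (triple_bits n p) = n"
  by (simp_all add: bits_def triple_bits_def split_beta)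

lemma take_bits: "m \<le> n \<Longrightarrow> take m (bits n x) = bits m x"
  by (simp add: bits_def take_map)

lemma bit_sign_bits:
  assumes "x \<in> space cube" "j < n"
  shows "bit_sign (bits n x ! j) = x j"
proof -
  have "x j = 1 \<or> x j = - 1" using assms by (auto simp: space_cube)
  then show ?thesis using assms by (auto simp: bits_def bit_sign_def)
qed

lemma affine_fn_bits:
  assumes "x \<in> space cube"
  shows "affine_fn n c a (bits n x) = c + (\<Sum>j<n. a j * x j)"
  using assms by (simp add: affine_fn_def bit_sign_bits)

lemma triple_bits_eq_iff:
  "triple_bits n (x, y, s) = l
    \<longleftrightarrow> bits n x = map fst l \<and> bits n y = map (fst \<circ> snd) l \<and> bits n s = map (snd \<circ> snd) l"
  by (auto simp: triple_bits_def bits_def list_eq_iff_nth_eq prod_eq_iff)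

lemma D_fun_bits:
  assumes "p \<in> space cube3"
  shows "D_fun (\<lambda>x. f (bits n x)) p = defect f (triple_bits n p)"
proof -
  obtain x y s where p: "p = (x, y, s)" by (cases p)
  have s: "s \<in> space cube" using assms by (simp add: p space_cube3)
  have "xs (triple_bits n p) = bits n x" "ys (triple_bits n p) = bits n y"
    "zs (triple_bits n p) = bits n (mix_z x y s)" "ws (triple_bits n p) = bits n (mix_w x y s)"
    by (auto simp: p triple_bits_def bits_def mix_if[OF s])
  then show ?thesis by (simp add: D_fun_def defect_def p)
qed

lemma
  shows sets_bits: "{x \<in> space cube. bits n x = l} \<in> sets cube"
    and measure_bits: "length l = n \<Longrightarrow> measure cube {x \<in> space cube. bits n x = l} = 1 / 2 ^ n"
proof -
  let ?E = "{x \<in> space cube. bits n x = l}"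
  have E: "?E = {x \<in> space cube. length l = n \<and> (\<forall>j<n. (x j = 1) = l ! j)}"
    by (auto simp: bits_def list_eq_iff_nth_eq)
  show S: "?E \<in> sets cube"
    unfolding E by measurable
  assume l: "length l = n"
  define h :: "nat \<Rightarrow> real \<Rightarrow> ennreal" where "h j t = of_bool ((t = 1) = l ! j)" for j t
  have "emeasure cube ?E = (\<integral>\<^sup>+x. indicator ?E x \<partial>cube)" using S by simp
  also have "\<dots> = (\<integral>\<^sup>+x. (\<Prod>j<n. h j (x j)) \<partial>cube)"
  proof (rule nn_integral_cong)
    fix x assume "x \<in> space cube"
    then show "indicator ?E x = (\<Prod>j<n. h j (x j))"
      unfolding E using l by (auto simp: indicator_def h_def of_bool_def)
  qed
  also have "\<dots> = (\<Prod>j<n. (h j 1 + h j (- 1)) / 2)" by (rule nn_integral_cube_prod) simp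
  also have "\<dots> = (\<Prod>j<n. ennreal (1 / 2))"
  proof (rule prod.cong[OF refl])
    fix j
    have "ennreal (1 / 2) = 1 / 2" using divide_ennreal[of 1 2] by simp
    then show "(h j 1 + h j (- 1)) / 2 = ennreal (1 / 2)" by (auto simp: h_def)
  qed
  also have "\<dots> = ennreal (1 / 2 ^ n)" by (simp only: prod_constant card_lessThan ennreal_power power_divide) simp
  finally show "measure cube ?E = 1 / 2 ^ n" by (simp add: measure_def)
qed

lemma
  shows sets_triple_bits: "{p \<in> space cube3. triple_bits n p = l} \<in> sets cube3"
    and measure_triple_bits:
      "length l = n \<Longrightarrow> measure cube3 {p \<in> space cube3. triple_bits n p = l} = 1 / 8 ^ n"
proof -
  let ?A = "\<lambda>l. {x \<in> space cube. bits n x = l}"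
  have eq: "{p \<in> space cube3. triple_bits n p = l}
      = ?A (map fst l) \<times> ?A (map (fst \<circ> snd) l) \<times> ?A (map (snd \<circ> snd) l)"
  proof (rule set_eqI)
    fix p :: "(nat \<Rightarrow> real) \<times> (nat \<Rightarrow> real) \<times> (nat \<Rightarrow> real)"
    obtain x y s where p: "p = (x, y, s)" by (cases p)
    show "p \<in> {p \<in> space cube3. triple_bits n p = l}
        \<longleftrightarrow> p \<in> ?A (map fst l) \<times> ?A (map (fst \<circ> snd) l) \<times> ?A (map (snd \<circ> snd) l)"
      unfolding p space_cube3 mem_Collect_eq triple_bits_eq_iff mem_Times_iff by auto
  qed
  note S = sets_bits
  show "{p \<in> space cube3. triple_bits n p = l} \<in> sets cube3"
    unfolding eq unfolding cube3_def by (intro pair_measureI S)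
  assume l: "length l = n"
  have "emeasure cube3 {p \<in> space cube3. triple_bits n p = l}
      = emeasure cube (?A (map fst l)) * (emeasure cube (?A (map (fst \<circ> snd) l))
        * emeasure cube (?A (map (snd \<circ> snd) l)))"
    unfolding eq unfolding cube3_def
    by (simp add: cube2.emeasure_pair_measure_Times cube.emeasure_pair_measure_Times S pair_measureI)
  also have "\<dots> = ennreal (1 / 2 ^ n) * (ennreal (1 / 2 ^ n) * ennreal (1 / 2 ^ n))"
    using l by (simp add: cube.emeasure_eq_measure measure_bits)
  also have "\<dots> = ennreal (1 / 2 ^ n * (1 / 2 ^ n * (1 / 2 ^ n)))"
    by (simp only: ennreal_mult zero_le_divide_1_iff zero_le_power zero_le_numeral mult_nonneg_nonneg)
  also have "(1 / 2 ^ n * (1 / 2 ^ n * (1 / 2 ^ n)) :: real) = 1 / 8 ^ n"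
    by (simp add: power_mult_distrib[symmetric])
  finally show "measure cube3 {p \<in> space cube3. triple_bits n p = l} = 1 / 8 ^ n"
    by (simp add: measure_def)
qed

lemma integral_bits:
  "integrable cube (\<lambda>x. f (bits n x))" "(\<integral>x. f (bits n x) \<partial>cube) = avg n f"
  for f :: "bool list \<Rightarrow> real"
proof -
  have "measure cube {x \<in> space cube. bits n x = l} = 1 / real CARD(bool) ^ n" if "length l = n" for l
    using measure_bits[OF that] by simp
  note * = integral_uniform_word[OF cube.prob_space_axioms length_bits(1) sets_bits this]
  show "integrable cube (\<lambda>x. f (bits n x))" "(\<integral>x. f (bits n x) \<partial>cube) = avg n f"
    by (rule *; simp)+
qed

lemma integral_triple_bits:
  "integrable cube3 (\<lambda>p. f (triple_bits n p))" "(\<integral>p. f (triple_bits n p) \<partial>cube3) = avg n f"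
  for f :: "letter3 list \<Rightarrow> real"
proof -
  have "measure cube3 {p \<in> space cube3. triple_bits n p = l} = 1 / real CARD(letter3) ^ n"
    if "length l = n" for l
    using measure_triple_bits[OF that] by simp
  note * = integral_uniform_word[OF cube3.prob_space_axioms length_bits(2) sets_triple_bits this]
  show "integrable cube3 (\<lambda>p. f (triple_bits n p))" "(\<integral>p. f (triple_bits n p) \<partial>cube3) = avg n f"
    by (rule *; simp)+
qed

text \<open>The class of functions in the \<open>L^1\<close>-closure of the functions of finitely many coordinates. It contains the
indicators of the sets that generate the \<open>\<sigma>\<close>-algebra, and the next lemmas close it under the operations that lead
from these to all integrable functions.\<close>

definition cylinder_approximable :: "((nat \<Rightarrow> real) \<Rightarrow> real) \<Rightarrow> bool" where
  "cylinder_approximable F \<longleftrightarrow> integrable cube F \<and>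
    (\<forall>\<epsilon>>0. \<exists>n f. (\<integral>x. \<bar>F x - f (bits n x)\<bar> \<partial>cube) < \<epsilon>)"

text \<open>Used with affine combinations and with \<open>max\<close>, which on indicators are complements and unions.
Two approximations that depend on different numbers of coordinates are both read off from the longer word.\<close>

lemma cylinder_approximable_combine:
  assumes F: "cylinder_approximable F" and G: "cylinder_approximable G"
    and \<phi>: "\<And>a b c d. \<bar>\<phi> a b - \<phi> c d\<bar> \<le> K * (\<bar>a - c\<bar> + \<bar>b - d\<bar>)"
    and int: "integrable cube (\<lambda>x. \<phi> (F x) (G x))" and K: "0 < K"
  shows "cylinder_approximable (\<lambda>x. \<phi> (F x) (G x))"
  unfolding cylinder_approximable_def
proof (intro conjI allI impI int)
  fix \<epsilon> :: real assume "0 < \<epsilon>"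
  then have e: "0 < \<epsilon> / (2 * K)" using K by simp
  obtain n f where f: "(\<integral>x. \<bar>F x - f (bits n x)\<bar> \<partial>cube) < \<epsilon> / (2 * K)"
    using F e unfolding cylinder_approximable_def by blast
  obtain m g where g: "(\<integral>x. \<bar>G x - g (bits m x)\<bar> \<partial>cube) < \<epsilon> / (2 * K)"
    using G e unfolding cylinder_approximable_def by blast
  define N where "N = max n m"
  have intF: "integrable cube F" and intG: "integrable cube G"
    using F G by (auto simp: cylinder_approximable_def)
  have "(\<integral>x. \<bar>\<phi> (F x) (G x) - \<phi> (f (take n (bits N x))) (g (take m (bits N x)))\<bar> \<partial>cube)
      \<le> (\<integral>x. K * (\<bar>F x - f (bits n x)\<bar> + \<bar>G x - g (bits m x)\<bar>) \<partial>cube)"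
  proof (rule integral_mono)
    show "integrable cube (\<lambda>x. \<bar>\<phi> (F x) (G x) - \<phi> (f (take n (bits N x))) (g (take m (bits N x)))\<bar>)"
      using integral_bits(1)[of "\<lambda>l. \<phi> (f (take n l)) (g (take m l))" N] int by auto
    show "integrable cube (\<lambda>x. K * (\<bar>F x - f (bits n x)\<bar> + \<bar>G x - g (bits m x)\<bar>))"
      using intF intG integral_bits(1)[of f n] integral_bits(1)[of g m] by auto
    show "\<bar>\<phi> (F x) (G x) - \<phi> (f (take n (bits N x))) (g (take m (bits N x)))\<bar>
        \<le> K * (\<bar>F x - f (bits n x)\<bar> + \<bar>G x - g (bits m x)\<bar>)" for x
      using \<phi> by (simp add: N_def take_bits)
  qed
  also have "\<dots> = K * ((\<integral>x. \<bar>F x - f (bits n x)\<bar> \<partial>cube) + (\<integral>x. \<bar>G x - g (bits m x)\<bar> \<partial>cube))"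
    using intF intG integral_bits(1)[of f n] integral_bits(1)[of g m]
    by (simp add: Bochner_Integration.integral_add)
  also have "\<dots> < K * (\<epsilon> / (2 * K) + \<epsilon> / (2 * K))"
    using f g K by (intro mult_strict_left_mono add_strict_mono) auto
  also have "\<dots> = \<epsilon>" using K by (simp add: field_simps)
  finally show "\<exists>n h. (\<integral>x. \<bar>\<phi> (F x) (G x) - h (bits n x)\<bar> \<partial>cube) < \<epsilon>"
    by (intro exI[of _ N] exI[of _ "\<lambda>l. \<phi> (f (take n l)) (g (take m l))"])
qed

lemma cylinder_approximable_limit:
  assumes F: "integrable cube F" and s: "\<And>i. cylinder_approximable (s i)"
    and lim: "(\<lambda>i. \<integral>x. \<bar>F x - s i x\<bar> \<partial>cube) \<longlonglongrightarrow> 0"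
  shows "cylinder_approximable F"
  unfolding cylinder_approximable_def
proof (intro conjI allI impI F)
  fix \<epsilon> :: real assume "0 < \<epsilon>"
  have "\<forall>\<^sub>F i in sequentially. (\<integral>x. \<bar>F x - s i x\<bar> \<partial>cube) < \<epsilon> / 2"
    using lim \<open>0 < \<epsilon>\<close> by (intro order_tendstoD) auto
  then obtain i where i: "(\<integral>x. \<bar>F x - s i x\<bar> \<partial>cube) < \<epsilon> / 2"
    by (meson eventually_sequentially order_refl)
  obtain n f where f: "(\<integral>x. \<bar>s i x - f (bits n x)\<bar> \<partial>cube) < \<epsilon> / 2"
    using s[of i] \<open>0 < \<epsilon>\<close> unfolding cylinder_approximable_def by (meson half_gt_zero)
  have int: "integrable cube (s i)" using s[of i] by (simp add: cylinder_approximable_def)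
  have "(\<integral>x. \<bar>F x - f (bits n x)\<bar> \<partial>cube) \<le> (\<integral>x. \<bar>F x - s i x\<bar> + \<bar>s i x - f (bits n x)\<bar> \<partial>cube)"
    using F int integral_bits(1)[of f n] by (intro integral_mono) auto
  also have "\<dots> = (\<integral>x. \<bar>F x - s i x\<bar> \<partial>cube) + (\<integral>x. \<bar>s i x - f (bits n x)\<bar> \<partial>cube)"
    using F int integral_bits(1)[of f n] by (intro Bochner_Integration.integral_add) auto
  finally show "\<exists>n f. (\<integral>x. \<bar>F x - f (bits n x)\<bar> \<partial>cube) < \<epsilon>"
    using i f by (intro exI[of _ n] exI[of _ f]) linarith
qed

text \<open>The factor 2 is the one with which simple functions approximate an integrable function in
\<open>integrable_induct\<close>.\<close>

lemma cylinder_approximable_dominated: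
  assumes F: "integrable cube F" and s: "\<And>i. cylinder_approximable (s i)"
    and lim: "\<And>x. x \<in> space cube \<Longrightarrow> (\<lambda>i. s i x) \<longlonglongrightarrow> F x"
    and dom: "\<And>i x. x \<in> space cube \<Longrightarrow> \<bar>s i x\<bar> \<le> 2 * \<bar>F x\<bar>"
  shows "cylinder_approximable F"
proof (rule cylinder_approximable_limit[OF F s])
  have int: "integrable cube (s i)" for i using s[of i] by (simp add: cylinder_approximable_def)
  have "(\<lambda>i. \<integral>x. \<bar>F x - s i x\<bar> \<partial>cube) \<longlonglongrightarrow> (\<integral>x. 0 \<partial>cube)"
  proof (rule integral_dominated_convergence[where w = "\<lambda>x. 3 * \<bar>F x\<bar>"])
    show "AE x in cube. (\<lambda>i. \<bar>F x - s i x\<bar>) \<longlonglongrightarrow> 0"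
    proof (rule AE_I2)
      fix x assume "x \<in> space cube"
      then have "(\<lambda>i. \<bar>F x - s i x\<bar>) \<longlonglongrightarrow> \<bar>F x - F x\<bar>" by (intro tendsto_intros lim)
      then show "(\<lambda>i. \<bar>F x - s i x\<bar>) \<longlonglongrightarrow> 0" by simp
    qed
    show "AE x in cube. norm \<bar>F x - s i x\<bar> \<le> 3 * \<bar>F x\<bar>" for i
    proof (rule AE_I2)
      fix x assume "x \<in> space cube"
      from dom[OF this, of i] show "norm \<bar>F x - s i x\<bar> \<le> 3 * \<bar>F x\<bar>"
        unfolding real_norm_def by linarith
    qed
  qed (use F int in auto)
  then show "(\<lambda>i. \<integral>x. \<bar>F x - s i x\<bar> \<partial>cube) \<longlonglongrightarrow> 0" by simp
qed

lemma cylinder_approximable_bits: "cylinder_approximable (\<lambda>x. f (bits n x))"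
  unfolding cylinder_approximable_def
proof (intro conjI allI impI integral_bits(1))
  fix \<epsilon> :: real assume "0 < \<epsilon>"
  then show "\<exists>m g. (\<integral>x. \<bar>f (bits n x) - g (bits m x)\<bar> \<partial>cube) < \<epsilon>"
    by (intro exI[of _ n] exI[of _ f]) simp
qed

lemma cylinder_approximable_cong:
  assumes "\<And>x. x \<in> space cube \<Longrightarrow> F x = G x" "cylinder_approximable F"
  shows "cylinder_approximable G"
proof -
  have "integrable cube G \<longleftrightarrow> integrable cube F"
    by (rule Bochner_Integration.integrable_cong) (auto simp: assms)
  moreover have "(\<integral>x. \<bar>G x - f (bits n x)\<bar> \<partial>cube) = (\<integral>x. \<bar>F x - f (bits n x)\<bar> \<partial>cube)" for n f
    by (rule Bochner_Integration.integral_cong) (auto simp: assms)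
  ultimately show ?thesis using assms(2) by (simp add: cylinder_approximable_def)
qed

lemma cylinder_approximable_indicator:
  assumes "A \<in> sets cube"
  shows "cylinder_approximable (indicator A)"
proof -
  have ind: "integrable cube (indicator B :: _ \<Rightarrow> real)" if "B \<in> sets cube" for B
    using that by (simp add: integrable_indicator_iff cube.emeasure_eq_measure)
  let ?U = "uniform_count_measure {- 1, 1 :: real}"
  let ?\<Omega> = "\<Pi>\<^sub>E j\<in>(UNIV :: nat set). space ?U"
  have \<Omega>: "?\<Omega> = space cube" by (simp add: cube_def space_PiM)
  have cube_sets: "sets cube = sigma_sets ?\<Omega> {{f \<in> ?\<Omega>. f i \<in> B} | i B. i \<in> UNIV \<and> B \<in> sets ?U}"
    unfolding cube_def by (rule sets_PiM_single)
  have "A \<in> sigma_sets ?\<Omega> {{f \<in> ?\<Omega>. f i \<in> B} | i B. i \<in> UNIV \<and> B \<in> sets ?U}"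
    using assms by (simp only: cube_sets)
  then show ?thesis
  proof (induction rule: sigma_sets.induct)
    case (Basic A)
    then obtain i B where A: "A = {f \<in> space cube. f i \<in> B}" unfolding \<Omega> by blast
    show ?case
      by (rule cylinder_approximable_cong[OF _
            cylinder_approximable_bits[of "\<lambda>l. of_bool (bit_sign (l ! i) \<in> B)" "Suc i"]])
        (auto simp: A bit_sign_bits indicator_def)
  next
    case Empty
    show ?case
      by (rule cylinder_approximable_cong[OF _ cylinder_approximable_bits[of "\<lambda>_. 0" 0]]) simp
  next
    case (Compl A)
    have A: "A \<in> sets cube" using Compl.hyps by (simp only: cube_sets)
    have "cylinder_approximable (\<lambda>x. 1 - indicator A x + 0 * indicator A x)"
    proof (rule cylinder_approximable_combine[where K = 1 and \<phi> = "\<lambda>a b. 1 - a + 0 * b", OF Compl.IH Compl.IH])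
      show "integrable cube (\<lambda>x. 1 - indicator A x + 0 * indicator A x :: real)"
        using ind[OF A] by simp
    qed simp_all
    then show ?case
      by (rule cylinder_approximable_cong[rotated]) (auto simp: \<Omega> indicator_def)
  next
    case (Union a)
    have a: "a i \<in> sets cube" for i using Union.hyps[of i] by (simp only: cube_sets)
    have fin: "cylinder_approximable (indicator (\<Union>i<N. a i))" for N
    proof (induction N)
      case 0
      show ?case
        by (rule cylinder_approximable_cong[OF _ cylinder_approximable_bits[of "\<lambda>_. 0" 0]]) simp
    next
      case (Suc N)
      have "cylinder_approximable (\<lambda>x. max (indicator (\<Union>i<N. a i) x) (indicator (a N) x))"
      proof (rule cylinder_approximable_combine[where K = 1 and \<phi> = max, OF Suc Union.IH[of N]])
        show "integrable cube (\<lambda>x. max (indicator (\<Union>i<N. a i) x) (indicator (a N) x) :: real)"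
          using a by (intro integrable_max ind) auto
        show "\<bar>max p q - max r t\<bar> \<le> 1 * (\<bar>p - r\<bar> + \<bar>q - t\<bar>)" for p q r t :: real
          by (smt (verit))
      qed simp
      then show ?case
        by (rule cylinder_approximable_cong[rotated]) (auto simp: indicator_def less_Suc_eq)
    qed
    show ?case
    proof (rule cylinder_approximable_dominated[OF _ fin])
      show "integrable cube (indicator (\<Union> (range a)) :: _ \<Rightarrow> real)"
        using a by (intro ind) auto
      show "(\<lambda>N. indicator (\<Union>i<N. a i) x :: real) \<longlonglongrightarrow> indicator (\<Union> (range a)) x" for x
        by (rule LIMSEQ_indicator_UN)
      show "\<bar>indicator (\<Union>i<N. a i) x :: real\<bar> \<le> 2 * \<bar>indicator (\<Union> (range a)) x\<bar>" for N x
        by (auto simp: indicator_def)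
    qed
  qed
qed

lemma integrable_cylinder_approximable:
  assumes "integrable cube F"
  shows "cylinder_approximable F"
  using assms
proof (induction rule: integrable_induct)
  case (base A c)
  have "cylinder_approximable (\<lambda>x. c * indicator A x + 0 * indicator A x)"
  proof (rule cylinder_approximable_combine[where K = "\<bar>c\<bar> + 1" and \<phi> = "\<lambda>a b. c * a + 0 * b"])
    show "\<bar>c * a + 0 * b - (c * a' + 0 * b')\<bar> \<le> (\<bar>c\<bar> + 1) * (\<bar>a - a'\<bar> + \<bar>b - b'\<bar>)" for a b a' b'
    proof -
      have "c * a + 0 * b - (c * a' + 0 * b') = c * (a - a')" by (simp add: right_diff_distrib)
      then have "\<bar>c * a + 0 * b - (c * a' + 0 * b')\<bar> = \<bar>c\<bar> * \<bar>a - a'\<bar>" by (simp add: abs_mult)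
      also have "\<dots> \<le> (\<bar>c\<bar> + 1) * (\<bar>a - a'\<bar> + \<bar>b - b'\<bar>)" by (intro mult_mono) auto
      finally show ?thesis .
    qed
  qed (use base in \<open>auto simp: integrable_indicator_iff intro!: cylinder_approximable_indicator\<close>)
  then show ?case by (simp add: mult.commute)
next
  case (add f g)
  show ?case
    by (rule cylinder_approximable_combine[where K = 1 and \<phi> = "(+)", OF add.IH])
      (use add.hyps in auto)
next
  case (lim f s)
  show ?case
    by (rule cylinder_approximable_dominated[of f s]) (use lim in auto)
qed

section \<open>The operator D on integrable functions\<close>

lemma integral_along:
  fixes h :: "(nat \<Rightarrow> real) \<Rightarrow> real"
  assumes "g \<in> measurable cube3 cube" "distr cube3 cube g = cube" "integrable cube h"
  shows "integrable cube3 (\<lambda>p. h (g p))" "(\<integral>p. h (g p) \<partial>cube3) = (\<integral>x. h x \<partial>cube)"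
proof -
  have "integrable (distr cube3 cube g) h" using assms by (simp only:)
  from integrable_distr[OF assms(1) this] show "integrable cube3 (\<lambda>p. h (g p))" .
  have "(\<integral>x. h x \<partial>distr cube3 cube g) = (\<integral>p. h (g p) \<partial>cube3)"
    by (rule integral_distr[OF assms(1)]) (use assms(3) in simp)
  then show "(\<integral>p. h (g p) \<partial>cube3) = (\<integral>x. h x \<partial>cube)" by (simp only: assms(2))
qed

text \<open>The norm bound and the mean of \<open>D f\<close> depend on the four points only through the fact that each has
distribution \<open>cube\<close>.\<close>

lemma D_fun_points:
  obtains X Y Z W where
    "\<forall>h p. D_fun h p = h (X p) + h (Y p) - h (Z p) - h (W p)"
    "X \<in> measurable cube3 cube" "distr cube3 cube X = cube"
    "Y \<in> measurable cube3 cube" "distr cube3 cube Y = cube"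
    "Z \<in> measurable cube3 cube" "distr cube3 cube Z = cube"
    "W \<in> measurable cube3 cube" "distr cube3 cube W = cube"
proof (rule that[of "\<lambda>(x, y, s). x" "\<lambda>(x, y, s). y" "\<lambda>(x, y, s). mix_z x y s" "\<lambda>(x, y, s). mix_w x y s"])
  show "(\<lambda>(x, y, s). x) \<in> measurable cube3 cube" "(\<lambda>(x, y, s). y) \<in> measurable cube3 cube"
    unfolding cube3_def by measurable
  show "\<forall>h p. D_fun h p = h ((\<lambda>(x, y, s). x) p) + h ((\<lambda>(x, y, s). y) p)
      - h ((\<lambda>(x, y, s). mix_z x y s) p) - h ((\<lambda>(x, y, s). mix_w x y s) p)"
    by (simp add: D_fun_def split_beta)
qed (rule distr_points measurable_mix)+

lemma D_fun_norm_le: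
  assumes "integrable cube h"
  shows "(\<integral>p. \<bar>D_fun h p\<bar> \<partial>cube3) \<le> 4 * (\<integral>x. \<bar>h x\<bar> \<partial>cube)"
proof -
  obtain X Y Z W where D: "\<forall>h p. D_fun h p = h (X p) + h (Y p) - h (Z p) - h (W p)"
    and X: "X \<in> measurable cube3 cube" "distr cube3 cube X = cube"
    and Y: "Y \<in> measurable cube3 cube" "distr cube3 cube Y = cube"
    and Z: "Z \<in> measurable cube3 cube" "distr cube3 cube Z = cube"
    and W: "W \<in> measurable cube3 cube" "distr cube3 cube W = cube"
    by (rule D_fun_points)
  have h: "integrable cube (\<lambda>x. \<bar>h x\<bar>)" using assms by simp
  note I = integral_along[OF X h] integral_along[OF Y h] integral_along[OF Z h] integral_along[OF W h]
  have "(\<integral>p. \<bar>D_fun h p\<bar> \<partial>cube3) \<le> (\<integral>p. \<bar>h (X p)\<bar> + \<bar>h (Y p)\<bar> + \<bar>h (Z p)\<bar> + \<bar>h (W p)\<bar> \<partial>cube3)"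
  proof (rule integral_mono)
    show "integrable cube3 (\<lambda>p. \<bar>D_fun h p\<bar>)" using D_fun_integrable[OF assms] by simp
    show "\<bar>D_fun h p\<bar> \<le> \<bar>h (X p)\<bar> + \<bar>h (Y p)\<bar> + \<bar>h (Z p)\<bar> + \<bar>h (W p)\<bar>" for p
      unfolding D[rule_format] by linarith
  qed (use I in simp)
  also have "\<dots> = 4 * (\<integral>x. \<bar>h x\<bar> \<partial>cube)" using I by simp
  finally show ?thesis .
qed

lemma integral_D_fun:
  assumes h: "integrable cube h"
  shows "(\<integral>p. D_fun h p \<partial>cube3) = 0"
proof -
  obtain X Y Z W where D: "\<forall>h p. D_fun h p = h (X p) + h (Y p) - h (Z p) - h (W p)"
    and X: "X \<in> measurable cube3 cube" "distr cube3 cube X = cube"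
    and Y: "Y \<in> measurable cube3 cube" "distr cube3 cube Y = cube"
    and Z: "Z \<in> measurable cube3 cube" "distr cube3 cube Z = cube"
    and W: "W \<in> measurable cube3 cube" "distr cube3 cube W = cube"
    by (rule D_fun_points)
  show ?thesis
    unfolding D[rule_format]
    using integral_along[OF X h] integral_along[OF Y h] integral_along[OF Z h] integral_along[OF W h]
    by simp
qed

lemma affine_approximation_integrable:
  assumes F: "integrable cube F" and "0 < \<epsilon>"
  shows "\<exists>n c a. (\<integral>x. \<bar>F x - (c + (\<Sum>j<n. a j * x j))\<bar> \<partial>cube)
    \<le> 10 ^ 11 * (\<integral>p. \<bar>D_fun F p\<bar> \<partial>cube3) + \<epsilon>"
proof -
  \<comment> \<open>The error \<open>\<eta>\<close> of the cylinder approximation enters four times multiplied by \<open>10^11\<close> and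
    twice by itself.\<close>
  define \<eta> where "\<eta> = \<epsilon> / 10 ^ 12"
  have "0 < \<eta>" using assms by (simp add: \<eta>_def)
  obtain n f where f: "(\<integral>x. \<bar>F x - f (bits n x)\<bar> \<partial>cube) < \<eta>"
    using integrable_cylinder_approximable[OF F] \<open>0 < \<eta>\<close> unfolding cylinder_approximable_def by blast
  let ?g = "\<lambda>x. f (bits n x)"
  have g: "integrable cube ?g" by (rule integral_bits)
  have Fg: "integrable cube (\<lambda>x. F x - ?g x)" using F g by simp
  obtain c a where ca: "avg n (\<lambda>l. \<bar>f l - affine_fn n c a l\<bar>) \<le> 10 ^ 11 * avg n (\<lambda>l. \<bar>defect f l\<bar>) + \<eta>"
    using affine_approximation[OF \<open>0 < \<eta>\<close>] by blast
  let ?a = "\<lambda>x. c + (\<Sum>j<n. a j * x j)"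
  have 1: "(\<integral>x. \<bar>?g x - affine_fn n c a (bits n x)\<bar> \<partial>cube) = avg n (\<lambda>l. \<bar>f l - affine_fn n c a l\<bar>)"
    by (rule integral_bits(2))
  have 2: "(\<integral>p. \<bar>D_fun ?g p\<bar> \<partial>cube3) = avg n (\<lambda>l. \<bar>defect f l\<bar>)"
    unfolding integral_triple_bits(2)[symmetric]
    by (rule Bochner_Integration.integral_cong) (simp_all add: D_fun_bits)
  have 3: "(\<integral>p. \<bar>D_fun ?g p\<bar> \<partial>cube3) \<le> (\<integral>p. \<bar>D_fun F p\<bar> \<partial>cube3) + 4 * \<eta>"
  proof -
    have D: "integrable cube3 (D_fun F)" "integrable cube3 (D_fun (\<lambda>x. F x - ?g x))"
      using D_fun_integrable F Fg by auto
    have "(\<integral>p. \<bar>D_fun ?g p\<bar> \<partial>cube3) \<le> (\<integral>p. \<bar>D_fun F p\<bar> + \<bar>D_fun (\<lambda>x. F x - ?g x) p\<bar> \<partial>cube3)"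
    proof (rule integral_mono)
      show "integrable cube3 (\<lambda>p. \<bar>D_fun ?g p\<bar>)" using D_fun_integrable[OF g] by simp
      show "\<bar>D_fun ?g p\<bar> \<le> \<bar>D_fun F p\<bar> + \<bar>D_fun (\<lambda>x. F x - ?g x) p\<bar>" for p
        by (cases p) (simp add: D_fun_def)
    qed (use D in auto)
    also have "\<dots> = (\<integral>p. \<bar>D_fun F p\<bar> \<partial>cube3) + (\<integral>p. \<bar>D_fun (\<lambda>x. F x - ?g x) p\<bar> \<partial>cube3)"
      using D by (intro Bochner_Integration.integral_add) auto
    also have "\<dots> \<le> (\<integral>p. \<bar>D_fun F p\<bar> \<partial>cube3) + 4 * \<eta>"
      using D_fun_norm_le[OF Fg] f by simp
    finally show ?thesis .
  qed
  have ga: "integrable cube (\<lambda>x. affine_fn n c a (bits n x))" by (rule integral_bits(1))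
  have "(\<integral>x. \<bar>F x - ?a x\<bar> \<partial>cube) = (\<integral>x. \<bar>F x - affine_fn n c a (bits n x)\<bar> \<partial>cube)"
    by (rule Bochner_Integration.integral_cong) (simp_all add: affine_fn_bits)
  also have "\<dots> \<le> (\<integral>x. \<bar>F x - ?g x\<bar> + \<bar>?g x - affine_fn n c a (bits n x)\<bar> \<partial>cube)"
    by (rule integral_mono) (use F g ga in auto)
  also have "\<dots> = (\<integral>x. \<bar>F x - ?g x\<bar> \<partial>cube) + (\<integral>x. \<bar>?g x - affine_fn n c a (bits n x)\<bar> \<partial>cube)"
    using F g ga by (intro Bochner_Integration.integral_add) auto
  also have "\<dots> \<le> 10 ^ 11 * (\<integral>p. \<bar>D_fun F p\<bar> \<partial>cube3) + \<epsilon>"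
    using f 1 2 3 ca \<open>0 < \<eta>\<close> unfolding \<eta>_def by simp
  finally show ?thesis by blast
qed

definition linear_fn :: "nat \<Rightarrow> (nat \<Rightarrow> real) \<Rightarrow> (nat \<Rightarrow> real) \<Rightarrow> real" where
  "linear_fn n a x = (\<Sum>j<n. a j * x j)"

lemma integrable_coordinate: "integrable cube (\<lambda>x. x j)"
  using integral_bits(1)[of "\<lambda>l. bit_sign (l ! j)" "Suc j"]
  by (rule Bochner_Integration.integrable_cong[THEN iffD1, rotated -1]) (simp_all add: bit_sign_bits)

lemma avg_bit_sign: "j < n \<Longrightarrow> avg n (\<lambda>l. bit_sign (l ! j)) = 0"
proof (induction n arbitrary: j)
  case (Suc n)
  then show ?case
    by (cases j) (simp_all add: avg_Suc_halves bit_sign_def del: avg.simps(2))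
qed simp

lemma integral_coordinate: "(\<integral>x. x j \<partial>cube) = 0"
proof -
  have "(\<integral>x. x j \<partial>cube) = (\<integral>x. bit_sign (bits (Suc j) x ! j) \<partial>cube)"
    by (rule Bochner_Integration.integral_cong) (simp_all add: bit_sign_bits)
  then show ?thesis using integral_bits(2)[of "\<lambda>l. bit_sign (l ! j)" "Suc j"] by (simp only: avg_bit_sign lessI)
qed

lemma integrable_linear_fn: "integrable cube (linear_fn n a)"
  unfolding linear_fn_def[abs_def]
  by (intro Bochner_Integration.integrable_sum integrable_mult_right integrable_coordinate)

lemma integral_linear_fn: "(\<integral>x. linear_fn n a x \<partial>cube) = 0"
  unfolding linear_fn_def
  by (subst Bochner_Integration.integral_sum) (auto simp: integrable_coordinate integral_coordinate)

lemma D_fun_linear_fn: "D_fun (linear_fn n a) p = 0"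
proof -
  obtain x y s where p: "p = (x, y, s)" by (cases p)
  have "a j * mix_z x y s j + a j * mix_w x y s j = a j * x j + a j * y j" for j
    by (simp add: mix_z_def mix_w_def field_simps)
  then have "linear_fn n a (mix_z x y s) + linear_fn n a (mix_w x y s) = linear_fn n a x + linear_fn n a y"
    by (simp add: linear_fn_def sum.distrib[symmetric])
  then show ?thesis by (simp add: D_fun_def p)
qed

text \<open>Function-level descriptions of \<open>R_space\<close> and \<open>A_space\<close>, see \<open>R_space_eq\<close> and \<open>A_space_eq\<close>. Arguments can
then be about functions instead of classes.\<close>

definition rademacher_limit :: "((nat \<Rightarrow> real) \<Rightarrow> real) \<Rightarrow> bool" where
  "rademacher_limit r \<longleftrightarrow> integrable cube r \<and>
    (\<forall>\<epsilon>>0. \<exists>n a. (\<integral>x. \<bar>r x - linear_fn n a x\<bar> \<partial>cube) < \<epsilon>)"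

definition affine_limit :: "((nat \<Rightarrow> real) \<Rightarrow> real) \<Rightarrow> bool" where
  "affine_limit g \<longleftrightarrow> (\<exists>c r. rademacher_limit r \<and> g = (\<lambda>x. c + r x))"

lemma rademacher_limit_integrable: "rademacher_limit r \<Longrightarrow> integrable cube r"
  by (simp add: rademacher_limit_def)

lemma affine_limit_integrable: "affine_limit g \<Longrightarrow> integrable cube g"
  by (auto simp: affine_limit_def rademacher_limit_def)

lemma rademacher_limit_linear_fn: "rademacher_limit (linear_fn n a)"
  unfolding rademacher_limit_def
proof (intro conjI allI impI integrable_linear_fn)
  fix \<epsilon> :: real assume "0 < \<epsilon>"
  then show "\<exists>m b. (\<integral>x. \<bar>linear_fn n a x - linear_fn m b x\<bar> \<partial>cube) < \<epsilon>"
    by (intro exI[of _ n] exI[of _ a]) simp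
qed

lemma linear_fn_uminus: "linear_fn n (\<lambda>j. - a j) x = - linear_fn n a x"
  by (simp add: linear_fn_def sum_negf)

lemma rademacher_limit_uminus:
  assumes "rademacher_limit r"
  shows "rademacher_limit (\<lambda>x. - r x)"
  unfolding rademacher_limit_def
proof (intro conjI allI impI)
  show "integrable cube (\<lambda>x. - r x)" using rademacher_limit_integrable[OF assms] by simp
  fix \<epsilon> :: real assume "0 < \<epsilon>"
  then obtain n a where "(\<integral>x. \<bar>r x - linear_fn n a x\<bar> \<partial>cube) < \<epsilon>"
    using assms unfolding rademacher_limit_def by blast
  moreover have "(\<integral>x. \<bar>- r x - linear_fn n (\<lambda>j. - a j) x\<bar> \<partial>cube) = (\<integral>x. \<bar>r x - linear_fn n a x\<bar> \<partial>cube)"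
    by (rule Bochner_Integration.integral_cong) (auto simp: linear_fn_uminus)
  ultimately show "\<exists>n a. (\<integral>x. \<bar>- r x - linear_fn n a x\<bar> \<partial>cube) < \<epsilon>" by metis
qed

lemma affine_limit_uminus:
  assumes "affine_limit g"
  shows "affine_limit (\<lambda>x. - g x)"
proof -
  obtain c r where "rademacher_limit r" "g = (\<lambda>x. c + r x)" using assms by (auto simp: affine_limit_def)
  then show ?thesis
    unfolding affine_limit_def
    by (intro exI[of _ "- c"] exI[of _ "\<lambda>x. - r x"]) (auto simp: rademacher_limit_uminus)
qed

lemma abs_integral_le: "integrable M f \<Longrightarrow> \<bar>\<integral>x. f x \<partial>M\<bar> \<le> (\<integral>x. \<bar>f x\<bar> \<partial>M)"
  for f :: "'a \<Rightarrow> real"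
  using integral_norm_bound[of M f] by simp

lemma integral_rademacher_limit:
  assumes "rademacher_limit r"
  shows "(\<integral>x. r x \<partial>cube) = 0"
proof -
  have "\<bar>\<integral>x. r x \<partial>cube\<bar> \<le> \<epsilon>" if "0 < \<epsilon>" for \<epsilon>
  proof -
    obtain n a where na: "(\<integral>x. \<bar>r x - linear_fn n a x\<bar> \<partial>cube) < \<epsilon>"
      using assms \<open>0 < \<epsilon>\<close> unfolding rademacher_limit_def by blast
    have r: "integrable cube (\<lambda>x. r x - linear_fn n a x)"
      using rademacher_limit_integrable[OF assms] integrable_linear_fn[of n a] by auto
    have "(\<integral>x. r x \<partial>cube) = (\<integral>x. r x - linear_fn n a x \<partial>cube)"
      using rademacher_limit_integrable[OF assms] integrable_linear_fn[of n a]
      by (simp add: Bochner_Integration.integral_diff integral_linear_fn)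
    then show ?thesis using abs_integral_le[OF r] na by linarith
  qed
  then show ?thesis using field_le_epsilon[of "\<bar>\<integral>x. r x \<partial>cube\<bar>" 0] by simp
qed

lemma D_fun_add: "D_fun (\<lambda>x. f x + g x) p = D_fun f p + D_fun g p"
  and D_fun_diff: "D_fun (\<lambda>x. f x - g x) p = D_fun f p - D_fun g p"
  and D_fun_cmult: "D_fun (\<lambda>x. c * f x) p = c * D_fun f p"
  and D_fun_const: "D_fun (\<lambda>x. c) p = 0"
  by (simp_all add: D_fun_def split_beta algebra_simps)

lemma D_fun_affine_limit:
  assumes "affine_limit g"
  shows "(\<integral>p. \<bar>D_fun g p\<bar> \<partial>cube3) = 0"
proof -
  obtain c r where r: "rademacher_limit r" and g: "g = (\<lambda>x. c + r x)"
    using assms by (auto simp: affine_limit_def)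
  have "(\<integral>p. \<bar>D_fun g p\<bar> \<partial>cube3) \<le> 0 + \<epsilon>" if "0 < \<epsilon>" for \<epsilon>
  proof -
    obtain n a where na: "(\<integral>x. \<bar>r x - linear_fn n a x\<bar> \<partial>cube) < \<epsilon> / 4"
      using r \<open>0 < \<epsilon>\<close> unfolding rademacher_limit_def by (meson divide_pos_pos zero_less_numeral)
    have i: "integrable cube (\<lambda>x. r x - linear_fn n a x)"
      using rademacher_limit_integrable[OF r] integrable_linear_fn[of n a] by auto
    have "(\<integral>p. \<bar>D_fun g p\<bar> \<partial>cube3) = (\<integral>p. \<bar>D_fun (\<lambda>x. r x - linear_fn n a x) p\<bar> \<partial>cube3)"
      by (simp add: g D_fun_add D_fun_diff D_fun_const D_fun_linear_fn)
    also have "\<dots> \<le> 4 * (\<integral>x. \<bar>r x - linear_fn n a x\<bar> \<partial>cube)" by (rule D_fun_norm_le[OF i])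
    finally show ?thesis using na by simp
  qed
  then have "(\<integral>p. \<bar>D_fun g p\<bar> \<partial>cube3) \<le> 0" by (rule field_le_epsilon)
  moreover have "0 \<le> (\<integral>p. \<bar>D_fun g p\<bar> \<partial>cube3)" by simp
  ultimately show ?thesis by linarith
qed

lemma rademacher_limit_affine_limit: "rademacher_limit r \<Longrightarrow> affine_limit r"
  unfolding affine_limit_def by (intro exI[of _ 0] exI[of _ r]) simp

lemma D_fun_le_distance:
  assumes f: "integrable cube f" and g: "affine_limit g"
  shows "(\<integral>p. \<bar>D_fun f p\<bar> \<partial>cube3) \<le> 4 * (\<integral>x. \<bar>f x - g x\<bar> \<partial>cube)"
proof -
  have i: "integrable cube (\<lambda>x. f x - g x)" using f affine_limit_integrable[OF g] by simp
  have D: "integrable cube3 (\<lambda>p. \<bar>D_fun (\<lambda>x. f x - g x) p\<bar>)" "integrable cube3 (\<lambda>p. \<bar>D_fun g p\<bar>)"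
    using D_fun_integrable[OF i] D_fun_integrable[OF affine_limit_integrable[OF g]] by auto
  have "(\<integral>p. \<bar>D_fun f p\<bar> \<partial>cube3) \<le> (\<integral>p. \<bar>D_fun (\<lambda>x. f x - g x) p\<bar> + \<bar>D_fun g p\<bar> \<partial>cube3)"
  proof (rule integral_mono)
    show "integrable cube3 (\<lambda>p. \<bar>D_fun f p\<bar>)" using D_fun_integrable[OF f] by simp
    show "\<bar>D_fun f p\<bar> \<le> \<bar>D_fun (\<lambda>x. f x - g x) p\<bar> + \<bar>D_fun g p\<bar>" for p
      unfolding D_fun_diff by linarith
  qed (use D in simp)
  also have "\<dots> = (\<integral>p. \<bar>D_fun (\<lambda>x. f x - g x) p\<bar> \<partial>cube3)"
    using D by (simp add: D_fun_affine_limit[OF g])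
  also have "\<dots> \<le> 4 * (\<integral>x. \<bar>f x - g x\<bar> \<partial>cube)" by (rule D_fun_norm_le[OF i])
  finally show ?thesis .
qed

text \<open>The approximation theorem gives affine functions \<open>c + l\<close> arbitrarily close to \<open>f\<close>. Integration shows
that \<open>c\<close> is close to \<open>E f\<close>, so the linear functions \<open>l\<close> themselves approximate \<open>f - E f\<close>; this is
how the sum of the constants and the closed space \<open>R\<close> is seen to be closed.\<close>

lemma affine_limit_if_D_fun_eq_0:
  assumes f: "integrable cube f" and D: "(\<integral>p. \<bar>D_fun f p\<bar> \<partial>cube3) = 0"
  shows "affine_limit f"
proof -
  define m where "m = (\<integral>x. f x \<partial>cube)"
  have "rademacher_limit (\<lambda>x. f x - m)"
    unfolding rademacher_limit_def
  proof (intro conjI allI impI)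
    show "integrable cube (\<lambda>x. f x - m)" using f by simp
    fix \<epsilon> :: real assume "0 < \<epsilon>"
    then have "0 < \<epsilon> / 3" by simp
    from affine_approximation_integrable[OF f this] obtain n c a
      where na: "(\<integral>x. \<bar>f x - (c + linear_fn n a x)\<bar> \<partial>cube) \<le> \<epsilon> / 3"
      unfolding D linear_fn_def by auto
    have i: "integrable cube (\<lambda>x. f x - (c + linear_fn n a x))"
      using f integrable_linear_fn[of n a] by simp
    have "(\<integral>x. f x - (c + linear_fn n a x) \<partial>cube) = m - c"
      using f integrable_linear_fn[of n a]
      by (simp add: m_def integral_linear_fn cube.prob_space)
    then have "\<bar>m - c\<bar> \<le> \<epsilon> / 3" using abs_integral_le[OF i] na by simp
    have "(\<integral>x. \<bar>f x - m - linear_fn n a x\<bar> \<partial>cube)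
        \<le> (\<integral>x. \<bar>f x - (c + linear_fn n a x)\<bar> + \<bar>m - c\<bar> \<partial>cube)"
      by (rule integral_mono) (use i f integrable_linear_fn[of n a] in auto)
    also have "\<dots> = (\<integral>x. \<bar>f x - (c + linear_fn n a x)\<bar> \<partial>cube) + \<bar>m - c\<bar>"
      using i by (simp add: cube.prob_space)
    finally show "\<exists>n a. (\<integral>x. \<bar>f x - m - linear_fn n a x\<bar> \<partial>cube) < \<epsilon>"
      using na \<open>\<bar>m - c\<bar> \<le> \<epsilon> / 3\<close> \<open>0 < \<epsilon>\<close> by (intro exI[of _ n] exI[of _ a]) linarith
  qed
  then show ?thesis
    unfolding affine_limit_def by (intro exI[of _ m] exI[of _ "\<lambda>x. f x - m"]) simp
qed

section \<open>The subspaces R and A\<close>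

lemma L1_minus_cls:
  assumes "integrable M f" "integrable M g"
  shows "minus_on (L1 M) (cls M f) (cls M g) = cls M (\<lambda>x. f x - g x)"
  using assms by (simp add: minus_on_def L1_scl_cls L1_add_cls)

lemma carr_L1: "F \<in> carr (L1 M) \<longleftrightarrow> (\<exists>f. integrable M f \<and> F = cls M f)"
  by (auto simp: L1_def)

lemma linear_fn_pad:
  assumes "n \<le> N"
  shows "linear_fn n a x = linear_fn N (\<lambda>j. if j < n then a j else 0) x"
proof -
  have "(\<Sum>j<N. (if j < n then a j else 0) * x j) = (\<Sum>j<n. (if j < n then a j else 0) * x j)"
    using assms by (intro sum.mono_neutral_right) auto
  then show ?thesis by (simp add: linear_fn_def)
qed

lemma lspan_rademacher:
  "F \<in> lspan (L1 cube) (range rademacher) \<longleftrightarrow> (\<exists>n a. F = cls cube (linear_fn n a))"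
proof
  assume "F \<in> lspan (L1 cube) (range rademacher)"
  then show "\<exists>n a. F = cls cube (linear_fn n a)"
  proof (induction rule: lspan.induct)
    case zero
    show ?case by (rule exI[of _ 0]) (simp add: L1_def linear_fn_def[abs_def])
  next
    case (base F)
    then obtain j where F: "F = cls cube (\<lambda>x. x j)" by (auto simp: rademacher_def)
    have "(\<lambda>x. x j) = linear_fn (Suc j) (\<lambda>i. if i = j then 1 else 0)"
      by (auto simp: linear_fn_def)
    then show ?case unfolding F by metis
  next
    case (add F G)
    then obtain n a m b where F: "F = cls cube (linear_fn n a)" and G: "G = cls cube (linear_fn m b)"
      by blast
    let ?a = "\<lambda>j. if j < n then a j else 0" and ?b = "\<lambda>j. if j < m then b j else 0"
    let ?N = "max n m"
    have "linear_fn n a x + linear_fn m b x = linear_fn ?N (\<lambda>j. ?a j + ?b j) x" for x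
    proof -
      have "linear_fn n a x + linear_fn m b x = linear_fn ?N ?a x + linear_fn ?N ?b x"
        using linear_fn_pad[of n ?N a x] linear_fn_pad[of m ?N b x] by simp
      also have "\<dots> = linear_fn ?N (\<lambda>j. ?a j + ?b j) x"
        unfolding linear_fn_def by (simp only: distrib_right sum.distrib)
      finally show ?thesis .
    qed
    then show ?case
      unfolding F G L1_add_cls[OF integrable_linear_fn integrable_linear_fn] by (intro exI) simp
  next
    case (scl F c)
    then obtain n a where F: "F = cls cube (linear_fn n a)" by blast
    have "c * linear_fn n a x = linear_fn n (\<lambda>j. c * a j) x" for x
      by (simp add: linear_fn_def sum_distrib_left mult.assoc)
    then show ?case unfolding F L1_scl_cls[OF integrable_linear_fn] by (intro exI) simp
  qed
next
  have "cls cube (linear_fn n a) \<in> lspan (L1 cube) (range rademacher)" for n a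
  proof (induction n)
    case 0
    have "cls cube (linear_fn 0 a) = zer (L1 cube)" by (simp add: L1_def linear_fn_def[abs_def])
    then show ?case using lspan.zero[of "L1 cube"] by simp
  next
    case (Suc n)
    have "scl (L1 cube) (a n) (rademacher n) \<in> lspan (L1 cube) (range rademacher)"
      by (intro lspan.scl lspan.base) simp
    from lspan.add[OF Suc this] show ?case
      by (simp add: rademacher_def L1_scl_cls L1_add_cls integrable_coordinate integrable_linear_fn)
        (simp add: linear_fn_def[abs_def])
  qed
  then show "\<exists>n a. F = cls cube (linear_fn n a) \<Longrightarrow> F \<in> lspan (L1 cube) (range rademacher)" by blast
qed

lemma R_space_eq: "R_space = cls cube ` Collect rademacher_limit"
proof -
  have "cls cube f \<in> R_space \<longleftrightarrow> rademacher_limit f" if f: "integrable cube f" for f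
  proof -
    have "(\<exists>G\<in>lspan (L1 cube) (range rademacher). nrm (L1 cube) (minus_on (L1 cube) (cls cube f) G) < e)
        \<longleftrightarrow> (\<exists>n a. nrm (L1 cube) (minus_on (L1 cube) (cls cube f) (cls cube (linear_fn n a))) < e)" for e
      using lspan_rademacher by (metis (no_types, lifting))
    also have "\<dots> e \<longleftrightarrow> (\<exists>n a. (\<integral>x. \<bar>f x - linear_fn n a x\<bar> \<partial>cube) < e)" for e
      using f integrable_linear_fn by (simp add: L1_minus_cls L1_nrm_cls)
    finally show ?thesis
      using f by (auto simp: R_space_def closure_on_def rademacher_limit_def carr_L1)
  qed
  moreover have "\<exists>f. integrable cube f \<and> F = cls cube f" if "F \<in> R_space" for F
    using that by (simp add: R_space_def closure_on_def carr_L1)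
  ultimately show ?thesis using rademacher_limit_integrable by blast
qed

lemma A_space_eq: "A_space = cls cube ` Collect affine_limit"
proof -
  have "add (L1 cube) (scl (L1 cube) c one) (cls cube r) = cls cube (\<lambda>x. c + r x)"
    if "rademacher_limit r" for c r
    using rademacher_limit_integrable[OF that] by (simp add: one_def L1_scl_cls L1_add_cls)
  note eq = this
  show ?thesis
  proof (intro equalityI subsetI)
    fix F assume "F \<in> A_space"
    then obtain c r where r: "rademacher_limit r" and F: "F = cls cube (\<lambda>x. c + r x)"
      unfolding A_space_def R_space_eq using eq by auto
    then show "F \<in> cls cube ` Collect affine_limit" unfolding F affine_limit_def by blast
  next
    fix F assume "F \<in> cls cube ` Collect affine_limit"
    then obtain c r where r: "rademacher_limit r" and F: "F = cls cube (\<lambda>x. c + r x)"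
      unfolding affine_limit_def by blast
    then show "F \<in> A_space"
      unfolding A_space_def R_space_eq using eq[OF r, of c, symmetric] by blast
  qed
qed

section \<open>Distances and quotient norms\<close>

lemma dist_on_cls_le:
  assumes f: "integrable M f" and g: "P g" and P: "\<And>g. P g \<Longrightarrow> integrable M g"
  shows "dist_on (L1 M) (cls M f) (cls M ` Collect P) \<le> (\<integral>x. \<bar>f x - g x\<bar> \<partial>M)"
proof -
  have eq: "nrm (L1 M) (minus_on (L1 M) (cls M f) (cls M h)) = (\<integral>x. \<bar>f x - h x\<bar> \<partial>M)" if "P h" for h
    using f P[OF that] by (simp add: L1_minus_cls L1_nrm_cls)
  show ?thesis
    unfolding dist_on_def eq[OF g, symmetric]
    by (rule cINF_lower) (use g in \<open>auto simp: eq intro!: bdd_belowI[where m = 0]\<close>)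
qed

lemma le_dist_on_cls:
  assumes f: "integrable M f" and g: "P g" and P: "\<And>g. P g \<Longrightarrow> integrable M g"
    and m: "\<And>g. P g \<Longrightarrow> m \<le> (\<integral>x. \<bar>f x - g x\<bar> \<partial>M)"
  shows "m \<le> dist_on (L1 M) (cls M f) (cls M ` Collect P)"
  unfolding dist_on_def
proof (rule cINF_greatest)
  fix G assume "G \<in> cls M ` Collect P"
  then obtain h where h: "P h" and G: "G = cls M h" by auto
  then show "m \<le> nrm (L1 M) (minus_on (L1 M) (cls M f) G)"
    using f P[OF h] m[OF h] by (simp add: L1_minus_cls L1_nrm_cls)
qed (use g in auto)

lemma coset_cls:
  assumes f: "integrable M f" and P: "\<And>g. P g \<Longrightarrow> integrable M g"
  shows "coset (L1 M) (cls M ` Collect P) (cls M f) = (\<lambda>g. cls M (\<lambda>x. f x + g x)) ` Collect P"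
  using assms by (auto simp: coset_def L1_add_cls image_iff)

lemma quot_nrm_le:
  assumes f: "integrable M f" and g: "P g" and P: "\<And>g. P g \<Longrightarrow> integrable M g"
  shows "nrm (quot_space (L1 M) (cls M ` Collect P)) (coset (L1 M) (cls M ` Collect P) (cls M f))
    \<le> (\<integral>x. \<bar>f x + g x\<bar> \<partial>M)"
proof -
  have coset: "coset (L1 M) (cls M ` Collect P) (cls M f) = (\<lambda>g. cls M (\<lambda>x. f x + g x)) ` Collect P"
    by (rule coset_cls[OF f P])
  have eq: "nrm (L1 M) (cls M (\<lambda>x. f x + h x)) = (\<integral>x. \<bar>f x + h x\<bar> \<partial>M)" if "P h" for h
    using f P[OF that] by (simp add: L1_nrm_cls)
  show ?thesis
    unfolding quot_space_def nspace.simps coset eq[OF g, symmetric]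
    by (rule cINF_lower) (use g in \<open>auto simp: eq intro!: bdd_belowI[where m = 0]\<close>)
qed

lemma le_quot_nrm:
  assumes f: "integrable M f" and g: "P g" and P: "\<And>g. P g \<Longrightarrow> integrable M g"
    and m: "\<And>g. P g \<Longrightarrow> m \<le> (\<integral>x. \<bar>f x + g x\<bar> \<partial>M)"
  shows "m \<le> nrm (quot_space (L1 M) (cls M ` Collect P)) (coset (L1 M) (cls M ` Collect P) (cls M f))"
proof -
  have coset: "coset (L1 M) (cls M ` Collect P) (cls M f) = (\<lambda>g. cls M (\<lambda>x. f x + g x)) ` Collect P"
    by (rule coset_cls[OF f P])
  show ?thesis
    unfolding quot_space_def nspace.simps coset
  proof (rule cINF_greatest)
    fix G assume "G \<in> (\<lambda>g. cls M (\<lambda>x. f x + g x)) ` Collect P"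
    then obtain h where h: "P h" and G: "G = cls M (\<lambda>x. f x + h x)" by auto
    then show "m \<le> nrm (L1 M) G" using f P[OF h] m[OF h] by (simp add: L1_nrm_cls)
  qed (use g in auto)
qed

text \<open>The operations of a quotient space are computed on representatives chosen by \<open>rep\<close>. All that is known of
the chosen element is that it differs from \<open>f\<close> by an element of the subspace.\<close>

lemma rep_coset:
  assumes f: "integrable M f" and g: "P g" and P: "\<And>g. P g \<Longrightarrow> integrable M g"
  obtains h where "P h" "rep (coset (L1 M) (cls M ` Collect P) (cls M f)) = cls M (\<lambda>x. f x + h x)"
proof -
  let ?K = "coset (L1 M) (cls M ` Collect P) (cls M f)"
  have coset: "coset (L1 M) (cls M ` Collect P) (cls M f) = (\<lambda>g. cls M (\<lambda>x. f x + g x)) ` Collect P"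
    by (rule coset_cls[OF f P])
  have "cls M (\<lambda>x. f x + g x) \<in> ?K" unfolding coset using g by auto
  then have "rep ?K \<in> ?K" unfolding rep_def by (rule someI)
  then show ?thesis using that unfolding coset by auto
qed

section \<open>The two-sided bound, the kernel of D and the map J\<close>

lemma rademacher_limit_zero: "rademacher_limit (\<lambda>x. 0)"
  using rademacher_limit_linear_fn[of 0 "\<lambda>_. 0"] by (simp add: linear_fn_def[abs_def])

lemma affine_limit_zero: "affine_limit (\<lambda>x. 0)"
  by (rule rademacher_limit_affine_limit[OF rademacher_limit_zero])

lemma nrm_D_op: "integrable cube f \<Longrightarrow> nrm (L1 cube3) (D_op (cls cube f)) = (\<integral>p. \<bar>D_fun f p\<bar> \<partial>cube3)"
  by (simp add: D_op_cls L1_nrm_cls D_fun_integrable)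

lemma two_sided_bound_if_ge:
  assumes C: "10 ^ 11 \<le> C"
  shows "two_sided_bound C"
  unfolding two_sided_bound_def
proof
  fix F assume "F \<in> carr (L1 cube)"
  then obtain f where f: "integrable cube f" and F: "F = cls cube f" by (auto simp: carr_L1)
  let ?d = "dist_on (L1 cube) F A_space" and ?D = "\<integral>p. \<bar>D_fun f p\<bar> \<partial>cube3"
  have "0 \<le> ?D" by simp
  have "?D / 4 \<le> ?d"
    unfolding F A_space_eq
    by (rule le_dist_on_cls[where P = affine_limit, OF f affine_limit_zero affine_limit_integrable])
      (use D_fun_le_distance[OF f] in \<open>auto simp: field_simps\<close>)
  moreover have "?d \<le> 10 ^ 11 * ?D"
  proof (rule field_le_epsilon)
    fix \<epsilon> :: real assume "0 < \<epsilon>"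
    from affine_approximation_integrable[OF f this] obtain n c a
      where na: "(\<integral>x. \<bar>f x - (c + linear_fn n a x)\<bar> \<partial>cube) \<le> 10 ^ 11 * ?D + \<epsilon>"
      unfolding linear_fn_def by auto
    have "affine_limit (\<lambda>x. c + linear_fn n a x)"
      using rademacher_limit_linear_fn by (auto simp: affine_limit_def)
    from dist_on_cls_le[where P = affine_limit, OF f this affine_limit_integrable]
    show "?d \<le> 10 ^ 11 * ?D + \<epsilon>" using na by (simp add: F A_space_eq)
  qed
  then have "?d \<le> C * ?D" using mult_right_mono[OF C \<open>0 \<le> ?D\<close>] by linarith
  ultimately show "1 / C * ?d \<le> nrm (L1 cube3) (D_op F) \<and> nrm (L1 cube3) (D_op F) \<le> 4 * ?d"
    using C by (simp add: F nrm_D_op[OF f] field_simps)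
qed

lemma D_op_eq_zero_iff:
  assumes f: "integrable cube f"
  shows "D_op (cls cube f) = zer (L1 cube3) \<longleftrightarrow> (\<integral>p. \<bar>D_fun f p\<bar> \<partial>cube3) = 0"
proof -
  have "D_op (cls cube f) = zer (L1 cube3) \<longleftrightarrow> (AE p in cube3. D_fun f p = 0)"
    unfolding D_op_cls[OF f] by (simp add: L1_def cls_eq_iff D_fun_integrable[OF f])
  also have "\<dots> \<longleftrightarrow> (\<integral>p. \<bar>D_fun f p\<bar> \<partial>cube3) = 0"
    using D_fun_integrable[OF f] by (subst integral_nonneg_eq_0_iff_AE) auto
  finally show ?thesis .
qed

lemma kernel_D_op: "{F \<in> carr (L1 cube). D_op F = zer (L1 cube3)} = A_space"
proof (intro equalityI subsetI)
  fix F assume "F \<in> {F \<in> carr (L1 cube). D_op F = zer (L1 cube3)}"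
  then obtain f where "integrable cube f" "F = cls cube f" "D_op (cls cube f) = zer (L1 cube3)"
    by (auto simp: carr_L1)
  then show "F \<in> A_space"
    using affine_limit_if_D_fun_eq_0[of f] D_op_eq_zero_iff[of f] by (auto simp: A_space_eq)
next
  fix F assume "F \<in> A_space"
  then obtain f where f: "affine_limit f" and F: "F = cls cube f" by (auto simp: A_space_eq)
  then show "F \<in> {F \<in> carr (L1 cube). D_op F = zer (L1 cube3)}"
    using affine_limit_integrable[OF f] D_fun_affine_limit[OF f] D_op_eq_zero_iff[of f]
    by (auto simp: carr_L1)
qed

abbreviation quot_nrm_R :: "((nat \<Rightarrow> real) \<Rightarrow> real) \<Rightarrow> real" where
  "quot_nrm_R f \<equiv> nrm (quot_space (L1 cube) R_space) (coset (L1 cube) R_space (cls cube f))"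

text \<open>For every \<open>r\<close> in \<open>R\<close> both \<open>E\<close> and \<open>D\<close> agree on \<open>f\<close> and \<open>f + r\<close>; the constants \<open>1\<close> and \<open>4\<close>
are bounds for their norms.\<close>

lemma quot_nrm_R_upper:
  assumes f: "integrable cube f"
  shows "\<bar>\<integral>x. f x \<partial>cube\<bar> + (\<integral>p. \<bar>D_fun f p\<bar> \<partial>cube3) \<le> 5 * quot_nrm_R f"
proof -
  have "(\<bar>\<integral>x. f x \<partial>cube\<bar> + (\<integral>p. \<bar>D_fun f p\<bar> \<partial>cube3)) / 5 \<le> quot_nrm_R f"
    unfolding R_space_eq
  proof (rule le_quot_nrm[where P = rademacher_limit, OF f rademacher_limit_zero rademacher_limit_integrable])
    fix r assume r: "rademacher_limit r"
    have i: "integrable cube (\<lambda>x. f x + r x)" using f rademacher_limit_integrable[OF r] by simp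
    have "(\<integral>x. f x + r x \<partial>cube) = (\<integral>x. f x \<partial>cube)"
      using f rademacher_limit_integrable[OF r] by (simp add: integral_rademacher_limit[OF r])
    then have 1: "\<bar>\<integral>x. f x \<partial>cube\<bar> \<le> (\<integral>x. \<bar>f x + r x\<bar> \<partial>cube)" using abs_integral_le[OF i] by simp
    have "(\<integral>p. \<bar>D_fun f p\<bar> \<partial>cube3) \<le> 4 * (\<integral>x. \<bar>f x + r x\<bar> \<partial>cube)"
      using D_fun_le_distance[OF f rademacher_limit_affine_limit[OF rademacher_limit_uminus[OF r]]]
      by simp
    with 1 show "(\<bar>\<integral>x. f x \<partial>cube\<bar> + (\<integral>p. \<bar>D_fun f p\<bar> \<partial>cube3)) / 5 \<le> (\<integral>x. \<bar>f x + r x\<bar> \<partial>cube)"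
      by simp
  qed
  then show ?thesis by simp
qed

text \<open>If \<open>c + r\<close> is close to \<open>f\<close>, then \<open>c\<close> is close to \<open>E f\<close>. Dropping the constant therefore changes the
error by at most \<open>\<bar>E f\<bar>\<close> plus the error itself.\<close>

lemma quot_nrm_R_le:
  assumes f: "integrable cube f"
  shows "quot_nrm_R f \<le> \<bar>\<integral>x. f x \<partial>cube\<bar> + 2 * dist_on (L1 cube) (cls cube f) A_space"
proof -
  have "(quot_nrm_R f - \<bar>\<integral>x. f x \<partial>cube\<bar>) / 2 \<le> dist_on (L1 cube) (cls cube f) A_space"
    unfolding A_space_eq
  proof (rule le_dist_on_cls[where P = affine_limit, OF f affine_limit_zero affine_limit_integrable])
    fix g assume "affine_limit g"
    then obtain c r where r: "rademacher_limit r" and g: "g = (\<lambda>x. c + r x)"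
      by (auto simp: affine_limit_def)
    have i: "integrable cube (\<lambda>x. f x - g x)" "integrable cube r"
      using f rademacher_limit_integrable[OF r] by (simp_all add: g)
    have "(\<integral>x. f x - g x \<partial>cube) = (\<integral>x. f x \<partial>cube) - c"
      using f i by (simp add: g integral_rademacher_limit[OF r] cube.prob_space)
    then have c: "\<bar>c\<bar> \<le> \<bar>\<integral>x. f x \<partial>cube\<bar> + (\<integral>x. \<bar>f x - g x\<bar> \<partial>cube)"
      using abs_integral_le[OF i(1)] by linarith
    have "quot_nrm_R f \<le> (\<integral>x. \<bar>f x + - r x\<bar> \<partial>cube)"
      unfolding R_space_eq
      by (rule quot_nrm_le[where P = rademacher_limit, OF f rademacher_limit_uminus[OF r] rademacher_limit_integrable])
    also have "\<dots> \<le> (\<integral>x. \<bar>f x - g x\<bar> + \<bar>c\<bar> \<partial>cube)"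
      by (rule integral_mono) (use f i in \<open>auto simp: g\<close>)
    also have "\<dots> = (\<integral>x. \<bar>f x - g x\<bar> \<partial>cube) + \<bar>c\<bar>"
      using i by (simp add: cube.prob_space)
    finally show "(quot_nrm_R f - \<bar>\<integral>x. f x \<partial>cube\<bar>) / 2 \<le> (\<integral>x. \<bar>f x - g x\<bar> \<partial>cube)"
      using c by simp
  qed
  then show ?thesis by simp
qed

lemma D_op_rep_coset:
  assumes f: "integrable cube f"
  shows "expect (rep (coset (L1 cube) R_space (cls cube f))) = (\<integral>x. f x \<partial>cube)"
    and "D_op (rep (coset (L1 cube) R_space (cls cube f))) = D_op (cls cube f)"
proof -
  obtain r where r: "rademacher_limit r"
    and eq: "rep (coset (L1 cube) R_space (cls cube f)) = cls cube (\<lambda>x. f x + r x)"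
    unfolding R_space_eq by (rule rep_coset[where P = rademacher_limit, OF f rademacher_limit_zero rademacher_limit_integrable])
  have i: "integrable cube r" by (rule rademacher_limit_integrable[OF r])
  show "expect (rep (coset (L1 cube) R_space (cls cube f))) = (\<integral>x. f x \<partial>cube)"
    unfolding eq using f i by (simp add: expect_cls integral_rademacher_limit[OF r])
  have "(\<integral>p. \<bar>D_fun r p\<bar> \<partial>cube3) = 0"
    by (rule D_fun_affine_limit[OF rademacher_limit_affine_limit[OF r]])
  then have "AE p in cube3. \<bar>D_fun r p\<bar> = 0"
    using D_fun_integrable[OF i] by (subst (asm) integral_nonneg_eq_0_iff_AE) auto
  then have "cls cube3 (D_fun (\<lambda>x. f x + r x)) = cls cube3 (D_fun f)"
    by (intro cls_cong) (auto simp: D_fun_add elim: eventually_mono)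
  then show "D_op (rep (coset (L1 cube) R_space (cls cube f))) = D_op (cls cube f)"
    unfolding eq using f i by (simp add: D_op_cls)
qed

lemma quotient_map_bounds:
  "\<exists>J \<in> carr (quot_space (L1 cube) R_space) \<rightarrow> carr (sum1 real_line (L1 cube3)).
     (\<forall>F\<in>carr (L1 cube). J (coset (L1 cube) R_space F) = (expect F, D_op F)) \<and>
     (\<forall>C\<ge>1. two_sided_bound C \<longrightarrow>
       (\<forall>F\<in>carr (L1 cube).
         1 / (2 * C) * nrm (quot_space (L1 cube) R_space) (coset (L1 cube) R_space F)
           \<le> nrm (sum1 real_line (L1 cube3)) (J (coset (L1 cube) R_space F)) \<and>
         nrm (sum1 real_line (L1 cube3)) (J (coset (L1 cube) R_space F))
           \<le> 5 * nrm (quot_space (L1 cube) R_space) (coset (L1 cube) R_space F)))"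
proof (rule bexI[where x = "\<lambda>K. (expect (rep K), D_op (rep K))"], intro conjI ballI allI impI)
  let ?J = "\<lambda>K. (expect (rep K), D_op (rep K))"
  have J: "?J (coset (L1 cube) R_space (cls cube f)) = (expect (cls cube f), D_op (cls cube f))"
    if "integrable cube f" for f
    using that by (simp add: D_op_rep_coset expect_cls)
  show "?J (coset (L1 cube) R_space F) = (expect F, D_op F)" if "F \<in> carr (L1 cube)" for F
    using that J by (auto simp: carr_L1)
  show "?J \<in> carr (quot_space (L1 cube) R_space) \<rightarrow> carr (sum1 real_line (L1 cube3))"
  proof
    fix K assume "K \<in> carr (quot_space (L1 cube) R_space)"
    then obtain f where f: "integrable cube f" and K: "K = coset (L1 cube) R_space (cls cube f)"
      by (auto simp: quot_space_def carr_L1)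
    have "D_op (cls cube f) \<in> carr (L1 cube3)"
      using D_fun_integrable[OF f] by (auto simp: D_op_cls[OF f] carr_L1)
    then show "?J K \<in> carr (sum1 real_line (L1 cube3))"
      unfolding K J[OF f] by (simp add: sum1_def real_line_def)
  qed
  fix C :: real and F assume C: "1 \<le> C" "two_sided_bound C" and F: "F \<in> carr (L1 cube)"
  then obtain f where f: "integrable cube f" and Ff: "F = cls cube f" by (auto simp: carr_L1)
  let ?E = "\<bar>\<integral>x. f x \<partial>cube\<bar>" and ?D = "\<integral>p. \<bar>D_fun f p\<bar> \<partial>cube3"
  have nJ: "nrm (sum1 real_line (L1 cube3)) (?J (coset (L1 cube) R_space F)) = ?E + ?D"
    unfolding Ff J[OF f] by (simp add: sum1_def real_line_def expect_cls[OF f] nrm_D_op[OF f])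
  show "nrm (sum1 real_line (L1 cube3)) (?J (coset (L1 cube) R_space F))
      \<le> 5 * nrm (quot_space (L1 cube) R_space) (coset (L1 cube) R_space F)"
    unfolding nJ using quot_nrm_R_upper[OF f] by (simp add: Ff)
  have "dist_on (L1 cube) (cls cube f) A_space \<le> C * ?D"
    using C F unfolding two_sided_bound_def by (auto simp: Ff nrm_D_op[OF f] field_simps)
  then have "quot_nrm_R f \<le> ?E + 2 * (C * ?D)" using quot_nrm_R_le[OF f] by linarith
  also have "\<dots> \<le> 2 * C * (?E + ?D)"
    using mult_right_mono[of 1 "2 * C" ?E] C(1) by (simp add: algebra_simps)
  finally show "1 / (2 * C) * nrm (quot_space (L1 cube) R_space) (coset (L1 cube) R_space F)
      \<le> nrm (sum1 real_line (L1 cube3)) (?J (coset (L1 cube) R_space F))"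
    unfolding nJ using C(1) by (simp add: Ff field_simps)
qed

section \<open>A measure preserving map from the unit interval to the triple cube\<close>

text \<open>Product functions determine a measure on the cube. Only lengths divisible by three are
required, which suits the interleaving of three sequences below; the remaining factors can be set to 1.\<close>

lemma distr_eq_cubeI:
  assumes m: "g \<in> measurable M cube" and "prob_space M"
    and prod: "\<And>(h :: nat \<Rightarrow> real \<Rightarrow> ennreal) n.
      (\<integral>\<^sup>+w. (\<Prod>j<3 * n. h j (g w j)) \<partial>M) = (\<Prod>j<3 * n. (h j 1 + h j (- 1)) / 2)"
  shows "distr M cube g = cube"
proof -
  interpret M: prob_space M by fact
  let ?U = "uniform_count_measure {- 1, 1 :: real}"
  have "distr M cube g = PiM UNIV (\<lambda>_. ?U)"
  proof (rule measure_eqI_PiM_infinite)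
    show "sets (distr M cube g) = sets (PiM UNIV (\<lambda>_. ?U))" by (simp add: cube_def)
    show "finite_measure (distr M cube g)"
      by (intro prob_space.finite_measure M.prob_space_distr m)
    fix A and J :: "nat set"
    assume J: "finite J" and A: "\<And>j. j \<in> J \<Longrightarrow> A j \<in> sets ?U"
    let ?E = "prod_emb UNIV (\<lambda>_. ?U) J (Pi\<^sub>E J A)"
    have E: "?E \<in> sets cube"
      unfolding cube_def by (intro sets_PiM_I) (use J A in auto)
    obtain n where n: "J \<subseteq> {..<n}" using finite_nat_iff_bounded J by blast
    then have n3: "J \<subseteq> {..<3 * n}" by (force dest: subsetD)
    define h :: "nat \<Rightarrow> real \<Rightarrow> ennreal" where "h j t = (if j \<in> J then indicator (A j) t else 1)" for j t
    have ind: "indicator ?E x = (\<Prod>j<3 * n. h j (x j))" if "x \<in> space cube" for x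
    proof -
      have "(\<Prod>j<3 * n. h j (x j)) = (\<Prod>j\<in>J. h j (x j))"
        using n3 by (intro prod.mono_neutral_right) (auto simp: h_def)
      also have "\<dots> = indicator ?E x"
      proof (cases "\<forall>j\<in>J. x j \<in> A j")
        case True
        then show ?thesis
          using that by (auto simp: h_def indicator_def prod_emb_def cube_def space_PiM PiE_iff)
      next
        case False
        then have "(\<Prod>j\<in>J. h j (x j)) = 0" using J by (auto simp: h_def indicator_def)
        then show ?thesis using False by (auto simp: indicator_def prod_emb_def PiE_iff)
      qed
      finally show ?thesis ..
    qed
    have "emeasure (distr M cube g) ?E = (\<integral>\<^sup>+w. indicator ?E (g w) \<partial>M)"
      using m E by (simp add: nn_integral_distr flip: nn_integral_indicator)
    also have "\<dots> = (\<integral>\<^sup>+w. (\<Prod>j<3 * n. h j (g w j)) \<partial>M)"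
      by (intro nn_integral_cong ind measurable_space[OF m])
    also have "\<dots> = (\<integral>\<^sup>+x. (\<Prod>j<3 * n. h j (x j)) \<partial>cube)"
      by (simp only: prod nn_integral_cube_prod finite_lessThan)
    also have "\<dots> = (\<integral>\<^sup>+x. indicator ?E x \<partial>cube)" by (intro nn_integral_cong ind[symmetric])
    also have "\<dots> = emeasure (PiM UNIV (\<lambda>_. ?U)) ?E" using E by (simp add: cube_def)
    finally show "emeasure (distr M cube g) ?E = emeasure (PiM UNIV (\<lambda>_. ?U)) ?E" .
  qed simp
  then show ?thesis by (simp add: cube_def)
qed

abbreviation unit_interval :: "real measure" where
  "unit_interval \<equiv> lebesgue_on {0<..<1}"

text \<open>Binary digits written with \<open>-1\<close> and \<open>1\<close>. Numbers with two expansions get the finite one; they form a null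
set.\<close>

definition digit :: "real \<Rightarrow> nat \<Rightarrow> real" where
  "digit t j = (if odd \<lfloor>2 ^ Suc j * t\<rfloor> then 1 else - 1)"

lemma digit_Suc: "digit t (Suc j) = digit (2 * t) j"
  by (simp add: digit_def mult_ac)

lemma digit_minus_1: "digit (t - 1) j = digit t j"
proof -
  have "\<lfloor>2 ^ Suc j * (t - 1)\<rfloor> = \<lfloor>2 ^ Suc j * t - of_int (2 ^ Suc j)\<rfloor>" by (simp add: algebra_simps)
  also have "\<dots> = \<lfloor>2 ^ Suc j * t\<rfloor> - 2 ^ Suc j" by (rule floor_diff_of_int)
  finally show ?thesis by (simp add: digit_def)
qed

lemma measurable_digit [measurable]: "(\<lambda>t. digit t j) \<in> measurable borel (count_space {- 1, 1})"
proof -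
  have "(\<lambda>t::real. if odd \<lfloor>2 ^ Suc j * t\<rfloor> then 1 else - 1 :: real) \<in> measurable borel (count_space {- 1, 1})"
    by measurable
  then show ?thesis by (simp only: digit_def[abs_def])
qed

text \<open>The first digit is constant on each half of the interval, and the further digits on each half are the digits of
the point rescaled to the full interval. The midpoint belongs to neither open half and is neglected.\<close>

lemma nn_integral_digits:
  fixes h :: "nat \<Rightarrow> real \<Rightarrow> ennreal"
  shows "(\<integral>\<^sup>+t. (\<Prod>j<n. h j (digit t j)) * indicator {0<..<1} t \<partial>lborel)
    = (\<Prod>j<n. (h j 1 + h j (- 1)) / 2)"
proof (induction n arbitrary: h)
  case 0
  show ?case by simp
next
  case (Suc n)
  define G where "G t = (\<Prod>j<n. h (Suc j) (digit t j)) * indicator {0<..<1} t" for t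
  have hm: "(\<lambda>t. h j (digit t k)) \<in> borel_measurable borel" for j k
    by (rule measurable_compose[OF measurable_digit]) simp
  have Gm [measurable]: "G \<in> borel_measurable borel"
    unfolding G_def by (intro borel_measurable_times_ennreal borel_measurable_prod_ennreal hm) simp
  have half: "(\<integral>\<^sup>+t. G t \<partial>lborel) = 2 * (\<integral>\<^sup>+t. G (s + 2 * t) \<partial>lborel)" for s
    using nn_integral_real_affine[OF Gm, of 2 s] by simp
  have mult_half: "a / 2 * (2 * b) = a * b" for a b :: ennreal
  proof -
    have "a / 2 * (2 * b) = a * b * 2 / 2"
      by (simp add: divide_ennreal_def mult_ac)
    then show ?thesis by (simp add: ennreal_mult_divide_eq)
  qed
  have "(\<integral>\<^sup>+t. (\<Prod>j<Suc n. h j (digit t j)) * indicator {0<..<1} t \<partial>lborel)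
      = (\<integral>\<^sup>+t. h 0 (- 1) * G (0 + 2 * t) + h 0 1 * G (- 1 + 2 * t) \<partial>lborel)"
  proof (rule nn_integral_cong_AE)
    have "AE t in lborel. t \<noteq> (1 / 2 :: real)" by (rule AE_lborel_singleton)
    then show "AE t in lborel. (\<Prod>j<Suc n. h j (digit t j)) * indicator {0<..<1} t
        = h 0 (- 1) * G (0 + 2 * t) + h 0 1 * G (- 1 + 2 * t)"
    proof eventually_elim
      case (elim t)
      consider "t \<le> 0" | "0 < t" "t < 1 / 2" | "1 / 2 < t" "t < 1" | "1 \<le> t" using elim by linarith
      then show ?case
      proof cases
        case 2
        then have "\<lfloor>2 * t\<rfloor> = 0" by (simp add: floor_eq_iff)
        then have "digit t 0 = - 1" by (simp add: digit_def)
        then show ?thesis using 2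
          by (simp add: prod.lessThan_Suc_shift digit_Suc digit_minus_1[of "2 * t"] G_def mult.assoc del: prod.lessThan_Suc)
      next
        case 3
        then have "\<lfloor>2 * t\<rfloor> = 1" by (simp add: floor_eq_iff)
        then have "digit t 0 = 1" by (simp add: digit_def)
        then show ?thesis using 3
          by (simp add: prod.lessThan_Suc_shift digit_Suc digit_minus_1[of "2 * t"] G_def mult.assoc del: prod.lessThan_Suc)
      qed (simp_all add: G_def)
    qed
  qed
  also have "\<dots> = h 0 (- 1) * (\<integral>\<^sup>+t. G (0 + 2 * t) \<partial>lborel) + h 0 1 * (\<integral>\<^sup>+t. G (- 1 + 2 * t) \<partial>lborel)"
    by (simp add: nn_integral_add nn_integral_cmult)
  also have "\<dots> = h 0 (- 1) / 2 * (\<integral>\<^sup>+t. G t \<partial>lborel) + h 0 1 / 2 * (\<integral>\<^sup>+t. G t \<partial>lborel)"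
  proof -
    have "a * (\<integral>\<^sup>+t. G (s + 2 * t) \<partial>lborel) = a / 2 * (\<integral>\<^sup>+t. G t \<partial>lborel)" for a s
      by (simp only: half[of s] mult_half)
    then show ?thesis by (simp only:)
  qed
  also have "\<dots> = (h 0 1 + h 0 (- 1)) / 2 * (\<integral>\<^sup>+t. G t \<partial>lborel)"
    by (simp add: divide_ennreal_def distrib_right add.commute)
  also have "(\<integral>\<^sup>+t. G t \<partial>lborel) = (\<Prod>j<n. (h (Suc j) 1 + h (Suc j) (- 1)) / 2)"
    unfolding G_def by (rule Suc.IH)
  finally show ?case by (simp only: prod.lessThan_Suc_shift)
qed

lemma prob_space_unit_interval: "prob_space unit_interval"
  by (rule prob_spaceI) (simp add: emeasure_restrict_space space_restrict_space)

lemma measurable_digits: "digit \<in> measurable unit_interval cube"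
proof (rule measurable_to_cube)
  fix j
  have "(\<lambda>t. digit t j) \<in> measurable lborel (count_space {- 1, 1})" by measurable
  then have "(\<lambda>t. digit t j) \<in> measurable lebesgue (count_space {- 1, 1})" by (rule measurable_completion)
  then show "(\<lambda>t. digit t j) \<in> measurable unit_interval (count_space {- 1, 1})"
    by (rule measurable_restrict_space1)
qed

lemma distr_digits: "distr unit_interval cube digit = cube"
proof (rule distr_eq_cubeI[OF measurable_digits prob_space_unit_interval])
  fix h :: "nat \<Rightarrow> real \<Rightarrow> ennreal" and n
  show "(\<integral>\<^sup>+t. (\<Prod>j<3 * n. h j (digit t j)) \<partial>unit_interval) = (\<Prod>j<3 * n. (h j 1 + h j (- 1)) / 2)"
    by (subst nn_integral_restrict_space) (simp_all add: nn_integral_completion nn_integral_digits)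
qed

text \<open>The image of \<open>cube3\<close> under \<open>interleave\<close> can be computed from product functions. Its left inverse
\<open>deinterleave\<close> then carries \<open>cube\<close> back to \<open>cube3\<close>.\<close>

definition interleave :: "(nat \<Rightarrow> real) \<times> (nat \<Rightarrow> real) \<times> (nat \<Rightarrow> real) \<Rightarrow> nat \<Rightarrow> real" where
  "interleave = (\<lambda>(x, y, s) i. if i mod 3 = 0 then x (i div 3) else if i mod 3 = 1 then y (i div 3) else s (i div 3))"

definition deinterleave :: "(nat \<Rightarrow> real) \<Rightarrow> (nat \<Rightarrow> real) \<times> (nat \<Rightarrow> real) \<times> (nat \<Rightarrow> real)" where
  "deinterleave x = (\<lambda>j. x (3 * j), \<lambda>j. x (3 * j + 1), \<lambda>j. x (3 * j + 2))"

lemma deinterleave_interleave: "deinterleave (interleave p) = p"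
proof -
  have "(3 * j + 1) mod 3 = 1" "(3 * j + 2) mod 3 = 2" "(3 * j + 1) div 3 = j" "(3 * j + 2) div 3 = j" for j :: nat
    by presburger+
  then show ?thesis by (simp add: deinterleave_def interleave_def split_beta)
qed

lemma measurable_interleave: "interleave \<in> measurable cube3 cube"
proof (rule measurable_to_cube)
  fix i
  have "(\<lambda>p. interleave p i) = (if i mod 3 = 0 then (\<lambda>(x, y, s). x (i div 3))
      else if i mod 3 = 1 then (\<lambda>(x, y, s). y (i div 3)) else (\<lambda>(x, y, s). s (i div 3)))"
    by (auto simp: interleave_def)
  then show "(\<lambda>p. interleave p i) \<in> measurable cube3 (count_space {- 1, 1})"
    by (simp only: measurable_coordinate3 split: if_split) simp
qed

lemma measurable_deinterleave: "deinterleave \<in> measurable cube cube3"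
  unfolding deinterleave_def[abs_def] cube3_def
  by (intro measurable_Pair measurable_to_cube measurable_coordinate)

lemma prod_lessThan_triple:
  "(\<Prod>j<3 * n. f j) = (\<Prod>j<n. f (3 * j)) * (\<Prod>j<n. f (3 * j + 1)) * (\<Prod>j<n. f (3 * j + 2))"
  for f :: "nat \<Rightarrow> 'a::comm_monoid_mult"
proof (induction n)
  case (Suc n)
  have "3 * Suc n = Suc (Suc (Suc (3 * n)))" by simp
  then show ?case
    unfolding \<open>3 * Suc n = _\<close> prod.lessThan_Suc Suc by (simp add: mult_ac)
qed simp

lemma distr_interleave: "distr cube3 cube interleave = cube"
proof (rule distr_eq_cubeI[OF measurable_interleave cube3.prob_space_axioms])
  fix h :: "nat \<Rightarrow> real \<Rightarrow> ennreal" and n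
  define a b c where "a x = (\<Prod>j<n. h (3 * j) (x j))" and "b x = (\<Prod>j<n. h (3 * j + 1) (x j))"
    and "c x = (\<Prod>j<n. h (3 * j + 2) (x j))" for x :: "nat \<Rightarrow> real"
  have hm: "(\<lambda>x. h i (x j)) \<in> borel_measurable cube" for i j
    by (rule measurable_compose[OF measurable_coordinate]) simp
  have abc [measurable]: "a \<in> borel_measurable cube" "b \<in> borel_measurable cube" "c \<in> borel_measurable cube"
    unfolding a_def b_def c_def by (intro borel_measurable_prod_ennreal hm)+
  have mods: "(3 * j + 1) mod 3 = 1" "(3 * j + 2) mod 3 = 2" "(3 * j + 1) div 3 = j" "(3 * j + 2) div 3 = j" for j :: nat
    by presburger+
  have eq: "(\<Prod>j<3 * n. h j (interleave (x, y, s) j)) = a x * b y * c s" for x y s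
    unfolding prod_lessThan_triple a_def b_def c_def using mods by (simp add: interleave_def)
  have m: "(\<lambda>p. \<Prod>j<3 * n. h j (interleave p j)) \<in> borel_measurable cube3"
    by (intro borel_measurable_prod_ennreal measurable_compose[OF measurable_interleave hm])
  have "(\<integral>\<^sup>+p. (\<Prod>j<3 * n. h j (interleave p j)) \<partial>cube3)
      = (\<integral>\<^sup>+x. \<integral>\<^sup>+y. \<integral>\<^sup>+s. a x * b y * c s \<partial>cube \<partial>cube \<partial>cube)"
    unfolding nn_integral_cube3[OF m] eq ..
  also have "\<dots> = (\<integral>\<^sup>+x. a x \<partial>cube) * (\<integral>\<^sup>+x. b x \<partial>cube) * (\<integral>\<^sup>+x. c x \<partial>cube)"
    by (simp add: nn_integral_cmult nn_integral_multc)
  also have "\<dots> = (\<Prod>j<3 * n. (h j 1 + h j (- 1)) / 2)"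
    unfolding prod_lessThan_triple a_def b_def c_def
    using nn_integral_cube_prod[of "{..<n}" "\<lambda>j. h (3 * j)"]
      nn_integral_cube_prod[of "{..<n}" "\<lambda>j. h (3 * j + 1)"]
      nn_integral_cube_prod[of "{..<n}" "\<lambda>j. h (3 * j + 2)"]
    by (simp only: finite_lessThan)
  finally show "(\<integral>\<^sup>+p. (\<Prod>j<3 * n. h j (interleave p j)) \<partial>cube3) = (\<Prod>j<3 * n. (h j 1 + h j (- 1)) / 2)" .
qed

definition coding :: "real \<Rightarrow> (nat \<Rightarrow> real) \<times> (nat \<Rightarrow> real) \<times> (nat \<Rightarrow> real)" where
  "coding t = deinterleave (digit t)"

lemma measurable_coding: "coding \<in> measurable unit_interval cube3"
  unfolding coding_def by (rule measurable_compose[OF measurable_digits measurable_deinterleave])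

lemma distr_coding: "distr unit_interval cube3 coding = cube3"
proof -
  have "distr unit_interval cube3 coding = distr (distr unit_interval cube digit) cube3 deinterleave"
    by (subst distr_distr[OF measurable_deinterleave measurable_digits]) (simp add: coding_def[abs_def] comp_def)
  also have "\<dots> = distr (distr cube3 cube interleave) cube3 deinterleave"
    by (simp only: distr_digits distr_interleave)
  also have "\<dots> = distr cube3 cube3 (\<lambda>p. p)"
    by (subst distr_distr[OF measurable_deinterleave measurable_interleave])
      (simp add: comp_def deinterleave_interleave)
  finally show ?thesis by simp
qed

lemma integral_coding:
  fixes F :: "_ \<Rightarrow> real"
  assumes "integrable cube3 F"
  shows "integrable unit_interval (\<lambda>t. F (coding t))" "(\<integral>t. F (coding t) \<partial>unit_interval) = (\<integral>p. F p \<partial>cube3)"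
proof -
  have "integrable (distr unit_interval cube3 coding) F" using assms by (simp only: distr_coding)
  from integrable_distr[OF measurable_coding this] show "integrable unit_interval (\<lambda>t. F (coding t))" .
  have "(\<integral>p. F p \<partial>distr unit_interval cube3 coding) = (\<integral>t. F (coding t) \<partial>unit_interval)"
    by (rule integral_distr[OF measurable_coding]) (use assms in simp)
  then show "(\<integral>t. F (coding t) \<partial>unit_interval) = (\<integral>p. F p \<partial>cube3)" by (simp only: distr_coding)
qed

section \<open>Embeddings into functions on the unit interval\<close>

text \<open>One family for both embeddings: \<open>e = 1\<close> is used for \<open>L^1/R\<close> and \<open>e = 0\<close> for \<open>L^1/A\<close>.\<close>

definition shifted_D :: "real \<Rightarrow> ((nat \<Rightarrow> real) \<Rightarrow> real) \<Rightarrow> (nat \<Rightarrow> real) \<times> (nat \<Rightarrow> real) \<times> (nat \<Rightarrow> real) \<Rightarrow> real" where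
  "shifted_D e f p = e * (\<integral>x. f x \<partial>cube) + D_fun f p"

lemma integrable_shifted_D: "integrable cube f \<Longrightarrow> integrable cube3 (shifted_D e f)"
  unfolding shifted_D_def[abs_def] using D_fun_integrable[of f] by simp

lemma shifted_D_add:
  "integrable cube f \<Longrightarrow> integrable cube g \<Longrightarrow> shifted_D e (\<lambda>x. f x + g x) p = shifted_D e f p + shifted_D e g p"
  by (simp add: shifted_D_def D_fun_add algebra_simps)

lemma shifted_D_cmult: "shifted_D e (\<lambda>x. c * f x) p = c * shifted_D e f p"
  by (simp add: shifted_D_def D_fun_cmult algebra_simps)

lemma shifted_D_cong_AE:
  assumes f: "integrable cube f" and g: "integrable cube g" and eq: "AE x in cube. f x = g x"
  shows "AE p in cube3. shifted_D e f p = shifted_D e g p"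
proof -
  have "cls cube3 (D_fun f) = cls cube3 (D_fun g)"
    using D_op_cls[OF f] D_op_cls[OF g] cls_cong[OF eq] by simp
  then have "AE p in cube3. D_fun f p = D_fun g p" using D_fun_integrable[OF f] by (simp add: cls_eq_iff)
  moreover have "(\<integral>x. f x \<partial>cube) = (\<integral>x. g x \<partial>cube)" using f g eq by (intro integral_cong_AE) auto
  ultimately show ?thesis by (simp add: shifted_D_def)
qed

text \<open>A norm estimate for \<open>shifted_D\<close> on functions becomes an embedding of the quotient. The map \<open>T\<close> takes an
arbitrary representative of an arbitrary element of a coset; \<open>T_q\<close> shows that the choice is immaterial, and linearity
follows from it.\<close>

lemma embeds_quotient:
  assumes int: "\<And>g. P g \<Longrightarrow> integrable cube g" and zero: "P (\<lambda>x. 0)"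
    and kills: "\<And>g. P g \<Longrightarrow> (\<integral>p. \<bar>shifted_D e g p\<bar> \<partial>cube3) = 0"
    and "0 < c"
    and bounds: "\<And>f. integrable cube f \<Longrightarrow>
      c * nrm (quot_space (L1 cube) (cls cube ` Collect P)) (coset (L1 cube) (cls cube ` Collect P) (cls cube f))
        \<le> (\<integral>p. \<bar>shifted_D e f p\<bar> \<partial>cube3) \<and>
      (\<integral>p. \<bar>shifted_D e f p\<bar> \<partial>cube3)
        \<le> C * nrm (quot_space (L1 cube) (cls cube ` Collect P)) (coset (L1 cube) (cls cube ` Collect P) (cls cube f))"
  shows "embeds_isomorphically (quot_space (L1 cube) (cls cube ` Collect P)) (L1 unit_interval)"
proof -
  let ?V = "cls cube ` Collect P"
  let ?Q = "quot_space (L1 cube) ?V"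
  let ?q = "\<lambda>f. coset (L1 cube) ?V (cls cube f)"
  define S where "S f = cls unit_interval (\<lambda>t. shifted_D e f (coding t))" for f
  define T where "T K = S (rep (rep K))" for K
  have S_cong: "S f = S g" if "AE p in cube3. shifted_D e f p = shifted_D e g p" for f g
    unfolding S_def
    by (rule cls_cong, rule AE_distrD[OF measurable_coding]) (use that in \<open>simp only: distr_coding\<close>)
  have S_int: "integrable unit_interval (\<lambda>t. shifted_D e f (coding t))" if "integrable cube f" for f
    by (rule integral_coding(1)[OF integrable_shifted_D[OF that]])
  have S_add: "S (\<lambda>x. f x + g x) = add (L1 unit_interval) (S f) (S g)"
    if "integrable cube f" "integrable cube g" for f g
    using that S_int by (simp add: S_def L1_add_cls shifted_D_add)
  have S_scl: "S (\<lambda>x. b * f x) = scl (L1 unit_interval) b (S f)" if "integrable cube f" for b f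
    using that S_int by (simp add: S_def L1_scl_cls shifted_D_cmult)
  have S_P: "S (\<lambda>x. f x + g x) = S f" if f: "integrable cube f" and g: "P g" for f g
  proof (rule S_cong)
    have "AE p in cube3. \<bar>shifted_D e g p\<bar> = 0"
      using kills[OF g] integrable_shifted_D[OF int[OF g]] by (subst (asm) integral_nonneg_eq_0_iff_AE) auto
    then show "AE p in cube3. shifted_D e (\<lambda>x. f x + g x) p = shifted_D e f p"
      by eventually_elim (simp add: shifted_D_add[OF f int[OF g]])
  qed
  have rep_q: "\<exists>g. P g \<and> rep (?q f) = cls cube (\<lambda>x. f x + g x)" if "integrable cube f" for f
    using rep_coset[where P = P, OF that zero] int by metis
  have T_q: "T (?q f) = S f" if f: "integrable cube f" for f
  proof -
    obtain g where g: "P g" and eq: "rep (?q f) = cls cube (\<lambda>x. f x + g x)" using rep_q[OF f] by blast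
    have fg: "integrable cube (\<lambda>x. f x + g x)" using f int[OF g] by simp
    have "T (?q f) = S (\<lambda>x. f x + g x)"
      unfolding T_def eq
      by (rule S_cong, rule shifted_D_cong_AE[OF rep_cls(1)[OF fg] fg rep_cls(2)[OF fg]])
    then show ?thesis by (simp add: S_P[OF f g])
  qed
  have carr: "K \<in> carr ?Q \<longleftrightarrow> (\<exists>f. integrable cube f \<and> K = ?q f)" for K
    by (auto simp: quot_space_def carr_L1 intro!: imageI)
  have "linear_map_on ?Q (L1 unit_interval) T"
    unfolding linear_map_on_def
  proof (intro conjI ballI allI)
    show "T \<in> carr ?Q \<rightarrow> carr (L1 unit_interval)"
      unfolding carr Pi_def using T_q S_int by (auto simp: carr S_def carr_L1)
    fix K assume "K \<in> carr ?Q"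
    then obtain f where f: "integrable cube f" and K: "K = ?q f" by (auto simp: carr)
    obtain f' where f': "P f'" and rK: "rep K = cls cube (\<lambda>x. f x + f' x)" using rep_q[OF f] K by blast
    have ff': "integrable cube (\<lambda>x. f x + f' x)" using f int[OF f'] by simp
    show "T (scl ?Q b K) = scl (L1 unit_interval) b (T K)" for b
    proof -
      have "scl ?Q b K = ?q (\<lambda>x. b * (f x + f' x))"
        unfolding quot_space_def nspace.simps rK L1_scl_cls[OF ff'] ..
      then have "T (scl ?Q b K) = scl (L1 unit_interval) b (S (\<lambda>x. f x + f' x))"
        using ff' T_q[of "\<lambda>x. b * (f x + f' x)"] S_scl[OF ff'] by simp
      then show ?thesis by (simp add: S_P[OF f f'] T_q[OF f] K)
    qed
    fix L assume "L \<in> carr ?Q"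
    then obtain g where g: "integrable cube g" and L: "L = ?q g" by (auto simp: carr)
    obtain g' where g': "P g'" and rL: "rep L = cls cube (\<lambda>x. g x + g' x)" using rep_q[OF g] L by blast
    have gg': "integrable cube (\<lambda>x. g x + g' x)" using g int[OF g'] by simp
    have "add ?Q K L = ?q (\<lambda>x. (f x + f' x) + (g x + g' x))"
      unfolding quot_space_def nspace.simps rK rL L1_add_cls[OF ff' gg'] ..
    then have "T (add ?Q K L) = add (L1 unit_interval) (S (\<lambda>x. f x + f' x)) (S (\<lambda>x. g x + g' x))"
      using ff' gg' T_q[of "\<lambda>x. (f x + f' x) + (g x + g' x)"] S_add[OF ff' gg'] by simp
    then show "T (add ?Q K L) = add (L1 unit_interval) (T K) (T L)"
      by (simp add: S_P[OF f f'] S_P[OF g g'] T_q[OF f] T_q[OF g] K L)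
  qed
  moreover have "nrm (L1 unit_interval) (T (?q f)) = (\<integral>p. \<bar>shifted_D e f p\<bar> \<partial>cube3)" if "integrable cube f" for f
  proof -
    have "integrable cube3 (\<lambda>p. \<bar>shifted_D e f p\<bar>)" using integrable_shifted_D[OF that] by simp
    from integral_coding(2)[OF this] show ?thesis
      unfolding T_q[OF that] S_def by (simp add: L1_nrm_cls[OF S_int[OF that]])
  qed
  ultimately show ?thesis
    unfolding embeds_isomorphically_def
    by (intro exI[of _ T] conjI exI[of _ c] exI[of _ C] \<open>0 < c\<close>) (use bounds in \<open>auto simp: carr\<close>)
qed

lemma dist_A_le:
  assumes f: "integrable cube f"
  shows "dist_on (L1 cube) (cls cube f) A_space \<le> 10 ^ 11 * (\<integral>p. \<bar>D_fun f p\<bar> \<partial>cube3)"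
proof -
  have "two_sided_bound (10 ^ 11)" by (rule two_sided_bound_if_ge) simp
  moreover have "cls cube f \<in> carr (L1 cube)" using f by (auto simp: carr_L1)
  ultimately have "1 / 10 ^ 11 * dist_on (L1 cube) (cls cube f) A_space \<le> (\<integral>p. \<bar>D_fun f p\<bar> \<partial>cube3)"
    unfolding two_sided_bound_def nrm_D_op[OF f, symmetric] by blast
  then show ?thesis by simp
qed

text \<open>The function \<open>H = E f + Df\<close> has integral \<open>E f\<close>, hence \<open>\<bar>E f\<bar> \<le> \<parallel>H\<parallel>\<^sub>1\<close> and
\<open>\<parallel>Df\<parallel>\<^sub>1 \<le> 2 \<parallel>H\<parallel>\<^sub>1\<close>.\<close>

lemma embeds_L1_mod_R: "embeds_isomorphically (quot_space (L1 cube) R_space) (L1 unit_interval)"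
  unfolding R_space_eq
proof (rule embeds_quotient[where e = 1 and c = "1 / (1 + 4 * 10 ^ 11)" and C = 5])
  show "(\<integral>p. \<bar>shifted_D 1 g p\<bar> \<partial>cube3) = 0" if "rademacher_limit g" for g
    using D_fun_affine_limit[OF rademacher_limit_affine_limit[OF that]]
    by (simp add: shifted_D_def integral_rademacher_limit[OF that])
  fix f :: "(nat \<Rightarrow> real) \<Rightarrow> real" assume f: "integrable cube f"
  let ?E = "\<integral>x. f x \<partial>cube" and ?D = "\<integral>p. \<bar>D_fun f p\<bar> \<partial>cube3" and ?H = "\<integral>p. \<bar>shifted_D 1 f p\<bar> \<partial>cube3"
  note i = integrable_shifted_D[OF f, of 1] and D = D_fun_integrable[OF f]
  have "(\<integral>p. shifted_D 1 f p \<partial>cube3) = ?E"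
    using D by (simp add: shifted_D_def integral_D_fun[OF f] cube3.prob_space)
  then have E: "\<bar>?E\<bar> \<le> ?H" using abs_integral_le[OF i] by simp
  have "?D \<le> (\<integral>p. \<bar>shifted_D 1 f p\<bar> + \<bar>?E\<bar> \<partial>cube3)"
    by (rule integral_mono) (use i D in \<open>auto simp: shifted_D_def\<close>)
  also have "\<dots> = ?H + \<bar>?E\<bar>" using i by (simp add: cube3.prob_space)
  finally have D2: "?D \<le> 2 * ?H" using E by simp
  have lower: "quot_nrm_R f \<le> (1 + 4 * 10 ^ 11) * ?H"
    using quot_nrm_R_le[OF f] dist_A_le[OF f] E D2 by simp
  have "?H \<le> (\<integral>p. \<bar>?E\<bar> + \<bar>D_fun f p\<bar> \<partial>cube3)"
    by (rule integral_mono) (use i D in \<open>auto simp: shifted_D_def\<close>)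
  also have "\<dots> = \<bar>?E\<bar> + ?D" using D by (simp add: cube3.prob_space)
  finally have "?H \<le> 5 * quot_nrm_R f" using quot_nrm_R_upper[OF f] by simp
  with lower show "1 / (1 + 4 * 10 ^ 11) * nrm (quot_space (L1 cube) (cls cube ` Collect rademacher_limit))
        (coset (L1 cube) (cls cube ` Collect rademacher_limit) (cls cube f)) \<le> ?H \<and>
      ?H \<le> 5 * nrm (quot_space (L1 cube) (cls cube ` Collect rademacher_limit))
        (coset (L1 cube) (cls cube ` Collect rademacher_limit) (cls cube f))"
    by (simp add: R_space_eq)
qed (simp_all add: rademacher_limit_zero rademacher_limit_integrable)

lemma embeds_L1_mod_A: "embeds_isomorphically (quot_space (L1 cube) A_space) (L1 unit_interval)"
  unfolding A_space_eq
proof (rule embeds_quotient[where e = 0 and c = "1 / 10 ^ 11" and C = 4])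
  show "(\<integral>p. \<bar>shifted_D 0 g p\<bar> \<partial>cube3) = 0" if "affine_limit g" for g
    using D_fun_affine_limit[OF that] by (simp add: shifted_D_def)
  fix f :: "(nat \<Rightarrow> real) \<Rightarrow> real" assume f: "integrable cube f"
  let ?V = "cls cube ` Collect affine_limit"
  let ?n = "nrm (quot_space (L1 cube) ?V) (coset (L1 cube) ?V (cls cube f))"
  let ?D = "\<integral>p. \<bar>D_fun f p\<bar> \<partial>cube3"
  have "?n \<le> dist_on (L1 cube) (cls cube f) ?V"
  proof (rule le_dist_on_cls[where P = affine_limit, OF f affine_limit_zero affine_limit_integrable])
    show "?n \<le> (\<integral>x. \<bar>f x - g x\<bar> \<partial>cube)" if "affine_limit g" for g
      using quot_nrm_le[where P = affine_limit, OF f affine_limit_uminus[OF that] affine_limit_integrable]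
      by simp
  qed
  also have "\<dots> \<le> 10 ^ 11 * ?D"
    using dist_A_le[OF f] by (simp only: A_space_eq)
  finally have lower: "?n \<le> 10 ^ 11 * ?D" .
  have "?D / 4 \<le> ?n"
  proof (rule le_quot_nrm[where P = affine_limit, OF f affine_limit_zero affine_limit_integrable])
    show "?D / 4 \<le> (\<integral>x. \<bar>f x + g x\<bar> \<partial>cube)" if "affine_limit g" for g
      using D_fun_le_distance[OF f affine_limit_uminus[OF that]] by simp
  qed
  with lower show "1 / 10 ^ 11 * ?n \<le> (\<integral>p. \<bar>shifted_D 0 f p\<bar> \<partial>cube3) \<and>
      (\<integral>p. \<bar>shifted_D 0 f p\<bar> \<partial>cube3) \<le> 4 * ?n"
    by (simp add: shifted_D_def)
qed (simp_all add: affine_limit_zero affine_limit_integrable)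

text \<open>A crude bound suffices, because \<open>198^5 > 10^11\<close>. The exponent \<open>4/5\<close> is lowered to \<open>5/7\<close> to make
\<open>128 = 2^7\<close> a convenient base.\<close>

lemma const_B0_ge: "198 \<le> const_B0"
proof -
  have "(6 :: real) powr 2 \<le> 6 powr (7 / 3)" by (rule powr_mono) auto
  then have A0: "38 \<le> const_A0" by (simp add: const_A0_def const_gamma_def)
  have "(32 :: real) = 128 powr (5 / 7)"
  proof -
    have "(128 :: real) powr (5 / 7) = (2 powr 7) powr (5 / 7)" by simp
    also have "\<dots> = 2 powr 5" by (simp only: powr_powr) simp
    finally show ?thesis by simp
  qed
  also have "\<dots> \<le> 128 powr (4 / 5)" by (rule powr_mono) auto
  also have "\<dots> \<le> (1 + 4 * const_A0) powr (4 / 5)" by (rule powr_mono2) (use A0 in auto)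
  finally have 1: "32 \<le> (1 + 4 * const_A0) powr (4 / 5)" .
  have "(4 :: real) powr 0 \<le> 4 powr (1 / 5)" by (rule powr_mono) auto
  then have "1 * 32 \<le> 4 powr (1 / 5) * (1 + 4 * const_A0) powr (4 / 5)"
    by (intro mult_mono 1) auto
  then show ?thesis using A0 by (simp add: const_B0_def)
qed

theorem theorem1:
  "(\<exists>C\<ge>1. two_sided_bound C) \<and>
   {F \<in> carr (L1 cube). D_op F = zer (L1 cube3)} = A_space \<and>
   (\<exists>J \<in> carr (quot_space (L1 cube) R_space) \<rightarrow> carr (sum1 real_line (L1 cube3)).
     (\<forall>F\<in>carr (L1 cube). J (coset (L1 cube) R_space F) = (expect F, D_op F)) \<and>
     (\<forall>C\<ge>1. two_sided_bound C \<longrightarrow>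
       (\<forall>F\<in>carr (L1 cube).
         1 / (2 * C) * nrm (quot_space (L1 cube) R_space) (coset (L1 cube) R_space F)
           \<le> nrm (sum1 real_line (L1 cube3)) (J (coset (L1 cube) R_space F)) \<and>
         nrm (sum1 real_line (L1 cube3)) (J (coset (L1 cube) R_space F))
           \<le> 5 * nrm (quot_space (L1 cube) R_space) (coset (L1 cube) R_space F)))) \<and>
   embeds_isomorphically (quot_space (L1 cube) R_space) (L1 (lebesgue_on {0<..<1::real})) \<and>
   embeds_isomorphically (quot_space (L1 cube) A_space) (L1 (lebesgue_on {0<..<1::real})) \<and>
   const_B0 ^ 5 \<ge> 1 \<and> two_sided_bound (const_B0 ^ 5)"
proof -
  have "(198 :: real) ^ 5 \<le> const_B0 ^ 5" by (rule power_mono[OF const_B0_ge]) simp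
  then have B: "10 ^ 11 \<le> const_B0 ^ 5" by simp
  then have B1: "1 \<le> const_B0 ^ 5" by simp
  show ?thesis
    using two_sided_bound_if_ge[OF B] B1 kernel_D_op quotient_map_bounds embeds_L1_mod_R embeds_L1_mod_A by blast
qed

end
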